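(* Let $G$ be a locally compact group and let $\kappa(G)$ be the smallest cardinality of a covering of $G$ by compact subsets. If $\kappa(G)>\aleph_0$, then $\mathrm{TLIM}_0(G)=\mathrm{TLIM}(G)$.
   Context: All groups are Hausdorff; $|E|$ is the left Haar measure of $E\subset G$. $L_\infty(G)$ is the algebra of bounded locally measurable functions modulo equality off locally null sets, the dual of $L_1(G)$. $M(G)$ is the set of means on $L_\infty(G)$: linear functionals $\mu$ with $\|\mu\|=1$, $\mu\ge0$; write $\mu(E)=\mu(\mathbb 1_E)$. $P_1(G)=\{f\in L_1(G):f\ge0,\ \|f\|_1=1\}$. $\mathrm{TLIM}(G)$ is the set of $\mu\in M(G)$ with $\mu(f*\phi)=\mu(\phi)$ for all $f\in P_1(G)$, $\phi\in L_\infty(G)$. For a finite measurable partition $\mathcal P$ of $G$ and $\epsilon\in(0,1)$, $\mathcal N(\mu,\mathcal P,\epsilon)=\{\nu\in M(G):|\mu(E)-\nu(E)|<\epsilon\ \text{for all }E\in\mathcal P\}$. For compact $A\subset G$ with $|A|>0$, $\mu_A=\mathbb 1_A/|A|$, regarded as a mean on $L_\infty(G)$. For compact $K\subset G$ and $\epsilon\in(0,1)$, $\mathscr C^+(K,\epsilon)$ is the set of compact $A\subset G$ with $|A|>0$ and $|xA\,\triangle\,A|/|A|<\epsilon$ for each $x\in K$. Then $\mathrm{TLIM}_0(G)$ is the set of $\mu\in\mathrm{TLIM}(G)$ such that for all finite measurable partitions $\mathcal P$ of $G$, compact $K\subset G$ and $\epsilon\in(0,1)$ there exists $A\in\mathscr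 C^+(K,\epsilon)$ with $\mu_A\in\mathcal N(\mu,\mathcal P,\epsilon)$ (i.e. $\mu$ is a limit point of a topological Følner net). *)

theory Defs
  imports "HOL-Analysis.Analysis" "HOL-Library.Disjoint_Sets"
begin

unbundle cardinal_syntax

(* Groups are written additively, but the class group_add is not commutative: the product xy is
   x + y, the inverse of y is -y, and the left translate xA is (+) x ` A. *)

section \<open>The compact covering number\<close>

definition compact_covering :: "'a::topological_space set set \<Rightarrow> bool" where
  "compact_covering C \<longleftrightarrow> (\<forall>K\<in>C. compact K) \<and> \<Union>C = UNIV"

definition minimal_compact_covering :: "'a::topological_space set set \<Rightarrow> bool" where
  "minimal_compact_covering C \<longleftrightarrow>
     compact_covering C \<and> (\<forall>D::'a set set. compact_covering D \<longrightarrow> |C| \<le>o |D| )"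

(* A cardinal is represented by a cardinal order, so this is determined up to =o. *)
definition compact_covering_number :: "'a::topological_space set rel" where
  "compact_covering_number = |SOME C::'a set set. minimal_compact_covering C|"

lemma minimal_compact_covering_exists:
  "\<exists>C::'a::topological_space set set. minimal_compact_covering C"
proof -
  let ?R = "card_of ` {C::'a set set. compact_covering C}"
  have "compact_covering (range (\<lambda>x::'a. {x}))"
    by (auto simp: compact_covering_def)
  then have "?R \<noteq> {}" by blast
  moreover have "\<forall>r\<in>?R. Card_order r" by (auto simp: card_of_Card_order)
  ultimately have "\<exists>r\<in>?R. \<forall>r'\<in>?R. r \<le>o r'" by (rule exists_minim_Card_order)
  then show ?thesis by (auto simp: minimal_compact_covering_def)
qed


section \<open>Left Haar measure\<close>

definition left_haar_measure :: "'a::{topological_group_add,t2_space} measure \<Rightarrow> bool" where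
  "left_haar_measure m \<longleftrightarrow>
     sets m = sets borel \<and>
     emeasure m UNIV \<noteq> 0 \<and>
     (\<forall>x. \<forall>E\<in>sets borel. emeasure m ((+) x ` E) = emeasure m E) \<and>
     (\<forall>K. compact K \<longrightarrow> emeasure m K < \<infinity>) \<and>
     (\<forall>E\<in>sets borel. emeasure m E = (INF U\<in>{U. open U \<and> E \<subseteq> U}. emeasure m U)) \<and>
     (\<forall>U. open U \<longrightarrow> emeasure m U = (SUP K\<in>{K. compact K \<and> K \<subseteq> U}. emeasure m K))"


section \<open>The spaces of essentially bounded and of integrable functions\<close>

definition locally_measurable :: "'a measure \<Rightarrow> 'a set \<Rightarrow> bool" where
  "locally_measurable m E \<longleftrightarrow> (\<forall>F\<in>sets m. emeasure m F < \<infinity> \<longrightarrow> E \<inter> F \<in> sets m)"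

definition locally_null :: "'a measure \<Rightarrow> 'a set \<Rightarrow> bool" where
  "locally_null m E \<longleftrightarrow> (\<forall>F\<in>sets m. emeasure m F < \<infinity> \<longrightarrow> E \<inter> F \<in> null_sets m)"

(* Elements of L_infinity are handled through representatives: functionals on L_infinity are
   functionals on Linf m that do not distinguish functions equal off a locally null set. *)
definition Linf :: "'a measure \<Rightarrow> ('a \<Rightarrow> complex) set" where
  "Linf m = {\<phi>. bounded (range \<phi>) \<and> (\<forall>B\<in>sets borel. locally_measurable m (\<phi> -` B))}"

definition locally_eq :: "'a measure \<Rightarrow> ('a \<Rightarrow> complex) \<Rightarrow> ('a \<Rightarrow> complex) \<Rightarrow> bool" where
  "locally_eq m \<phi> \<psi> \<longleftrightarrow> locally_null m {x. \<phi> x \<noteq> \<psi> x}"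

definition Linf_norm :: "'a measure \<Rightarrow> ('a \<Rightarrow> complex) \<Rightarrow> real" where
  "Linf_norm m \<phi> = Inf {c. 0 \<le> c \<and> locally_null m {x. c < cmod (\<phi> x)}}"

definition P1 :: "'a measure \<Rightarrow> ('a \<Rightarrow> real) set" where
  "P1 m = {f. integrable m f \<and> (AE x in m. 0 \<le> f x) \<and> (\<integral>x. \<bar>f x\<bar> \<partial>m) = 1}"

definition convolution ::
    "'a::group_add measure \<Rightarrow> ('a \<Rightarrow> real) \<Rightarrow> ('a \<Rightarrow> complex) \<Rightarrow> ('a \<Rightarrow> complex)" where
  "convolution m f \<phi> = (\<lambda>x. \<integral>y. f y *\<^sub>R \<phi> (- y + x) \<partial>m)"


section \<open>Means\<close>

(* Functionals are extensional, so that equality of functionals is equality on Linf m.  The norm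
   condition is stated in ennreal, where an unbounded functional has supremum infinity. *)
definition means :: "'a measure \<Rightarrow> (('a \<Rightarrow> complex) \<Rightarrow> complex) set" where
  "means m = {\<mu> \<in> extensional (Linf m).
     (\<forall>\<phi>\<in>Linf m. \<forall>\<psi>\<in>Linf m. locally_eq m \<phi> \<psi> \<longrightarrow> \<mu> \<phi> = \<mu> \<psi>) \<and>
     (\<forall>\<phi>\<in>Linf m. \<forall>\<psi>\<in>Linf m. \<mu> (\<lambda>x. \<phi> x + \<psi> x) = \<mu> \<phi> + \<mu> \<psi>) \<and>
     (\<forall>c. \<forall>\<phi>\<in>Linf m. \<mu> (\<lambda>x. c * \<phi> x) = c * \<mu> \<phi>) \<and>
     (SUP \<phi>\<in>{\<phi>\<in>Linf m. Linf_norm m \<phi> \<le> 1}. ennreal (cmod (\<mu> \<phi>))) = 1 \<and>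
     (\<forall>\<phi>\<in>Linf m. locally_null m {x. \<phi> x \<notin> \<real>\<^sub>\<ge>\<^sub>0} \<longrightarrow> \<mu> \<phi> \<in> \<real>\<^sub>\<ge>\<^sub>0)}"

definition TLIM :: "'a::{topological_group_add,t2_space} measure \<Rightarrow> (('a \<Rightarrow> complex) \<Rightarrow> complex) set"
  where "TLIM m = {\<mu> \<in> means m. \<forall>f\<in>P1 m. \<forall>\<phi>\<in>Linf m. \<mu> (convolution m f \<phi>) = \<mu> \<phi>}"

(* Any E with indicator function in Linf is allowed as a piece of a partition.  Requiring Borel
   pieces instead changes nothing: a locally measurable set is Borel up to a locally null set. *)
definition finite_measurable_partition :: "'a measure \<Rightarrow> 'a set set \<Rightarrow> bool" where
  "finite_measurable_partition m \<P> \<longleftrightarrow>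
     finite \<P> \<and> partition_on UNIV \<P> \<and> (\<forall>E\<in>\<P>. locally_measurable m E)"

definition mean_nhd ::
    "'a measure \<Rightarrow> (('a \<Rightarrow> complex) \<Rightarrow> complex) \<Rightarrow> 'a set set \<Rightarrow> real \<Rightarrow> (('a \<Rightarrow> complex) \<Rightarrow> complex) set"
  where
  "mean_nhd m \<mu> \<P> \<epsilon> = {\<nu> \<in> means m. \<forall>E\<in>\<P>. cmod (\<mu> (indicator E) - \<nu> (indicator E)) < \<epsilon>}"

definition L1_functional :: "'a measure \<Rightarrow> ('a \<Rightarrow> real) \<Rightarrow> (('a \<Rightarrow> complex) \<Rightarrow> complex)" where
  "L1_functional m f = restrict (\<lambda>\<phi>. \<integral>x. f x *\<^sub>R \<phi> x \<partial>m) (Linf m)"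

definition mean_of_set :: "'a measure \<Rightarrow> 'a set \<Rightarrow> (('a \<Rightarrow> complex) \<Rightarrow> complex)" where
  "mean_of_set m A = L1_functional m (\<lambda>x. indicator A x / measure m A)"

definition folner_sets ::
    "'a::{topological_group_add,t2_space} measure \<Rightarrow> 'a set \<Rightarrow> real \<Rightarrow> 'a set set" where
  "folner_sets m K \<epsilon> = {A. compact A \<and> measure m A > 0 \<and>
     (\<forall>x\<in>K. measure m (sym_diff ((+) x ` A) A) / measure m A < \<epsilon>)}"

definition TLIM0 :: "'a::{topological_group_add,t2_space} measure \<Rightarrow> (('a \<Rightarrow> complex) \<Rightarrow> complex) set"
  where "TLIM0 m = {\<mu> \<in> TLIM m. \<forall>\<P> K \<epsilon>.
     finite_measurable_partition m \<P> \<and> compact K \<and> 0 < \<epsilon> \<and> \<epsilon> < 1 \<longrightarrow>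
     (\<exists>A\<in>folner_sets m K \<epsilon>. mean_of_set m A \<in> mean_nhd m \<mu> \<P> \<epsilon>)}"

end

theory Submission
  imports Defs "HOL-Library.Set_Algebras" "HOL-Library.Countable_Set_Type"
begin

text \<open>
  For a compact set \<open>A\<close> write \<open>Ax\<close> for its right translate. Since \<open>\<mu>\<close> is topologically invariant,
  \<open>\<mu>(E)\<close> is the \<open>\<mu>\<close>-mean of the function \<open>x \<mapsto> \<mu>\<^bsub>Ax\<^esub>(E)\<close>, and every \<open>Ax\<close> is as invariant under
  left translation as \<open>A\<close> is. Sort the points \<open>x\<close> into finitely many cells according to the
  approximate value of \<open>(\<mu>\<^bsub>Ax\<^esub>(E))\<^bsub>E \<in> P\<^esub>\<close>. As \<open>G\<close> is not sigma-compact, \<open>\<mu>\<close> vanishes on sigma-compact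
  sets (such a set lies in a sigma-compact open subgroup, which has infinitely many cosets). So in
  every cell of positive mass one finds arbitrarily many \<open>x\<close> for which the sets \<open>Ax\<close> are pairwise
  disjoint and of nearly the same measure, and the union of suitably many \<open>Ax\<close> from each cell is the
  required Folner set.

  A Folner set \<open>A\<close> to start from is obtained from \<open>\<mu>\<close> by Day's convexity argument followed by
  Namioka's level set argument. If no convex combination \<open>g\<close> of right translates of a
  density \<open>q\<close> were nearly invariant under left translation by finitely many \<open>k\<close>, then the Hahn--Banach
  theorem would provide bounded functionals \<open>L\<^sub>k\<close> on integrable functions with
  \<open>\<Sum>\<^sub>k (L\<^sub>k(k q * \<delta>\<^sub>x) - L\<^sub>k(q * \<delta>\<^sub>x))\<close> bounded away from \<open>0\<close>, uniformly in \<open>x\<close>. But the \<open>\<mu>\<close>-mean of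
  \<open>x \<mapsto> L(q * \<delta>\<^sub>x)\<close> is unchanged when \<open>q\<close> is replaced by a right translate, so by the uniqueness
  of Haar measure it depends on the integral of \<open>q\<close> only.
\<close>

text \<open>The obstacle in passing from \<open>A\<close> to a union of translates is that the group
  may be non-unimodular: the translate of \<open>A\<close> by \<open>x\<close> has measure
  \<open>modular (- x) * measure m A\<close>, so a union weights its pieces unequally and a count
  proportional to the mass of a cell would give the wrong mean. Hence a cell is sliced by powers of
  \<open>1 + \<theta>\<close>. There are countably many slices, so if each lay in a compact set the
  cell would have mass zero; some slice escapes every compact set, and the number of translates
  taken there is proportional to the mass of the cell divided by the size of the slice. Left
  invariance survives because left and right translations commute: the defect of a translate carries
  the same modular factor as its measure.

  The initial set must be invariant under a compact \<open>K\<close>, while the Hahn--Banach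
  argument handles finitely many translations. The small translations left over are absorbed by a
  thickening. This is why the densities are combinations of indicators of right translates of one
  compact set: thickening that set costs the same relative amount on every translate.\<close>

lemma small_factor:
  fixes c e :: real
  assumes "c \<ge> 0" "e > 0"
  obtains d where "d > 0" "d * c < e"
proof (rule that[of "e / (c + 1)"])
  have "0 < c + 1" using assms(1) by linarith
  then show "e / (c + 1) > 0" "e / (c + 1) * c < e"
    using assms by (auto simp: field_simps)
qed

lemma eq_0_if_abs_le_all:
  fixes x c :: real
  assumes "c \<ge> 0" "\<And>e. e > 0 \<Longrightarrow> \<bar>x\<bar> \<le> e * c"
  shows "x = 0"
proof (rule ccontr)
  assume "x \<noteq> 0"
  then have "\<bar>x\<bar> > 0" by simp
  then obtain d where "d > 0" "d * c < \<bar>x\<bar>" using small_factor[OF assms(1)] by blast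
  then show False using assms(2)[of d] by linarith
qed

text \<open>Geometric slicing, with \<open>i\<close> the floor of the logarithm. Taken with
  \<open>r = 1 + \<theta>\<close>, it sorts the measures of right translates into countably many
  classes, each known up to the factor \<open>r\<close>.\<close>

lemma real_powr_interval:
  fixes r a :: real
  assumes "r > 1" "a > 0"
  shows "\<exists>i :: int. r powr of_int i \<le> a \<and> a < r * r powr of_int i"
proof (intro exI conjI)
  let ?i = "\<lfloor>log r a\<rfloor>"
  have "r powr of_int ?i \<le> r powr log r a" using assms by (intro powr_mono) auto
  then show "r powr of_int ?i \<le> a" using assms by simp
  have "r powr log r a < r powr (of_int ?i + 1)" using assms by (intro powr_less_mono) auto
  then show "a < r * r powr of_int ?i" using assms by (simp add: powr_add mult.commute)
qed


section \<open>Topological groups\<close>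

lemma compact_left_translate:
  fixes A :: "'a::topological_group_add set"
  shows "compact A \<Longrightarrow> compact ((+) a ` A)"
  by (intro compact_continuous_image continuous_intros)

lemma compact_right_translate:
  fixes A :: "'a::topological_group_add set"
  shows "compact A \<Longrightarrow> compact ((\<lambda>y. y + a) ` A)"
  by (intro compact_continuous_image continuous_intros)

lemma compact_uminus_image:
  fixes A :: "'a::topological_group_add set"
  shows "compact A \<Longrightarrow> compact (uminus ` A)"
  by (intro compact_continuous_image continuous_intros)

lemma compact_set_plus:
  fixes A B :: "'a::topological_group_add set"
  assumes "compact A" "compact B"
  shows "compact (A + B)"
proof -
  have "A + B = (\<lambda>(x, y). x + y) ` (A \<times> B)"
    by (auto simp: set_plus_def)
  then show ?thesis
    using assms by (auto intro!: compact_continuous_image compact_Times continuous_intros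
        simp: case_prod_unfold)
qed

lemma left_translate_eq_vimage:
  fixes A :: "'a::group_add set"
  shows "(+) a ` A = (\<lambda>x. - a + x) -` A"
  by (force simp: image_iff)

lemma right_translate_eq_vimage:
  fixes A :: "'a::group_add set"
  shows "(\<lambda>y. y + a) ` A = (\<lambda>x. x - a) -` A"
  by (force simp: image_iff)

lemma uminus_image_eq_vimage:
  fixes A :: "'a::group_add set"
  shows "uminus ` A = uminus -` A"
  by (force simp: image_iff)

lemma open_left_translate:
  fixes A :: "'a::topological_group_add set"
  shows "open A \<Longrightarrow> open ((+) a ` A)"
  unfolding left_translate_eq_vimage by (intro open_vimage continuous_intros)

lemma open_right_translate:
  fixes A :: "'a::topological_group_add set"
  shows "open A \<Longrightarrow> open ((\<lambda>y. y + a) ` A)"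
  unfolding right_translate_eq_vimage by (intro open_vimage continuous_intros)

lemma open_uminus_image:
  fixes A :: "'a::topological_group_add set"
  shows "open A \<Longrightarrow> open (uminus ` A)"
  unfolding uminus_image_eq_vimage by (intro open_vimage continuous_intros)

lemma open_set_plus:
  fixes A B :: "'a::topological_group_add set"
  assumes "open B"
  shows "open (A + B)"
proof -
  have "A + B = (\<Union>a\<in>A. (+) a ` B)"
    by (auto simp: set_plus_def)
  then show ?thesis using assms by (auto intro: open_left_translate)
qed

lemma open_set_plus':
  fixes A B :: "'a::topological_group_add set"
  assumes "open A"
  shows "open (A + B)"
proof -
  have "A + B = (\<Union>b\<in>B. (\<lambda>y. y + b) ` A)"
    by (auto simp: set_plus_def)
  then show ?thesis using assms by (auto intro: open_right_translate)
qed

lemma borel_left_translate: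
  fixes A :: "'a::topological_group_add set"
  assumes "A \<in> sets borel"
  shows "(+) a ` A \<in> sets borel"
proof -
  have "(\<lambda>x. - a + x) \<in> borel_measurable borel"
    by (intro borel_measurable_continuous_onI continuous_intros)
  then show ?thesis
    unfolding left_translate_eq_vimage using assms by (metis measurable_sets_borel)
qed

lemma borel_right_translate:
  fixes A :: "'a::topological_group_add set"
  assumes "A \<in> sets borel"
  shows "(\<lambda>y. y + a) ` A \<in> sets borel"
proof -
  have "(\<lambda>x. x - a) \<in> borel_measurable borel"
    by (intro borel_measurable_continuous_onI continuous_intros)
  then show ?thesis
    unfolding right_translate_eq_vimage using assms by (metis measurable_sets_borel)
qed

lemma compact_in_borel: "compact (K :: 'a::t2_space set) \<Longrightarrow> K \<in> sets borel"
  by (simp add: borel_closed compact_imp_closed)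

text \<open>The tube lemma, applied to the preimage of \<open>U\<close> under addition, which
  contains the product of \<open>{0}\<close> and \<open>A\<close>.\<close>

lemma compact_open_thickening:
  fixes A :: "'a::topological_group_add set"
  assumes "compact A" "open U" "A \<subseteq> U"
  obtains N where "open N" "0 \<in> N" "\<And>t a. t \<in> N \<Longrightarrow> a \<in> A \<Longrightarrow> t + a \<in> U"
proof -
  have "open {p :: 'a \<times> 'a. fst p + snd p \<in> U}"
    using assms(2) by (intro open_vimage[of U "\<lambda>p. fst p + snd p", unfolded vimage_def]
        continuous_intros)
  moreover have "{0} \<times> A \<subseteq> {p :: 'a \<times> 'a. fst p + snd p \<in> U}"
    using assms(3) by auto
  ultimately obtain N where "0 \<in> N" "open N" "N \<times> A \<subseteq> {p. fst p + snd p \<in> U}"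
    using Elementary_Topology.tube_lemma[OF assms(1), of "{p. fst p + snd p \<in> U}" 0] by blast
  then show ?thesis by (intro that[of N]) auto
qed


section \<open>Functions with compact support\<close>

definition cc :: "('a::topological_space \<Rightarrow> real) \<Rightarrow> bool" where
  "cc f \<longleftrightarrow> continuous_on UNIV f \<and> (\<exists>K. compact K \<and> (\<forall>x. x \<notin> K \<longrightarrow> f x = 0))"

text \<open>The working class of integrands: it contains the \<open>cc\<close> functions and the
  indicators of compact sets, and its members are integrable against any measure that is finite on
  compact sets.\<close>

definition bcs :: "('a::topological_space \<Rightarrow> real) \<Rightarrow> bool" where
  "bcs f \<longleftrightarrow> f \<in> borel_measurable borel \<and> (\<exists>C. \<forall>x. \<bar>f x\<bar> \<le> C)
     \<and> (\<exists>K. compact K \<and> (\<forall>x. x \<notin> K \<longrightarrow> f x = 0))"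

lemma cc_imp_bcs:
  assumes "cc f" shows "bcs f"
proof -
  obtain K where f: "continuous_on UNIV f" and K: "compact K" "\<And>x. x \<notin> K \<Longrightarrow> f x = 0"
    using assms by (auto simp: cc_def)
  have "compact (f ` K)"
    using f K(1) by (meson compact_continuous_image continuous_on_subset subset_UNIV)
  then obtain C where C: "\<And>x. x \<in> K \<Longrightarrow> \<bar>f x\<bar> \<le> C"
    by (metis bounded_iff compact_imp_bounded imageI real_norm_def)
  have "\<bar>f x\<bar> \<le> max C 0" for x
    using C[of x] K(2)[of x] by (cases "x \<in> K") auto
  then show ?thesis
    unfolding bcs_def using f K by (metis borel_measurable_continuous_onI)
qed

lemma bcsE:
  assumes "bcs f"
  obtains K C where "f \<in> borel_measurable borel" "\<And>x. \<bar>f x\<bar> \<le> C" "0 \<le> C"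
    "compact K" "\<And>x. x \<notin> K \<Longrightarrow> f x = 0"
  using assms unfolding bcs_def by (metis abs_ge_zero order_trans)

lemma bcs_add:
  assumes "bcs f" "bcs g" shows "bcs (\<lambda>x. f x + g x)"
proof -
  obtain K C where f: "f \<in> borel_measurable borel" "\<And>x. \<bar>f x\<bar> \<le> C" "compact K" "\<And>x. x \<notin> K \<Longrightarrow> f x = 0"
    using assms(1) by (metis bcsE)
  obtain K' C' where g: "g \<in> borel_measurable borel" "\<And>x. \<bar>g x\<bar> \<le> C'" "compact K'" "\<And>x. x \<notin> K' \<Longrightarrow> g x = 0"
    using assms(2) by (metis bcsE)
  have "\<bar>f x + g x\<bar> \<le> C + C'" for x
    using f(2)[of x] g(2)[of x] by linarith
  moreover have "compact (K \<union> K') \<and> (\<forall>x. x \<notin> K \<union> K' \<longrightarrow> f x + g x = 0)"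
    using f g by auto
  ultimately show ?thesis
    unfolding bcs_def using borel_measurable_add[OF f(1) g(1)] by blast
qed

lemma bcs_mult_bounded:
  assumes "bcs f" "g \<in> borel_measurable borel" "\<And>x. f x \<noteq> 0 \<Longrightarrow> \<bar>g x\<bar> \<le> B"
  shows "bcs (\<lambda>x. g x * f x)"
proof -
  obtain K C where f: "f \<in> borel_measurable borel" "\<And>x. \<bar>f x\<bar> \<le> C" "0 \<le> C" "compact K" "\<And>x. x \<notin> K \<Longrightarrow> f x = 0"
    using assms(1) by (metis bcsE)
  have "\<bar>g x * f x\<bar> \<le> \<bar>B\<bar> * C" for x
  proof (cases "f x = 0")
    case True then show ?thesis using f(3) by auto
  next
    case False
    then show ?thesis using assms(3)[of x] f(2)[of x]
      unfolding abs_mult by (intro mult_mono) auto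
  qed
  moreover have "\<forall>x. x \<notin> K \<longrightarrow> g x * f x = 0" using f by auto
  ultimately show ?thesis
    unfolding bcs_def using borel_measurable_times[OF assms(2) f(1)] f(4) by blast
qed

lemma bcs_scale: "bcs f \<Longrightarrow> bcs (\<lambda>x. c * f x)"
  by (rule bcs_mult_bounded[where B = "\<bar>c\<bar>"]) auto

lemma bcs_diff: "bcs f \<Longrightarrow> bcs g \<Longrightarrow> bcs (\<lambda>x. f x - g x)"
  using bcs_add[of f "\<lambda>x. - 1 * g x"] bcs_scale[of g "-1"] by simp

lemma bcs_zero: "bcs (\<lambda>x. 0)"
  unfolding bcs_def by (intro conjI exI[of _ "{}"] exI[of _ 0]) auto

lemma bcs_sum: "finite I \<Longrightarrow> (\<And>i. i \<in> I \<Longrightarrow> bcs (f i)) \<Longrightarrow> bcs (\<lambda>x. \<Sum>i\<in>I. f i x)"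
  by (induction I rule: finite_induct) (auto intro: bcs_zero bcs_add)

lemma bcs_abs: "bcs f \<Longrightarrow> bcs (\<lambda>x. \<bar>f x\<bar>)"
  unfolding bcs_def using borel_measurable_abs by fastforce

lemma bcs_indicator:
  fixes A :: "'a::t2_space set"
  assumes "A \<in> sets borel" "A \<subseteq> K" "compact K"
  shows "bcs (indicator A)"
  unfolding bcs_def using assms by (intro conjI exI[of _ 1] exI[of _ K]) (auto simp: indicator_def)

lemma bcs_compose:
  fixes f :: "'a::topological_space \<Rightarrow> real"
  assumes "bcs f" "continuous_on UNIV h" "continuous_on UNIV k"
    and hk: "\<And>x. k (h x) = x"
  shows "bcs (\<lambda>x. f (h x))"
proof -
  obtain K C where f: "f \<in> borel_measurable borel" "\<And>x. \<bar>f x\<bar> \<le> C" "compact K" "\<And>x. x \<notin> K \<Longrightarrow> f x = 0"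
    using assms(1) by (metis bcsE)
  have "compact (k ` K)"
    using f(3) assms(3) by (meson compact_continuous_image continuous_on_subset subset_UNIV)
  moreover have "f (h x) = 0" if "x \<notin> k ` K" for x
    using that f(4)[of "h x"] hk[of x] by (metis imageI)
  moreover have "(\<lambda>x. f (h x)) \<in> borel_measurable borel"
    using f(1) assms(2) by (metis borel_measurable_continuous_onI measurable_compose)
  ultimately show ?thesis
    unfolding bcs_def using f(2) by blast
qed

lemma cc_compose:
  fixes f :: "'a::topological_space \<Rightarrow> real"
  assumes "cc f" "continuous_on UNIV h" "continuous_on UNIV k"
    and hk: "\<And>x. k (h x) = x"
  shows "cc (\<lambda>x. f (h x))"
proof -
  obtain K where f: "continuous_on UNIV f" "compact K" "\<And>x. x \<notin> K \<Longrightarrow> f x = 0"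
    using assms(1) unfolding cc_def by blast
  have "compact (k ` K)"
    using f(2) assms(3) by (meson compact_continuous_image continuous_on_subset subset_UNIV)
  moreover have "f (h x) = 0" if "x \<notin> k ` K" for x
    using that f(3)[of "h x"] hk[of x] by (metis imageI)
  moreover have "continuous_on UNIV (\<lambda>x. f (h x))"
    by (rule continuous_on_compose2[OF f(1) assms(2)]) auto
  ultimately show ?thesis
    unfolding cc_def by blast
qed

context
  fixes f :: "'a::topological_group_add \<Rightarrow> real"
begin

lemma bcs_translate_left: "bcs f \<Longrightarrow> bcs (\<lambda>x. f (a + x))"
  by (rule bcs_compose[where h = "\<lambda>x. a + x" and k = "\<lambda>x. - a + x"])
     (auto intro!: continuous_intros simp: add.assoc[symmetric])

lemma bcs_translate_right: "bcs f \<Longrightarrow> bcs (\<lambda>x. f (x + a))"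
  by (rule bcs_compose[where h = "\<lambda>x. x + a" and k = "\<lambda>x. x - a"])
     (auto intro!: continuous_intros simp: add.assoc)

lemma bcs_uminus: "bcs f \<Longrightarrow> bcs (\<lambda>x. f (- x))"
  by (rule bcs_compose[where h = uminus and k = uminus]) (auto intro!: continuous_intros)

lemma cc_translate_left: "cc f \<Longrightarrow> cc (\<lambda>x. f (a + x))"
  by (rule cc_compose[where h = "\<lambda>x. a + x" and k = "\<lambda>x. - a + x"])
     (auto intro!: continuous_intros simp: add.assoc[symmetric])

lemma cc_translate_right: "cc f \<Longrightarrow> cc (\<lambda>x. f (x + a))"
  by (rule cc_compose[where h = "\<lambda>x. x + a" and k = "\<lambda>x. x - a"])
     (auto intro!: continuous_intros simp: add.assoc)

lemma cc_uminus: "cc f \<Longrightarrow> cc (\<lambda>x. f (- x))"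
  by (rule cc_compose[where h = uminus and k = uminus]) (auto intro!: continuous_intros)

end

lemma cc_scale: "cc f \<Longrightarrow> cc (\<lambda>x. c * f x)"
  unfolding cc_def by (auto intro!: continuous_intros)

lemma cc_uniform_left:
  fixes f :: "'a::topological_group_add \<Rightarrow> real"
  assumes "cc f" "e > 0"
  obtains N where "open N" "0 \<in> N" "\<And>t z. t \<in> N \<Longrightarrow> \<bar>f (t + z) - f z\<bar> < e"
proof -
  obtain K where f: "continuous_on UNIV f" and K: "compact K" "\<And>x. x \<notin> K \<Longrightarrow> f x = 0"
    using assms(1) by (auto simp: cc_def)
  have "open {p :: 'a \<times> 'a. \<bar>f (fst p + snd p) - f (snd p)\<bar> < e}"
    by (intro open_Collect_less continuous_intros continuous_on_compose2[OF f]) auto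
  moreover have "{0} \<times> K \<subseteq> {p :: 'a \<times> 'a. \<bar>f (fst p + snd p) - f (snd p)\<bar> < e}"
    using assms(2) by auto
  ultimately obtain X where X: "0 \<in> X" "open X"
      "X \<times> K \<subseteq> {p :: 'a \<times> 'a. \<bar>f (fst p + snd p) - f (snd p)\<bar> < e}"
    using Elementary_Topology.tube_lemma[OF K(1), of "{p :: 'a \<times> 'a. \<bar>f (fst p + snd p) - f (snd p)\<bar> < e}" 0]
    by auto
  have XK: "\<bar>f (t + z) - f z\<bar> < e" if "t \<in> X" "z \<in> K" for t z
    using X(3) that by auto
  \<comment> \<open>The symmetric neighbourhood serves the case \<open>t + z \<in> K\<close>: there
    the estimate is read at the point \<open>t + z\<close> with the shift
    \<open>- t\<close>.\<close>
  let ?N = "X \<inter> uminus ` X"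
  have "\<bar>f (t + z) - f z\<bar> < e" if t: "t \<in> ?N" for t z
  proof -
    have tX: "t \<in> X" "- t \<in> X" using t by auto
    consider "z \<in> K" | "t + z \<in> K" | "z \<notin> K" "t + z \<notin> K" by blast
    then show ?thesis
    proof cases
      case 2
      then show ?thesis using XK[OF tX(2) 2] by (simp add: add.assoc[symmetric] abs_minus_commute)
    qed (use XK tX K(2) assms(2) in auto)
  qed
  moreover have "open ?N" "0 \<in> ?N"
    using X(1,2) open_uminus_image[OF X(2)] by (auto simp: uminus_image_eq_vimage)
  ultimately show ?thesis using that by blast
qed

lemma cc_uniform_right:
  fixes f :: "'a::topological_group_add \<Rightarrow> real"
  assumes "cc f" "e > 0"
  obtains N where "open N" "0 \<in> N" "\<And>t z. t \<in> N \<Longrightarrow> \<bar>f (z + t) - f z\<bar> < e"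
proof -
  obtain N where N: "open N" "0 \<in> N" "\<And>t z. t \<in> N \<Longrightarrow> \<bar>f (- (t + z)) - f (- z)\<bar> < e"
    using cc_uniform_left[OF cc_uminus[OF assms(1)] assms(2)] by metis
  have "\<bar>f (z + t) - f z\<bar> < e" if "t \<in> uminus ` N" for t z
    using that N(3)[of "- t" "- z"] by (auto simp: minus_add)
  moreover have "open (uminus ` N)" "0 \<in> uminus ` N"
    using N(1,2) open_uminus_image[OF N(1)] by (auto simp: uminus_image_eq_vimage)
  ultimately show ?thesis using that by blast
qed

lemma cc_add:
  assumes "cc f" "cc g" shows "cc (\<lambda>x. f x + g x)"
proof -
  obtain K L where "continuous_on UNIV f" "compact K" "\<And>x. x \<notin> K \<Longrightarrow> f x = 0"
    "continuous_on UNIV g" "compact L" "\<And>x. x \<notin> L \<Longrightarrow> g x = 0"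
    using assms unfolding cc_def by blast
  then show ?thesis unfolding cc_def
    by (intro conjI exI[of _ "K \<union> L"]) (auto intro!: continuous_intros)
qed

lemma cc_sum: "finite I \<Longrightarrow> (\<And>i. i \<in> I \<Longrightarrow> cc (f i)) \<Longrightarrow> cc (\<lambda>x. \<Sum>i\<in>I. f i x)"
proof (induction I rule: finite_induct)
  case empty
  show ?case unfolding cc_def by (intro conjI exI[of _ "{}"]) auto
qed (simp add: cc_add)

text \<open>The test functions of the locale \<open>invariant_mean\<close>: genuine real Borel
  functions, which embed into \<open>Linf m\<close> without any passage to equivalence
  classes.\<close>

definition bdd_borel :: "('a::topological_space \<Rightarrow> real) \<Rightarrow> bool" where
  "bdd_borel f \<longleftrightarrow> f \<in> borel_measurable borel \<and> (\<exists>C. \<forall>x. \<bar>f x\<bar> \<le> C)"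

lemma bdd_borel_add: "bdd_borel f \<Longrightarrow> bdd_borel g \<Longrightarrow> bdd_borel (\<lambda>x. f x + g x)"
proof -
  assume "bdd_borel f" "bdd_borel g"
  then obtain C D where fg: "f \<in> borel_measurable borel" "g \<in> borel_measurable borel"
    "\<And>x. \<bar>f x\<bar> \<le> C" "\<And>x. \<bar>g x\<bar> \<le> D" by (auto simp: bdd_borel_def)
  have "\<bar>f x + g x\<bar> \<le> C + D" for x using fg(3,4)[of x] by linarith
  then show ?thesis using fg(1,2) by (auto simp: bdd_borel_def)
qed

lemma bdd_borel_scale: "bdd_borel f \<Longrightarrow> bdd_borel (\<lambda>x. c * f x)"
proof -
  assume "bdd_borel f"
  then obtain C where f: "f \<in> borel_measurable borel" "\<And>x. \<bar>f x\<bar> \<le> C" by (auto simp: bdd_borel_def)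
  have "\<bar>c * f x\<bar> \<le> \<bar>c\<bar> * C" for x unfolding abs_mult using f(2)[of x] by (intro mult_left_mono) auto
  then show ?thesis using f(1) using borel_measurable_times[OF borel_measurable_const f(1)]
    unfolding bdd_borel_def by blast
qed

lemma bdd_borel_const: "bdd_borel (\<lambda>_. c)"
  by (auto simp: bdd_borel_def)

lemma bdd_borel_diff: "bdd_borel f \<Longrightarrow> bdd_borel g \<Longrightarrow> bdd_borel (\<lambda>x. f x - g x)"
  using bdd_borel_add[of f "\<lambda>x. - 1 * g x"] bdd_borel_scale[of g "-1"] by simp

lemma bdd_borel_sum: "finite I \<Longrightarrow> (\<And>i. i \<in> I \<Longrightarrow> bdd_borel (f i)) \<Longrightarrow> bdd_borel (\<lambda>x. \<Sum>i\<in>I. f i x)"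
  by (induction I rule: finite_induct) (auto intro: bdd_borel_const bdd_borel_add)

lemma bdd_borel_indicator: "A \<in> sets borel \<Longrightarrow> bdd_borel (indicator A)"
  by (auto simp: bdd_borel_def indicator_def intro!: exI[of _ 1])

lemma bdd_borel_continuous:
  "continuous_on UNIV f \<Longrightarrow> (\<And>x. \<bar>f x\<bar> \<le> C) \<Longrightarrow> bdd_borel f"
  by (auto simp: bdd_borel_def intro: borel_measurable_continuous_onI)


section \<open>Finite Borel partitions of compact sets\<close>

text \<open>Each new index takes priority on its own open set, and the old choice remains elsewhere;
  the fibres are thus built from open sets by finitely many differences and unions.\<close>

lemma finite_borel_choice:
  fixes U :: "'a::topological_space \<Rightarrow> 'a set"
  assumes "finite X" "\<And>x. x \<in> X \<Longrightarrow> open (U x)"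
  shows "\<exists>\<sigma>. (\<forall>x\<in>\<Union>(U ` X). \<sigma> x \<in> X \<and> x \<in> U (\<sigma> x)) \<and>
    (\<forall>a. {x\<in>\<Union>(U ` X). \<sigma> x = a} \<in> sets borel)"
  using assms
proof (induction X rule: finite_induct)
  case empty
  then show ?case by auto
next
  case (insert b X)
  then obtain \<sigma> where \<sigma>: "\<And>x. x \<in> \<Union>(U ` X) \<Longrightarrow> \<sigma> x \<in> X \<and> x \<in> U (\<sigma> x)"
    "\<And>a. {x\<in>\<Union>(U ` X). \<sigma> x = a} \<in> sets borel" by auto
  define \<tau> where "\<tau> x = (if x \<in> U b then b else \<sigma> x)" for x
  have "{x\<in>\<Union>(U ` insert b X). \<tau> x = a} \<in> sets borel" for a
  proof -
    have "{x\<in>\<Union>(U ` insert b X). \<tau> x = a} =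
      (if a = b then U b else {}) \<union> ({x\<in>\<Union>(U ` X). \<sigma> x = a} - U b)"
      by (auto simp: \<tau>_def)
    also have "\<dots> \<in> sets borel"
      using \<sigma>(2)[of a] insert.prems by (intro sets.Un sets.Diff) auto
    finally show ?thesis .
  qed
  moreover have "\<forall>x\<in>\<Union>(U ` insert b X). \<tau> x \<in> insert b X \<and> x \<in> U (\<tau> x)"
    using \<sigma>(1) by (auto simp: \<tau>_def)
  ultimately show ?case by blast
qed

lemma compact_borel_choice:
  fixes U :: "'a::t2_space \<Rightarrow> 'a set"
  assumes "compact K" "\<And>x. x \<in> K \<Longrightarrow> open (U x) \<and> x \<in> U x"
  obtains X \<sigma> where "finite X" "X \<subseteq> K" "\<And>x. x \<in> K \<Longrightarrow> \<sigma> x \<in> X \<and> x \<in> U (\<sigma> x)"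
    "\<And>a. {x\<in>K. \<sigma> x = a} \<in> sets borel"
proof -
  obtain X where X: "X \<subseteq> K" "finite X" "K \<subseteq> (\<Union>x\<in>X. U x)"
    using compactE_image[OF assms(1), of K U] assms(2) by (metis UN_iff subsetI)
  then obtain \<sigma> where \<sigma>: "\<And>x. x \<in> \<Union>(U ` X) \<Longrightarrow> \<sigma> x \<in> X \<and> x \<in> U (\<sigma> x)"
    "\<And>a. {x\<in>\<Union>(U ` X). \<sigma> x = a} \<in> sets borel"
    using finite_borel_choice[OF X(2), of U] assms(2) by blast
  have "{x\<in>K. \<sigma> x = a} \<in> sets borel" for a
  proof -
    have "{x\<in>K. \<sigma> x = a} = K \<inter> {x\<in>\<Union>(U ` X). \<sigma> x = a}" using X(3) by auto
    then show ?thesis using \<sigma>(2)[of a] compact_in_borel[OF assms(1)] by auto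
  qed
  moreover have "\<sigma> x \<in> X \<and> x \<in> U (\<sigma> x)" if "x \<in> K" for x
    using \<sigma>(1)[of x] X(3) that by blast
  ultimately show ?thesis using X by (intro that[of X \<sigma>])
qed

text \<open>Compactness of \<open>L\<close> makes \<open>F x\<close> uniformly close to
  \<open>F a\<close> on \<open>L\<close> for \<open>x\<close> near \<open>a\<close>; finitely many
  such \<open>a\<close> suffice for \<open>K\<close>. The fibres of \<open>\<sigma>\<close> are the
  cells of the Riemann sums below.\<close>

lemma compact_uniform_choice:
  fixes F :: "'a::t2_space \<Rightarrow> 'b::topological_space \<Rightarrow> real"
  assumes "compact K" "compact L" "continuous_on UNIV (\<lambda>(x, y). F x y)" "e > 0"
  obtains X \<sigma> where "finite X" "X \<subseteq> K" "\<And>x. x \<in> K \<Longrightarrow> \<sigma> x \<in> X"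
    "\<And>x y. x \<in> K \<Longrightarrow> y \<in> L \<Longrightarrow> \<bar>F x y - F (\<sigma> x) y\<bar> < e"
    "\<And>a. {x\<in>K. \<sigma> x = a} \<in> sets borel"
proof -
  have F: "continuous_on UNIV (\<lambda>p. F (fst p) (snd p))"
    using assms(3) by (simp add: case_prod_unfold)
  have "\<exists>U. open U \<and> a \<in> U \<and> (\<forall>x\<in>U. \<forall>y\<in>L. \<bar>F x y - F a y\<bar> < e)" for a
  proof -
    have "continuous_on UNIV (\<lambda>p::'a \<times> 'b. F a (snd p))"
      by (rule continuous_on_compose2[OF F, of _ "\<lambda>p. (a, snd p)", simplified])
         (intro continuous_intros)
    then have "open {p. \<bar>F (fst p) (snd p) - F a (snd p)\<bar> < e}"
      using F by (intro open_Collect_less continuous_intros)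
    moreover have "{a} \<times> L \<subseteq> {p. \<bar>F (fst p) (snd p) - F a (snd p)\<bar> < e}"
      using assms(4) by auto
    ultimately obtain X0 where "a \<in> X0" "open X0" "X0 \<times> L \<subseteq> {p. \<bar>F (fst p) (snd p) - F a (snd p)\<bar> < e}"
      using Elementary_Topology.tube_lemma[OF assms(2), of "{p. \<bar>F (fst p) (snd p) - F a (snd p)\<bar> < e}" a]
      by auto
    then show ?thesis by (intro exI[of _ X0]) auto
  qed
  then obtain U where U: "\<And>a. open (U a) \<and> a \<in> U a" "\<And>a x y. x \<in> U a \<Longrightarrow> y \<in> L \<Longrightarrow> \<bar>F x y - F a y\<bar> < e"
    by metis
  from compact_borel_choice[OF assms(1), of U, OF U(1)] obtain X \<sigma>
    where "finite X" "X \<subseteq> K" "\<And>x. x \<in> K \<Longrightarrow> \<sigma> x \<in> X \<and> x \<in> U (\<sigma> x)"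
    "\<And>a. {x\<in>K. \<sigma> x = a} \<in> sets borel" by blast
  then show ?thesis using U(2) by (intro that[of X \<sigma>]) auto
qed


section \<open>Locally compact groups\<close>

lemma locally_compact_zero_nhd:
  assumes "locally_compact_space (euclidean :: 'a::{topological_group_add,t2_space} topology)"
  obtains N C :: "'a::{topological_group_add,t2_space} set" where "open N" "compact C" "0 \<in> N" "N \<subseteq> C"
  using assms that unfolding locally_compact_space_def
  by (metis UNIV_I compactin_euclidean_iff open_openin topspace_euclidean)

lemma Urysohn_cc:
  fixes K :: "'a::{topological_group_add,t2_space} set"
  assumes lc: "locally_compact_space (euclidean :: 'a topology)"
    and "compact K" "open U" "K \<subseteq> U"
  obtains f where "cc f" "\<And>x. 0 \<le> f x" "\<And>x. f x \<le> 1" "\<And>x. x \<in> K \<Longrightarrow> f x = 1"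
    "\<And>x. x \<notin> U \<Longrightarrow> f x = 0"
proof -
  obtain N C :: "'a set" where NC: "open N" "compact C" "0 \<in> N" "N \<subseteq> C"
    using locally_compact_zero_nhd[OF lc] .
  \<comment> \<open>The Urysohn function will vanish off \<open>V\<close>, which lies in the compact
    set \<open>K + C\<close>; this is what gives it compact support.\<close>
  define V where "V = U \<inter> (K + N)"
  have "open V" unfolding V_def using assms NC by (intro open_Int open_set_plus)
  have KV: "K \<subseteq> V" unfolding V_def using assms(4) NC(3)
    by (force simp: set_plus_def)
  have VC: "V \<subseteq> K + C" unfolding V_def using NC(4) by (auto simp: set_plus_def)
  have cr: "completely_regular_space (euclidean :: 'a topology)"
  proof (rule locally_compact_regular_imp_completely_regular_space[OF lc])
    have "Hausdorff_space (euclidean :: 'a topology)"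
      unfolding Hausdorff_space_def disjnt_def using hausdorff by (metis open_openin)
    then show "Hausdorff_space (euclidean :: 'a topology) \<or> regular_space (euclidean :: 'a topology)" ..
  qed
  have "disjnt K (- V)" "compactin euclidean K" "closedin euclidean (- V)"
    using KV assms(2) \<open>open V\<close> by (auto simp: disjnt_def)
  from Urysohn_completely_regular_compact_closed[OF zero_le_one cr this(2,3,1)]
  obtain f where f: "continuous_map euclidean (subtopology euclidean {0..1::real}) f"
      "f ` (- V) \<subseteq> {0}" "f ` K \<subseteq> {1}" .
  have fc: "continuous_on UNIV f" and f01: "f x \<in> {0..1}" for x
    using f(1) by (auto simp: continuous_map_in_subtopology)
  have f0: "f x = 0" if "x \<notin> V" for x using f(2) that by auto
  have "compact (K + C)" using assms(2) NC(2) by (rule compact_set_plus)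
  then have "cc f" unfolding cc_def using fc f0 VC by blast
  moreover have "f x = 0" if "x \<notin> U" for x using f0[of x] that V_def by auto
  ultimately show ?thesis
    using f01 f(3) by (intro that[of f]) auto
qed

section \<open>Integration against Haar measure\<close>

locale haar_group =
  fixes m :: "'a::{topological_group_add,t2_space} measure"
  assumes lc: "locally_compact_space (euclidean :: 'a topology)"
    and haar: "left_haar_measure m"
begin

lemma sets_m [simp, measurable_cong]: "sets m = sets borel"
  using haar by (simp add: left_haar_measure_def)

lemma space_m [simp]: "space m = UNIV"
  using sets_eq_imp_space_eq[OF sets_m] by simp

lemma measurable_m [simp]: "measurable m N = measurable borel N"
  by (rule measurable_cong_sets) auto

lemma emeasure_left_translate: "E \<in> sets borel \<Longrightarrow> emeasure m ((+) x ` E) = emeasure m E"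
  using haar by (simp add: left_haar_measure_def)

lemma emeasure_compact_finite: "compact K \<Longrightarrow> emeasure m K < \<infinity>"
  using haar by (simp add: left_haar_measure_def)

lemma emeasure_subset_compact_finite:
  assumes "compact K" "E \<subseteq> K" shows "emeasure m E < \<infinity>"
proof -
  have "emeasure m E \<le> emeasure m K"
    using assms by (intro emeasure_mono) (auto intro: compact_in_borel)
  then show ?thesis using emeasure_compact_finite[OF assms(1)] by (rule le_less_trans)
qed

lemma measure_left_translate: "E \<in> sets borel \<Longrightarrow> measure m ((+) x ` E) = measure m E"
  by (simp add: measure_def emeasure_left_translate)

lemma integral_bcs_bound:
  assumes "bcs g" "compact L" "\<And>y. y \<notin> L \<Longrightarrow> g y = 0" "\<And>y. y \<in> L \<Longrightarrow> \<bar>g y\<bar> \<le> c"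
  shows "integrable m g" and "(\<integral>y. \<bar>g y\<bar> \<partial>m) \<le> c * measure m L" and "\<bar>\<integral>y. g y \<partial>m\<bar> \<le> c * measure m L"
proof -
  have L: "L \<in> sets m" "emeasure m L < \<infinity>"
    using assms(2) emeasure_compact_finite[OF assms(2)] by (auto intro: compact_in_borel)
  show int: "integrable m g"
    by (rule integrableI_bounded_set[OF L(1) _ L(2), of _ c])
       (use assms bcsE in \<open>auto simp: bcs_def\<close>)
  have "(\<integral>y. \<bar>g y\<bar> \<partial>m) \<le> (\<integral>y. c * indicator L y \<partial>m)"
    using L assms(3,4) int
    by (intro integral_mono integrable_mult_right integrable_real_indicator) (auto simp: indicator_def)
  also have "\<dots> = c * measure m L" using L by simp
  finally show "(\<integral>y. \<bar>g y\<bar> \<partial>m) \<le> c * measure m L" .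
  moreover have "\<bar>\<integral>y. g y \<partial>m\<bar> \<le> (\<integral>y. \<bar>g y\<bar> \<partial>m)" by (rule integral_abs_bound)
  ultimately show "\<bar>\<integral>y. g y \<partial>m\<bar> \<le> c * measure m L" by linarith
qed

lemma integrable_bcs: "bcs g \<Longrightarrow> integrable m g"
  by (metis bcsE integral_bcs_bound(1))

lemma integrable_cc: "cc g \<Longrightarrow> integrable m g"
  by (intro integrable_bcs cc_imp_bcs)

lemma integral_left_translate:
  fixes f :: "'a \<Rightarrow> real"
  assumes [measurable]: "f \<in> borel_measurable borel"
  shows "(\<integral>x. f (a + x) \<partial>m) = (\<integral>x. f x \<partial>m)"
proof -
  have [measurable]: "(\<lambda>x. a + x) \<in> borel_measurable borel"
    by (intro borel_measurable_continuous_onI continuous_intros)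
  have "distr m borel (\<lambda>x. a + x) = m"
  proof (rule measure_eqI)
    fix E assume "E \<in> sets (distr m borel (\<lambda>x. a + x))"
    then have E: "E \<in> sets borel" by simp
    then have "emeasure (distr m borel (\<lambda>x. a + x)) E = emeasure m ((\<lambda>x. a + x) -` E)"
      by (subst emeasure_distr) auto
    also have "(\<lambda>x. a + x) -` E = (+) (- a) ` E"
      by (simp add: left_translate_eq_vimage)
    finally show "emeasure (distr m borel (\<lambda>x. a + x)) E = emeasure m E"
      using E by (simp add: emeasure_left_translate)
  qed simp
  then have "(\<integral>x. f x \<partial>m) = (\<integral>x. f x \<partial>distr m borel (\<lambda>x. a + x))" by simp
  also have "\<dots> = (\<integral>x. f (a + x) \<partial>m)" by (intro integral_distr) auto
  finally show ?thesis by simp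
qed

text \<open>Finitely many left translates of \<open>U\<close> cover any compact set, so a null
  \<open>U\<close> would make all compact sets null, and by inner regularity of the open set
  \<open>UNIV\<close> the whole measure would vanish.\<close>

lemma emeasure_open_pos:
  assumes "open U" "U \<noteq> {}" shows "emeasure m U > 0"
proof (rule ccontr)
  assume "\<not> emeasure m U > 0"
  then have U0: "emeasure m U = 0" by simp
  obtain u where u: "u \<in> U" using assms(2) by blast
  have null: "emeasure m K = 0" if K: "compact K" for K
  proof -
    obtain X where X: "X \<subseteq> K" "finite X" "K \<subseteq> (\<Union>x\<in>X. (+) (x - u) ` U)"
    proof (rule compactE_image[OF K, of K "\<lambda>x. (+) (x - u) ` U"])
      show "open ((+) (x - u) ` U)" for x using assms(1) by (rule open_left_translate)
      have "x \<in> (+) (x - u) ` U" for x using u by (intro image_eqI[of _ _ u]) simp_all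
      then show "K \<subseteq> (\<Union>x\<in>K. (+) (x - u) ` U)" by blast
    qed blast
    have "(\<Union>x\<in>X. (+) (x - u) ` U) \<in> null_sets m"
      using X(2) U0 assms(1) borel_open[OF open_left_translate[OF assms(1)]]
      by (intro null_sets_UN' countable_finite) (auto simp: null_sets_def emeasure_left_translate)
    then have "emeasure m K \<le> 0"
      using emeasure_mono[OF X(3), of m] by (simp add: null_sets_def)
    then show ?thesis by simp
  qed
  have "emeasure m UNIV = (SUP K\<in>{K. compact K \<and> K \<subseteq> UNIV}. emeasure m K)"
    using haar open_UNIV unfolding left_haar_measure_def by blast
  also have "\<dots> \<le> 0" by (intro SUP_least) (simp add: null)
  finally show False using haar by (simp add: left_haar_measure_def)
qed

lemma integral_cc_pos:
  assumes "cc f" "\<And>x. 0 \<le> f x" "f x0 > 0"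
  shows "(\<integral>x. f x \<partial>m) > 0"
proof (rule ccontr)
  assume "\<not> (\<integral>x. f x \<partial>m) > 0"
  moreover have "(\<integral>x. f x \<partial>m) \<ge> 0" using assms(2) by simp
  ultimately have "(\<integral>x. f x \<partial>m) = 0" by simp
  then have ae: "AE x in m. f x = 0"
    using integral_nonneg_eq_0_iff_AE[OF integrable_cc[OF assms(1)]] assms(2) by simp
  have op: "open {x. 0 < f x}"
    using assms(1) by (intro open_Collect_less) (auto simp: cc_def)
  have "emeasure m {x \<in> space m. \<not> f x = 0} = 0"
    using ae assms(1) cc_imp_bcs[OF assms(1)] by (intro AE_iff_measurable[THEN iffD1, OF _ _ ae])
       (auto simp: bcs_def)
  moreover have "{x \<in> space m. \<not> f x = 0} = {x. 0 < f x}" using assms(2) by (auto simp: less_le)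
  ultimately have "emeasure m {x. 0 < f x} = 0" by simp
  moreover have "emeasure m {x. 0 < f x} > 0" using op assms(3) by (intro emeasure_open_pos) auto
  ultimately show False by simp
qed

lemma cc_zero_nhd_bump:
  assumes "open N" "0 \<in> N"
  obtains w where "cc w" "\<And>x. 0 \<le> w x" "\<And>x. x \<notin> N \<Longrightarrow> w x = 0" "(\<integral>x. w x \<partial>m) = 1"
proof -
  have "{0} \<subseteq> N" using assms(2) by simp
  then obtain f where f: "cc f" "\<And>x. 0 \<le> f x" "\<And>x. x \<in> {0} \<Longrightarrow> f x = 1" "\<And>x. x \<notin> N \<Longrightarrow> f x = 0"
    using Urysohn_cc[OF lc compact_sing[of 0] assms(1)] by metis
  have pos: "(\<integral>x. f x \<partial>m) > 0" using f by (intro integral_cc_pos[of f 0]) auto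
  show ?thesis
  proof (rule that[of "\<lambda>x. inverse (\<integral>x. f x \<partial>m) * f x"])
    show "cc (\<lambda>x. inverse (\<integral>x. f x \<partial>m) * f x)" by (rule cc_scale[OF f(1)])
  qed (use f pos in auto)
qed

text \<open>The tube lemma makes the integrands uniformly close on \<open>L\<close>. The statement
  is local in \<open>x\<close> because for \<open>g (y + x)\<close> a common compact support exists
  only while \<open>x\<close> stays near a given point.\<close>

lemma continuous_on_parametric_integral:
  fixes F :: "'a \<Rightarrow> 'a \<Rightarrow> real"
  assumes F: "continuous_on UNIV (\<lambda>(x, y). F x y)" and L: "compact L" and "open X"
    and 0: "\<And>x y. x \<in> X \<Longrightarrow> y \<notin> L \<Longrightarrow> F x y = 0"
  shows "continuous_on X (\<lambda>x. \<integral>y. F x y \<partial>m)"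
proof -
  have F': "continuous_on UNIV (\<lambda>p. F (fst p) (snd p))"
    using F by (simp add: case_prod_unfold)
  have Fx: "continuous_on UNIV (F x)" for x
    by (rule continuous_on_compose2[OF F', of _ "\<lambda>y. (x, y)", simplified]) (intro continuous_intros)
  have bcsF: "bcs (F x)" if "x \<in> X" for x
    using Fx L 0[OF that] by (intro cc_imp_bcs) (auto simp: cc_def)
  show ?thesis unfolding continuous_on_def
  proof (intro ballI tendstoI)
    fix x0 and e :: real assume x0: "x0 \<in> X" and e: "e > 0"
    obtain e' where e': "e' > 0" "e' * measure m L < e"
      using small_factor[OF measure_nonneg e] by blast
    have "continuous_on UNIV (\<lambda>p::'a \<times> 'a. F x0 (snd p))"
      by (rule continuous_on_compose2[OF Fx]) (auto intro!: continuous_intros)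
    then have "open {p. \<bar>F (fst p) (snd p) - F x0 (snd p)\<bar> < e'}"
      using F' by (intro open_Collect_less continuous_intros)
    moreover have "{x0} \<times> L \<subseteq> {p. \<bar>F (fst p) (snd p) - F x0 (snd p)\<bar> < e'}"
      using e' by auto
    ultimately obtain X0 where X0: "x0 \<in> X0" "open X0"
        "X0 \<times> L \<subseteq> {p. \<bar>F (fst p) (snd p) - F x0 (snd p)\<bar> < e'}"
      using Elementary_Topology.tube_lemma[OF L, of "{p. \<bar>F (fst p) (snd p) - F x0 (snd p)\<bar> < e'}" x0]
      by auto
    have "dist (\<integral>y. F x y \<partial>m) (\<integral>y. F x0 y \<partial>m) < e" if x: "x \<in> X0" "x \<in> X" for x
    proof -
      have "\<bar>\<integral>y. (F x y - F x0 y) \<partial>m\<bar> \<le> e' * measure m L"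
        using x X0(3) 0 x0 bcsF by (intro integral_bcs_bound bcs_diff L) (auto intro: less_imp_le)
      then show ?thesis
        using integrable_bcs[OF bcsF[OF x(2)]] integrable_bcs[OF bcsF[OF x0]] e'
        by (simp add: dist_real_def)
    qed
    then show "\<forall>\<^sub>F x in at x0 within X. dist (\<integral>y. F x y \<partial>m) (\<integral>y. F x0 y \<partial>m) < e"
      using X0 by (auto simp: eventually_at_topological)
  qed
qed

text \<open>The sum is the integral of the step function \<open>g (\<sigma> x)\<close> on
  \<open>K\<close>, collected by the fibres of \<open>\<sigma>\<close>.\<close>

lemma riemann_sum:
  assumes K: "compact K" and X: "finite X" and \<sigma>: "\<And>x. x \<in> K \<Longrightarrow> \<sigma> x \<in> X"
    and P: "\<And>a. {x\<in>K. \<sigma> x = a} \<in> sets borel"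
    and g: "bcs g" "\<And>x. x \<notin> K \<Longrightarrow> g x = 0" "\<And>x. x \<in> K \<Longrightarrow> \<bar>g x - g (\<sigma> x)\<bar> \<le> e"
  shows "\<bar>(\<integral>x. g x \<partial>m) - (\<Sum>a\<in>X. measure m {x\<in>K. \<sigma> x = a} * g a)\<bar> \<le> e * measure m K"
proof -
  have fin: "emeasure m {x\<in>K. \<sigma> x = a} < \<infinity>" for a
    by (rule emeasure_subset_compact_finite[OF K]) auto
  have b: "bcs (\<lambda>x. \<Sum>a\<in>X. g a * indicator {x\<in>K. \<sigma> x = a} x)"
    using X P K by (intro bcs_sum bcs_scale bcs_indicator[of _ K]) auto
  have eq: "(\<Sum>a\<in>X. g a * indicator {x\<in>K. \<sigma> x = a} x) = (if x \<in> K then g (\<sigma> x) else 0)" for x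
  proof (cases "x \<in> K")
    case True
    have "(\<Sum>a\<in>X. g a * indicator {x\<in>K. \<sigma> x = a} x) = (\<Sum>a\<in>X. if \<sigma> x = a then g a else 0)"
      using True by (intro sum.cong) (auto simp: indicator_def)
    then show ?thesis using X \<sigma>[OF True] True by simp
  qed (simp add: indicator_def)
  have "(\<integral>x. (\<Sum>a\<in>X. g a * indicator {x\<in>K. \<sigma> x = a} x) \<partial>m)
      = (\<Sum>a\<in>X. measure m {x\<in>K. \<sigma> x = a} * g a)"
    using P fin by (subst Bochner_Integration.integral_sum)
      (auto intro!: integrable_mult_right integrable_real_indicator sum.cong simp: mult.commute)
  moreover have "\<bar>\<integral>x. (g x - (\<Sum>a\<in>X. g a * indicator {x\<in>K. \<sigma> x = a} x)) \<partial>m\<bar> \<le> e * measure m K"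
    using g b by (intro integral_bcs_bound bcs_diff K) (auto simp: eq)
  ultimately show ?thesis
    using integrable_bcs[OF b] integrable_bcs[OF g(1)] by simp
qed

text \<open>\<open>borel\<close> on \<open>'a \<times> 'a\<close> may be strictly larger than \<open>borel \<Otimes>\<^sub>M borel\<close>, so Fubini's theorem of
  the library does not apply; for compactly supported continuous functions, Riemann sums suffice.\<close>
lemma fubini_cc:
  fixes F :: "'a \<Rightarrow> 'a \<Rightarrow> real"
  assumes F: "continuous_on UNIV (\<lambda>(x, y). F x y)" and K: "compact K" and L: "compact L"
    and 0: "\<And>x y. \<not> (x \<in> K \<and> y \<in> L) \<Longrightarrow> F x y = 0"
  shows "(\<integral>x. (\<integral>y. F x y \<partial>m) \<partial>m) = (\<integral>y. (\<integral>x. F x y \<partial>m) \<partial>m)" (is "?I = ?J")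
proof -
  have F1: "continuous_on UNIV (\<lambda>p. F (fst p) (snd p))"
    using F by (simp add: case_prod_unfold)
  have F2: "continuous_on UNIV (\<lambda>(y, x). F x y)" unfolding case_prod_unfold
    by (rule continuous_on_compose2[OF F1, of _ "\<lambda>p. (snd p, fst p)", simplified]) (intro continuous_intros)
  have Fx: "continuous_on UNIV (F x)" for x
    by (rule continuous_on_compose2[OF F1, of _ "\<lambda>y. (x, y)", simplified]) (intro continuous_intros)
  have Fy: "continuous_on UNIV (\<lambda>x. F x y)" for y
    by (rule continuous_on_compose2[OF F1, of _ "\<lambda>x. (x, y)", simplified]) (intro continuous_intros)
  have bx: "bcs (F x)" for x
    using Fx L 0 by (intro cc_imp_bcs) (auto simp: cc_def)
  have bY: "bcs (\<lambda>x. F x y)" for y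
    using Fy K 0 by (intro cc_imp_bcs) (auto simp: cc_def)
  have "continuous_on UNIV (\<lambda>x. \<integral>y. F x y \<partial>m)"
    using 0 by (intro continuous_on_parametric_integral[OF F L]) auto
  moreover have "(\<integral>y. F x y \<partial>m) = 0" if "x \<notin> K" for x
    using 0 that by simp
  ultimately have bI: "bcs (\<lambda>x. \<integral>y. F x y \<partial>m)"
    using K by (intro cc_imp_bcs) (auto simp: cc_def)
  have "continuous_on UNIV (\<lambda>y. \<integral>x. F x y \<partial>m)"
    using 0 by (intro continuous_on_parametric_integral[OF F2 K]) auto
  moreover have "(\<integral>x. F x y \<partial>m) = 0" if "y \<notin> L" for y
    using 0 that by simp
  ultimately have bJ: "bcs (\<lambda>y. \<integral>x. F x y \<partial>m)"
    using L by (intro cc_imp_bcs) (auto simp: cc_def)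
  have "\<bar>?I - ?J\<bar> \<le> e * (2 * measure m K * measure m L)" if "e > 0" for e
  proof -
    obtain X \<sigma> where X: "finite X" "X \<subseteq> K" and \<sigma>: "\<And>x. x \<in> K \<Longrightarrow> \<sigma> x \<in> X"
      and e: "\<And>x y. x \<in> K \<Longrightarrow> y \<in> L \<Longrightarrow> \<bar>F x y - F (\<sigma> x) y\<bar> < e"
      and P: "\<And>a. {x\<in>K. \<sigma> x = a} \<in> sets borel"
      by (rule compact_uniform_choice[OF K L F \<open>e > 0\<close>]) (rule that)
    \<comment> \<open>Freezing the first variable at the points of \<open>X\<close> turns both
      iterated integrals into the same finite sum; each is off by at most
      \<open>e * measure m K * measure m L\<close>.\<close>
    define p where "p a = measure m {x\<in>K. \<sigma> x = a}" for a
    have 1: "\<bar>?I - (\<Sum>a\<in>X. p a * (\<integral>y. F a y \<partial>m))\<bar> \<le> (e * measure m L) * measure m K"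
      unfolding p_def
    proof (rule riemann_sum[OF K X(1) \<sigma> P bI])
      fix x assume x: "x \<in> K"
      have "\<bar>\<integral>y. (F x y - F (\<sigma> x) y) \<partial>m\<bar> \<le> e * measure m L"
        using bx L 0 e[OF x] by (intro integral_bcs_bound bcs_diff) (auto intro: less_imp_le)
      then show "\<bar>(\<integral>y. F x y \<partial>m) - (\<integral>y. F (\<sigma> x) y \<partial>m)\<bar> \<le> e * measure m L"
        using integrable_bcs[OF bx] by simp
    qed (use 0 in auto)
    have sum: "(\<integral>y. (\<Sum>a\<in>X. p a * F a y) \<partial>m) = (\<Sum>a\<in>X. p a * (\<integral>y. F a y \<partial>m))"
      using integrable_bcs[OF bx] by (subst Bochner_Integration.integral_sum) auto
    have bs: "bcs (\<lambda>y. \<Sum>a\<in>X. p a * F a y)"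
      using X bx by (intro bcs_sum bcs_scale)
    have "\<bar>\<integral>y. ((\<integral>x. F x y \<partial>m) - (\<Sum>a\<in>X. p a * F a y)) \<partial>m\<bar> \<le> (e * measure m K) * measure m L"
    proof (rule integral_bcs_bound(3)[OF bcs_diff[OF bJ bs] L])
      fix y assume y: "y \<in> L"
      show "\<bar>(\<integral>x. F x y \<partial>m) - (\<Sum>a\<in>X. p a * F a y)\<bar> \<le> e * measure m K"
        unfolding p_def
        using 0 e[OF _ y] by (intro riemann_sum[OF K X(1) \<sigma> P bY]) (auto intro: less_imp_le)
    qed (use 0 in auto)
    then have 2: "\<bar>?J - (\<Sum>a\<in>X. p a * (\<integral>y. F a y \<partial>m))\<bar> \<le> (e * measure m K) * measure m L"
      using integrable_bcs[OF bJ] integrable_bcs[OF bs] by (simp add: sum[symmetric])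
    show ?thesis using 1 2 by (simp add: algebra_simps)
  qed
  then show ?thesis
    using eq_0_if_abs_le_all[of "2 * measure m K * measure m L" "?I - ?J"] by simp
qed


subsection \<open>The modular function\<close>

text \<open>For \<open>x\<close> in the translate of \<open>N\<close> by \<open>x0\<close>, the
  functions \<open>g (y + x)\<close> of \<open>y\<close> all vanish off the one compact set of
  differences \<open>k - (c + x0)\<close> with \<open>k \<in> K\<close>,
  \<open>c \<in> C\<close>.\<close>

lemma continuous_on_integral_right_translate:
  assumes "cc g"
  shows "continuous_on UNIV (\<lambda>x. \<integral>y. g (y + x) \<partial>m)"
proof -
  obtain N C :: "'a set" where N: "open N" "compact C" "0 \<in> N" "N \<subseteq> C"
    using locally_compact_zero_nhd[OF lc] .
  obtain K where g: "continuous_on UNIV g" and K: "compact K" "\<And>x. x \<notin> K \<Longrightarrow> g x = 0"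
    using assms by (auto simp: cc_def)
  have gc: "continuous_on UNIV (\<lambda>(x, y). g (y + x))" unfolding case_prod_unfold
    by (rule continuous_on_compose2[OF g]) (auto intro!: continuous_intros)
  have "isCont (\<lambda>x. \<integral>y. g (y + x) \<partial>m) x0" for x0
  proof -
    have op: "open ((\<lambda>y. y + x0) ` N)" using N(1) by (rule open_right_translate)
    have "continuous_on ((\<lambda>y. y + x0) ` N) (\<lambda>x. \<integral>y. g (y + x) \<partial>m)"
    proof (rule continuous_on_parametric_integral[OF gc _ op])
      show "compact (K + uminus ` (\<lambda>y. y + x0) ` C)"
        using K N by (intro compact_set_plus compact_uminus_image compact_right_translate)
      fix x y assume x: "x \<in> (\<lambda>y. y + x0) ` N" and y: "y \<notin> K + uminus ` (\<lambda>y. y + x0) ` C"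
      have "y + x \<notin> K"
      proof
        assume "y + x \<in> K"
        moreover have "- x \<in> uminus ` (\<lambda>y. y + x0) ` C" using x N(4) by blast
        ultimately have "(y + x) + - x \<in> K + uminus ` (\<lambda>y. y + x0) ` C" by (rule set_plus_intro)
        then show False using y by (simp add: add.assoc)
      qed
      then show "g (y + x) = 0" by (rule K)
    qed
    moreover have "x0 \<in> (\<lambda>y. y + x0) ` N" using N(3) by (intro image_eqI[of _ _ 0]) auto
    ultimately show ?thesis using op continuous_on_eq_continuous_at by blast
  qed
  then show ?thesis by (simp add: continuous_at_imp_continuous_on)
qed

text \<open>The modular function is read off from this formula: the right-hand side depends on \<open>g\<close> only
  through its integral.\<close>
lemma integral_mult_right_translates:
  assumes f: "cc f" and g: "cc g"
  shows "(\<integral>x. f x * (\<integral>y. g (y + x) \<partial>m) \<partial>m) = (\<integral>x. g x \<partial>m) * (\<integral>x. f (- x) \<partial>m)"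
proof -
  obtain K where fc: "continuous_on UNIV f" and K: "compact K" "\<And>x. x \<notin> K \<Longrightarrow> f x = 0"
    using f by (auto simp: cc_def)
  obtain L where gc: "continuous_on UNIV g" and L: "compact L" "\<And>x. x \<notin> L \<Longrightarrow> g x = 0"
    using g by (auto simp: cc_def)
  have LK: "compact (L + uminus ` K)" using K L by (intro compact_set_plus compact_uminus_image)
  have *: "y \<in> L + uminus ` K" if "y + x \<in> L" "x \<in> K" for x y
  proof -
    have "(y + x) + - x \<in> L + uminus ` K" using that by (intro set_plus_intro) auto
    then show ?thesis by (simp add: add.assoc)
  qed
  have "(\<integral>x. f x * (\<integral>y. g (y + x) \<partial>m) \<partial>m) = (\<integral>x. (\<integral>y. f x * g (y + x) \<partial>m) \<partial>m)"
    by simp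
  also have "\<dots> = (\<integral>y. (\<integral>x. f x * g (y + x) \<partial>m) \<partial>m)"
  proof (rule fubini_cc[OF _ K(1) LK])
    show "continuous_on UNIV (\<lambda>(x, y). f x * g (y + x))" unfolding case_prod_unfold
      by (intro continuous_intros continuous_on_compose2[OF fc] continuous_on_compose2[OF gc]) auto
    show "f x * g (y + x) = 0" if "\<not> (x \<in> K \<and> y \<in> L + uminus ` K)" for x y
      using that * K(2) L(2) by fastforce
  qed
  also have "\<dots> = (\<integral>y. (\<integral>x. f (- y + x) * g x \<partial>m) \<partial>m)"
  proof (rule Bochner_Integration.integral_cong[OF refl])
    fix y
    have "(\<lambda>x. f (- y + x) * g x) \<in> borel_measurable borel"
      by (intro borel_measurable_continuous_onI continuous_intros continuous_on_compose2[OF fc]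
          continuous_on_compose2[OF gc]) auto
    from integral_left_translate[OF this, of y]
    show "(\<integral>x. f x * g (y + x) \<partial>m) = (\<integral>x. f (- y + x) * g x \<partial>m)"
      by (simp add: add.assoc[symmetric])
  qed
  also have "\<dots> = (\<integral>x. (\<integral>y. f (- y + x) * g x \<partial>m) \<partial>m)"
  proof (rule fubini_cc[OF _ LK L(1)])
    show "continuous_on UNIV (\<lambda>(y, x). f (- y + x) * g x)" unfolding case_prod_unfold
      by (intro continuous_intros continuous_on_compose2[OF fc] continuous_on_compose2[OF gc]) auto
    show "f (- y + x) * g x = 0" if "\<not> (y \<in> L + uminus ` K \<and> x \<in> L)" for x y
    proof (cases "x \<in> L \<and> - y + x \<in> K")
      case True
      then have "y \<in> L + uminus ` K" using *[of y "- y + x"] by (simp add: add.assoc[symmetric])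
      then show ?thesis using that True by auto
    next
      case False
      then show ?thesis using K(2) L(2) by auto
    qed
  qed
  \<comment> \<open>Replacing \<open>y\<close> by \<open>x + y\<close> turns \<open>- y + x\<close>
    into \<open>- y\<close>, so the inner integral no longer sees \<open>x\<close>.\<close>
  also have "\<dots> = (\<integral>x. g x * (\<integral>y. f (- y) \<partial>m) \<partial>m)"
  proof (rule Bochner_Integration.integral_cong[OF refl])
    fix x
    have "(\<lambda>y. f (- y + x)) \<in> borel_measurable borel"
      by (intro borel_measurable_continuous_onI continuous_on_compose2[OF fc] continuous_intros) auto
    from integral_left_translate[OF this, of x]
    show "(\<integral>y. f (- y + x) * g x \<partial>m) = g x * (\<integral>y. f (- y) \<partial>m)"
      by (simp add: minus_add add.assoc mult.commute)
  qed
  finally show ?thesis by simp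
qed

text \<open>The difference \<open>d\<close> of the two sides is continuous in \<open>x\<close> and,
  by \<open>integral_mult_right_translates\<close>, orthogonal to every \<open>cc\<close> function.
  Testing it against \<open>f * d\<close> with \<open>f\<close> equal to \<open>1\<close> at a point
  where \<open>d\<close> is nonzero gives a positive integral that should be zero.\<close>

lemma integral_right_translate_proportional:
  assumes g: "cc g" and h: "cc h"
  shows "(\<integral>x. h x \<partial>m) * (\<integral>y. g (y + x) \<partial>m) = (\<integral>x. g x \<partial>m) * (\<integral>y. h (y + x) \<partial>m)"
proof (rule ccontr)
  assume neq: "\<not> ?thesis"
  define d where "d x = (\<integral>x. h x \<partial>m) * (\<integral>y. g (y + x) \<partial>m) - (\<integral>x. g x \<partial>m) * (\<integral>y. h (y + x) \<partial>m)" for x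
  have d0: "d x \<noteq> 0" using neq by (simp add: d_def)
  have dc: "continuous_on UNIV d" unfolding d_def
    by (intro continuous_intros continuous_on_integral_right_translate g h)
  obtain f where f: "cc f" "\<And>x. 0 \<le> f x" "\<And>y. y \<in> {x} \<Longrightarrow> f y = 1"
    using Urysohn_cc[OF lc compact_sing[of x] open_UNIV subset_UNIV] by metis
  have ccfd: "cc (\<lambda>x. f x * d x)" using f(1) dc by (auto simp: cc_def intro!: continuous_intros)
  have ccmult: "cc (\<lambda>x. (f x * d x) * (\<integral>y. k (y + x) \<partial>m))" if "cc k" for k
    using ccfd continuous_on_integral_right_translate[OF that]
    by (auto simp: cc_def intro!: continuous_intros)
  have "(\<integral>x. (f x * d x) * d x \<partial>m) =
      (\<integral>x. (\<integral>x. h x \<partial>m) * ((f x * d x) * (\<integral>y. g (y + x) \<partial>m))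
        - (\<integral>x. g x \<partial>m) * ((f x * d x) * (\<integral>y. h (y + x) \<partial>m)) \<partial>m)"
    by (intro Bochner_Integration.integral_cong refl) (simp add: d_def algebra_simps)
  also have "\<dots> = (\<integral>x. h x \<partial>m) * (\<integral>x. (f x * d x) * (\<integral>y. g (y + x) \<partial>m) \<partial>m)
        - (\<integral>x. g x \<partial>m) * (\<integral>x. (f x * d x) * (\<integral>y. h (y + x) \<partial>m) \<partial>m)"
    using ccmult[OF g] ccmult[OF h]
    by (subst Bochner_Integration.integral_diff) (auto intro!: integrable_mult_right integrable_cc)
  also have "\<dots> = 0"
    by (simp add: integral_mult_right_translates[OF ccfd g] integral_mult_right_translates[OF ccfd h])
  finally have "(\<integral>x. (f x * d x) * d x \<partial>m) = 0" .
  moreover have "(\<integral>x. (f x * d x) * d x \<partial>m) > 0"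
  proof (rule integral_cc_pos[of _ x])
    show "cc (\<lambda>x. (f x * d x) * d x)"
      using ccfd dc by (auto simp: cc_def intro!: continuous_intros)
    show "0 \<le> f x * d x * d x" for x using f(2)[of x] by (simp add: mult.assoc)
    show "0 < f x * d x * d x" using f(3)[of x] d0 by (simp add: mult.assoc[symmetric] flip: power2_eq_square)
  qed
  ultimately show False by simp
qed

text \<open>The convention is that \<open>g (y + x)\<close> has integral \<open>modular x\<close>
  times that of \<open>g\<close>, so a set translated on the right by \<open>x\<close> gets the
  factor \<open>modular (- x)\<close>. The chosen \<open>w\<close> does not matter, by
  \<open>integral_right_translate_proportional\<close>.\<close>

definition modular :: "'a \<Rightarrow> real" where
  "modular x = (\<integral>y. (SOME w. cc w \<and> (\<forall>x. 0 \<le> w x) \<and> (\<integral>x. w x \<partial>m) = 1) (y + x) \<partial>m)"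

lemma modularE:
  obtains w where "cc w" "\<And>x. 0 \<le> w x" "(\<integral>x. w x \<partial>m) = 1" "\<And>x. modular x = (\<integral>y. w (y + x) \<partial>m)"
proof -
  let ?P = "\<lambda>w. cc w \<and> (\<forall>x. 0 \<le> w x) \<and> (\<integral>x. w x \<partial>m) = 1"
  have "\<exists>w. ?P w" using cc_zero_nhd_bump[OF open_UNIV] by (metis UNIV_I)
  then have "?P (SOME w. ?P w)" by (rule someI_ex)
  then show ?thesis using that[of "SOME w. ?P w"] by (auto simp: modular_def)
qed

lemma integral_right_translate_cc:
  assumes "cc g" shows "(\<integral>y. g (y + x) \<partial>m) = modular x * (\<integral>x. g x \<partial>m)"
proof -
  obtain w where w: "cc w" "(\<integral>x. w x \<partial>m) = 1" "\<And>x. modular x = (\<integral>y. w (y + x) \<partial>m)"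
    using modularE by metis
  show ?thesis using integral_right_translate_proportional[OF assms w(1), of x] w by (simp add: mult.commute)
qed

lemma modular_pos: "modular x > 0"
proof -
  obtain w where w: "cc w" "\<And>x. 0 \<le> w x" "(\<integral>x. w x \<partial>m) = 1" "\<And>x. modular x = (\<integral>y. w (y + x) \<partial>m)"
    using modularE by metis
  obtain z where "w z > 0"
  proof (rule ccontr)
    assume "\<not> thesis"
    then have "w z = 0" for z using w(2)[of z] by (metis that less_le)
    then show False using w(3) by simp
  qed
  then show ?thesis unfolding w(4)
    using w(2) by (intro integral_cc_pos[of _ "z - x"] cc_translate_right w) (auto simp: add.assoc)
qed

lemma continuous_on_modular: "continuous_on UNIV modular"
proof -
  obtain w where w: "cc w" "\<And>x. modular x = (\<integral>y. w (y + x) \<partial>m)"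
    using modularE by metis
  then have "modular = (\<lambda>x. \<integral>y. w (y + x) \<partial>m)" by blast
  then show ?thesis using continuous_on_integral_right_translate[OF w(1)] by simp
qed

lemma modular_add: "modular (x + y) = modular x * modular y"
proof -
  obtain w where w: "cc w" "(\<integral>x. w x \<partial>m) = 1" using modularE by metis
  have "modular (x + y) = (\<integral>z. w (z + (x + y)) \<partial>m)"
    using w by (simp add: integral_right_translate_cc)
  also have "\<dots> = (\<integral>z. (\<lambda>z. w (z + y)) (z + x) \<partial>m)" by (simp add: add.assoc)
  also have "\<dots> = modular x * (\<integral>z. w (z + y) \<partial>m)"
    by (rule integral_right_translate_cc) (rule cc_translate_right[OF w(1)])
  finally show ?thesis using w by (simp add: integral_right_translate_cc)
qed

lemma modular_zero [simp]: "modular 0 = 1"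
  using modular_add[of 0 0] modular_pos[of 0] by simp

lemma modular_minus: "modular (- x) = inverse (modular x)"
  using modular_add[of x "- x"] modular_pos[of x] by (simp add: field_simps)

text \<open>A normalized \<open>w\<close> in the place of \<open>g\<close> in
  \<open>integral_mult_right_translates\<close> makes the inner integral equal to
  \<open>modular x\<close>.\<close>

lemma integral_uminus_cc:
  assumes "cc f" shows "(\<integral>x. modular x * f x \<partial>m) = (\<integral>x. f (- x) \<partial>m)"
proof -
  obtain w where w: "cc w" "(\<integral>x. w x \<partial>m) = 1" using modularE by metis
  show ?thesis
    using integral_mult_right_translates[OF assms w(1)] w
    by (simp add: integral_right_translate_cc mult.commute)
qed


subsection \<open>From continuous functions to Borel functions\<close>

lemma outer_regular_compact:
  assumes "compact K" "e > 0"
  obtains U where "open U" "K \<subseteq> U" "emeasure m U \<le> emeasure m K + ennreal e"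
proof -
  have "emeasure m K = (INF U\<in>{U. open U \<and> K \<subseteq> U}. emeasure m U)"
    using haar compact_in_borel[OF assms(1)] unfolding left_haar_measure_def by blast
  moreover have "emeasure m K < emeasure m K + ennreal e"
  proof -
    obtain r where "emeasure m K = ennreal r" "0 \<le> r"
      using emeasure_compact_finite[OF assms(1)] by (cases "emeasure m K") auto
    then show ?thesis using assms(2) by (simp add: ennreal_less_iff flip: ennreal_plus)
  qed
  ultimately have "(INF U\<in>{U. open U \<and> K \<subseteq> U}. emeasure m U) < emeasure m K + ennreal e" by simp
  then obtain U where "open U" "K \<subseteq> U" "emeasure m U < emeasure m K + ennreal e"
    unfolding INF_less_iff by auto
  then show ?thesis using that[of U] by (simp add: less_imp_le)
qed

text \<open>Outer regularity is asked of compact sets only: enough to recover integrals of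
  \<open>bcs\<close> functions from those of \<open>cc\<close> functions, and inherited by
  continuous densities and by images under homeomorphisms.\<close>

definition compact_regular_measure :: "'a measure \<Rightarrow> bool" where
  "compact_regular_measure n \<longleftrightarrow> sets n = sets borel \<and> (\<forall>K. compact K \<longrightarrow> emeasure n K < \<infinity>) \<and>
    (\<forall>K e. compact K \<longrightarrow> e > 0 \<longrightarrow> (\<exists>U. open U \<and> K \<subseteq> U \<and> emeasure n U \<le> emeasure n K + ennreal e))"

lemma compact_regular_measure_outer:
  assumes "compact_regular_measure n" "compact K" "e > 0"
  shows "\<exists>U. open U \<and> K \<subseteq> U \<and> emeasure n U \<le> emeasure n K + ennreal e"
  using assms by (simp add: compact_regular_measure_def)

text \<open>As \<open>\<phi>\<close> may be unbounded, an outer approximation \<open>U\<close> of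
  \<open>K\<close> is first cut down to \<open>K + N\<close>, inside the compact set
  \<open>K + C\<close>, where \<open>\<phi>\<close> has a bound \<open>B\<close>; the excess of
  \<open>U\<close> is then taken below \<open>e / (B + 1)\<close>.\<close>

lemma compact_regular_measure_density:
  assumes "continuous_on UNIV \<phi>" "\<And>x. 0 \<le> \<phi> x"
  shows "compact_regular_measure (density m (\<lambda>x. ennreal (\<phi> x)))"
proof -
  let ?n = "density m (\<lambda>x. ennreal (\<phi> x))"
  have [measurable]: "\<phi> \<in> borel_measurable borel"
    using assms(1) by (rule borel_measurable_continuous_onI)
  have bd: "\<exists>B\<ge>0. \<forall>x\<in>K. \<phi> x \<le> B" if K: "compact K" for K
  proof -
    have "compact (\<phi> ` K)"
      using K assms(1) by (meson compact_continuous_image continuous_on_subset subset_UNIV)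
    then obtain C where C: "\<And>x. x \<in> K \<Longrightarrow> \<bar>\<phi> x\<bar> \<le> C"
      by (metis bounded_iff compact_imp_bounded imageI real_norm_def)
    then show ?thesis by (intro exI[of _ "max C 0"]) (force simp: abs_le_iff)
  qed
  have le: "emeasure ?n E \<le> ennreal B * emeasure m E"
    if "E \<in> sets borel" "\<And>x. x \<in> E \<Longrightarrow> \<phi> x \<le> B" for E B
  proof -
    have "emeasure ?n E = (\<integral>\<^sup>+x. ennreal (\<phi> x) * indicator E x \<partial>m)"
      using that(1) by (subst emeasure_density) auto
    also have "\<dots> \<le> (\<integral>\<^sup>+x. ennreal B * indicator E x \<partial>m)"
      using that(2) by (intro nn_integral_mono) (auto simp: indicator_def intro: ennreal_leI)
    finally show ?thesis using that(1) by (simp add: nn_integral_cmult_indicator)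
  qed
  obtain N C :: "'a set" where N: "open N" "compact C" "0 \<in> N" "N \<subseteq> C"
    using locally_compact_zero_nhd[OF lc] .
  show ?thesis unfolding compact_regular_measure_def
  proof (intro conjI allI impI)
    fix K :: "'a set" assume K: "compact K"
    obtain B where B: "B \<ge> 0" "\<And>x. x \<in> K \<Longrightarrow> \<phi> x \<le> B" using bd[OF K] by blast
    have "emeasure ?n K \<le> ennreal B * emeasure m K"
      using B compact_in_borel[OF K] by (intro le) auto
    also have "\<dots> < \<infinity>" using emeasure_compact_finite[OF K] by (simp add: ennreal_mult_less_top)
    finally show fin: "emeasure ?n K < \<infinity>" .
    fix e :: real assume e: "e > 0"
    have KC: "compact (K + C)" using K N(2) by (rule compact_set_plus)
    obtain B where B: "B \<ge> 0" "\<And>x. x \<in> K + C \<Longrightarrow> \<phi> x \<le> B" using bd[OF KC] by blast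
    have "e / (B + 1) > 0" using e B by simp
    then obtain U where U: "open U" "K \<subseteq> U" "emeasure m U \<le> emeasure m K + ennreal (e / (B + 1))"
      using outer_regular_compact[OF K] by blast
    define V where "V = U \<inter> (K + N)"
    have V: "open V" "K \<subseteq> V" "V \<subseteq> K + C"
      using U N open_set_plus[OF N(1), of K] by (force simp: V_def set_plus_def)+
    have Vs: "V \<in> sets borel" "K \<in> sets borel" using V(1) compact_in_borel[OF K] by auto
    have "emeasure m (V - K) = emeasure m V - emeasure m K"
      using V Vs emeasure_compact_finite[OF K] by (intro emeasure_Diff) auto
    also have "\<dots> \<le> (emeasure m K + ennreal (e / (B + 1))) - emeasure m K"
      using U(1,3) by (intro ennreal_minus_mono order_trans[OF emeasure_mono U(3)]) (auto simp: V_def)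
    also have "\<dots> = ennreal (e / (B + 1))"
      using emeasure_compact_finite[OF K] by (simp add: ennreal_add_diff_cancel_left less_top[symmetric])
    finally have small: "emeasure m (V - K) \<le> ennreal (e / (B + 1))" .
    have "emeasure ?n (V - K) \<le> ennreal B * emeasure m (V - K)"
      using V Vs B by (intro le) auto
    also have "\<dots> \<le> ennreal B * ennreal (e / (B + 1))" using small by (rule mult_left_mono) simp
    also have "\<dots> = ennreal (B * (e / (B + 1)))" using B(1) e by (intro ennreal_mult[symmetric]) auto
    also have "\<dots> \<le> ennreal e" using B(1) e by (intro ennreal_leI) (simp add: field_simps)
    finally have "emeasure ?n (V - K) \<le> ennreal e" .
    moreover have "emeasure ?n V = emeasure ?n K + emeasure ?n (V - K)"
      using V(2) Vs by (subst plus_emeasure) (auto simp: Un_absorb1)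
    ultimately show "\<exists>U. open U \<and> K \<subseteq> U \<and> emeasure ?n U \<le> emeasure ?n K + ennreal e"
      using V by (intro exI[of _ V]) (auto intro: add_left_mono)
  qed simp
qed

lemma compact_regular_measure_distr:
  assumes h: "continuous_on UNIV h" and k: "continuous_on UNIV k"
    and hk: "\<And>x. h (k x) = x" "\<And>x. k (h x) = x"
  shows "compact_regular_measure (distr m borel h)"
proof -
  have hm: "h \<in> borel_measurable borel" using h by (rule borel_measurable_continuous_onI)
  have n: "emeasure (distr m borel h) E = emeasure m (k ` E)" if "E \<in> sets borel" for E
  proof -
    have "h -` E = k ` E" using hk by (auto simp: image_iff) metis
    then show ?thesis using that hm by (subst emeasure_distr) auto
  qed
  have kc: "compact (k ` K)" if "compact K" for K
    using that k by (meson compact_continuous_image continuous_on_subset subset_UNIV)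
  show ?thesis unfolding compact_regular_measure_def
  proof (intro conjI allI impI)
    fix K :: "'a set" assume K: "compact K"
    show "emeasure (distr m borel h) K < \<infinity>"
      using emeasure_compact_finite[OF kc[OF K]] n[OF compact_in_borel[OF K]] by simp
    fix e :: real assume "e > 0"
    then obtain U where U: "open U" "k ` K \<subseteq> U" "emeasure m U \<le> emeasure m (k ` K) + ennreal e"
      using outer_regular_compact[OF kc[OF K]] by blast
    have kU: "open (k -` U)" using U(1) k by (rule open_vimage)
    have kU2: "k ` (k -` U) = U" using hk by (auto simp: image_iff) metis
    show "\<exists>U. open U \<and> K \<subseteq> U \<and> emeasure (distr m borel h) U \<le> emeasure (distr m borel h) K + ennreal e"
    proof (intro exI[of _ "k -` U"] conjI)
      show "K \<subseteq> k -` U" using U(2) by auto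
      show "emeasure (distr m borel h) (k -` U) \<le> emeasure (distr m borel h) K + ennreal e"
        using U(3) kU2 n[of "k -` U"] n[of K] kU compact_in_borel[OF K] by simp
    qed (rule kU)
  qed simp
qed

text \<open>A Urysohn function \<open>f\<close> between \<open>K\<close> and a nearly optimal open
  \<open>U\<close> sandwiches the common integral: the measure of \<open>K\<close> under
  \<open>n\<close> is below it, the measure of \<open>U\<close> under \<open>n'\<close> above
  it.\<close>

lemma compact_regular_measures_le_compact:
  assumes n: "compact_regular_measure n" "compact_regular_measure n'" and eq: "\<And>f. cc f \<Longrightarrow> (\<integral>x. f x \<partial>n) = (\<integral>x. f x \<partial>n')"
    and K: "compact K"
  shows "emeasure n K \<le> emeasure n' K"
proof (rule ennreal_le_epsilon)
  fix e :: real assume "emeasure n' K < top" "e > 0"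
  have [measurable_cong]: "sets n = sets borel" "sets n' = sets borel"
    using n by (auto simp: compact_regular_measure_def)
  obtain U where U: "open U" "K \<subseteq> U" "emeasure n' U \<le> emeasure n' K + ennreal e"
    using compact_regular_measure_outer[OF n(2) K \<open>e > 0\<close>] by auto
  obtain f where f: "cc f" "\<And>x. 0 \<le> f x" "\<And>x. f x \<le> 1" "\<And>x. x \<in> K \<Longrightarrow> f x = 1" "\<And>x. x \<notin> U \<Longrightarrow> f x = 0"
    using Urysohn_cc[OF lc K U(1,2)] by metis
  have int: "integrable q f" if q: "compact_regular_measure q" for q
  proof -
    obtain L C where L: "f \<in> borel_measurable borel" "compact L" "\<And>x. x \<notin> L \<Longrightarrow> f x = 0"
      using cc_imp_bcs[OF f(1)] by (metis bcsE)
    have "sets q = sets borel" "emeasure q L < \<infinity>" using q L(2) by (auto simp: compact_regular_measure_def)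
    then show ?thesis
      using L f(2,3) by (intro integrableI_bounded_set[of L _ f 1])
        (auto simp: compact_in_borel measurable_cong_sets[of q borel])
  qed
  have Ks: "K \<in> sets n" "U \<in> sets n'" using n K U(1) by (auto simp: compact_regular_measure_def compact_in_borel)
  have "emeasure n K = (\<integral>\<^sup>+x. indicator K x \<partial>n)" using Ks by simp
  also have "\<dots> \<le> (\<integral>\<^sup>+x. ennreal (f x) \<partial>n)"
    using f(4) by (intro nn_integral_mono) (auto simp: indicator_def)
  also have "\<dots> = ennreal (\<integral>x. f x \<partial>n)"
    using int[OF n(1)] f(2) by (intro nn_integral_eq_integral) auto
  also have "\<dots> = ennreal (\<integral>x. f x \<partial>n')" using eq[OF f(1)] by simp
  also have "\<dots> = (\<integral>\<^sup>+x. ennreal (f x) \<partial>n')"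
    using int[OF n(2)] f(2) by (intro nn_integral_eq_integral[symmetric]) auto
  also have "\<dots> \<le> (\<integral>\<^sup>+x. indicator U x \<partial>n')"
    using f(3,5) by (intro nn_integral_mono) (auto simp: indicator_def)
  also have "\<dots> = emeasure n' U" using Ks by simp
  finally show "emeasure n K \<le> emeasure n' K + ennreal e" using U(3) by simp
qed

text \<open>Both measures agree on compact sets. Restricted to a compact \<open>Q\<close> carrying
  \<open>f\<close> they become finite and agree on closed sets, an intersection-stable generator of
  the Borel sets.\<close>

lemma compact_regular_measures_eq_integral_bcs:
  assumes n: "compact_regular_measure n" "compact_regular_measure n'" and eq: "\<And>f. cc f \<Longrightarrow> (\<integral>x. f x \<partial>n) = (\<integral>x. f x \<partial>n')"
    and f: "bcs f"
  shows "(\<integral>x. f x \<partial>n) = (\<integral>x. f x \<partial>n')"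
proof -
  have sets_n [measurable_cong]: "sets n = sets borel" "sets n' = sets borel"
    using n by (auto simp: compact_regular_measure_def)
  obtain Q C where Q: "f \<in> borel_measurable borel" "compact Q" "\<And>x. x \<notin> Q \<Longrightarrow> f x = 0"
    using f by (metis bcsE)
  note [measurable] = Q(1) compact_in_borel[OF Q(2)]
  have K: "emeasure n K = emeasure n' K" if "compact K" for K
    using compact_regular_measures_le_compact[OF n eq that] compact_regular_measures_le_compact[OF n(2,1) eq[symmetric] that]
    by (rule antisym)
  have Qs: "emeasure (density n (\<lambda>x. ennreal (indicator Q x))) E = emeasure n (Q \<inter> E)"
      "emeasure (density n' (\<lambda>x. ennreal (indicator Q x))) E = emeasure n' (Q \<inter> E)" if "E \<in> sets borel" for E
  proof -
    have *: "ennreal (indicator Q x) * indicator E x = indicator (Q \<inter> E) x" for x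
      by (auto simp: indicator_def)
    have "Q \<inter> E \<in> sets n" "Q \<inter> E \<in> sets n'" using that compact_in_borel[OF Q(2)] sets_n by auto
    then show "emeasure (density n (\<lambda>x. ennreal (indicator Q x))) E = emeasure n (Q \<inter> E)"
      "emeasure (density n' (\<lambda>x. ennreal (indicator Q x))) E = emeasure n' (Q \<inter> E)"
      using that sets_n by (simp_all add: emeasure_density *)
  qed
  have "density n (\<lambda>x. ennreal (indicator Q x)) = density n' (\<lambda>x. ennreal (indicator Q x))"
  proof (rule measure_eqI_generator_eq[where E = "Collect closed" and A = "\<lambda>_. UNIV" and \<Omega> = UNIV])
    show "Int_stable (Collect closed :: 'a set set)" by (auto simp: Int_stable_def)
    show "sets (density n (\<lambda>x. ennreal (indicator Q x))) = sigma_sets UNIV (Collect closed)"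
      "sets (density n' (\<lambda>x. ennreal (indicator Q x))) = sigma_sets UNIV (Collect closed)"
      using sets_n by (auto simp: borel_eq_closed)
    fix X :: "'a set" assume "X \<in> Collect closed"
    then have "compact (Q \<inter> X)" "X \<in> sets borel" using Q(2) by (auto intro: compact_Int_closed)
    then show "emeasure (density n (\<lambda>x. ennreal (indicator Q x))) X =
        emeasure (density n' (\<lambda>x. ennreal (indicator Q x))) X"
      using K Qs by simp
  next
    show "emeasure (density n (\<lambda>x. ennreal (indicator Q x))) UNIV \<noteq> \<infinity>"
      using n(1) Q(2) Qs(1)[of UNIV] by (auto simp: compact_regular_measure_def)
  qed auto
  moreover have "(\<integral>x. f x \<partial>q) = (\<integral>x. f x \<partial>density q (\<lambda>x. ennreal (indicator Q x)))"
    if q: "sets q = sets borel" for q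
  proof -
    have [measurable_cong]: "sets q = sets borel" by (rule q)
    have "(\<integral>x. f x \<partial>density q (\<lambda>x. ennreal (indicator Q x))) = (\<integral>x. indicator Q x *\<^sub>R f x \<partial>q)"
      by (intro integral_density) auto
    also have "\<dots> = (\<integral>x. f x \<partial>q)"
      using Q(3) by (intro Bochner_Integration.integral_cong refl) (auto simp: indicator_def)
    finally show ?thesis by simp
  qed
  ultimately show ?thesis using sets_n by metis
qed

lemma integral_right_translate:
  assumes f: "bcs f" shows "(\<integral>y. f (y + x) \<partial>m) = modular x * (\<integral>x. f x \<partial>m)"
proof -
  have [measurable]: "(\<lambda>y. y + x) \<in> borel_measurable borel"
    by (intro borel_measurable_continuous_onI continuous_intros)
  have d: "(\<integral>y. g y \<partial>distr m borel (\<lambda>y. y + x)) = (\<integral>y. g (y + x) \<partial>m)"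
    "(\<integral>y. g y \<partial>density m (\<lambda>_. ennreal (modular x))) = modular x * (\<integral>y. g y \<partial>m)" if "bcs g" for g
  proof -
    have [measurable]: "g \<in> borel_measurable borel" using that by (simp add: bcs_def)
    show "(\<integral>y. g y \<partial>distr m borel (\<lambda>y. y + x)) = (\<integral>y. g (y + x) \<partial>m)"
      by (rule integral_distr) auto
    show "(\<integral>y. g y \<partial>density m (\<lambda>_. ennreal (modular x))) = modular x * (\<integral>y. g y \<partial>m)"
      using modular_pos[of x] by (subst integral_density) (auto intro: less_imp_le)
  qed
  have n1: "compact_regular_measure (distr m borel (\<lambda>y. y + x))"
    by (rule compact_regular_measure_distr[where k = "\<lambda>y. y - x"]) (auto intro!: continuous_intros simp: add.assoc)
  have n2: "compact_regular_measure (density m (\<lambda>_. ennreal (modular x)))"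
    using modular_pos[of x] by (intro compact_regular_measure_density) (auto intro: less_imp_le)
  have "(\<integral>y. f y \<partial>distr m borel (\<lambda>y. y + x)) = (\<integral>y. f y \<partial>density m (\<lambda>_. ennreal (modular x)))"
    by (rule compact_regular_measures_eq_integral_bcs[OF n1 n2 _ f])
       (simp add: d cc_imp_bcs integral_right_translate_cc)
  then show ?thesis using d[OF f] by simp
qed

lemma integral_uminus:
  assumes f: "bcs f" shows "(\<integral>x. f (- x) \<partial>m) = (\<integral>x. modular x * f x \<partial>m)"
proof -
  have [measurable]: "(uminus :: 'a \<Rightarrow> 'a) \<in> borel_measurable borel"
    "modular \<in> borel_measurable borel"
    by (auto intro!: borel_measurable_continuous_onI continuous_intros continuous_on_modular)
  have d: "(\<integral>y. g y \<partial>distr m borel uminus) = (\<integral>y. g (- y) \<partial>m)"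
    "(\<integral>y. g y \<partial>density m (\<lambda>y. ennreal (modular y))) = (\<integral>y. modular y * g y \<partial>m)" if "bcs g" for g
  proof -
    have [measurable]: "g \<in> borel_measurable borel" using that by (simp add: bcs_def)
    show "(\<integral>y. g y \<partial>distr m borel uminus) = (\<integral>y. g (- y) \<partial>m)"
      by (rule integral_distr) auto
    show "(\<integral>y. g y \<partial>density m (\<lambda>y. ennreal (modular y))) = (\<integral>y. modular y * g y \<partial>m)"
      using modular_pos by (subst integral_density) (auto intro: less_imp_le)
  qed
  have n1: "compact_regular_measure (distr m borel uminus)"
    by (rule compact_regular_measure_distr[where k = uminus]) (auto intro!: continuous_intros)
  have n2: "compact_regular_measure (density m (\<lambda>y. ennreal (modular y)))"
    using modular_pos by (intro compact_regular_measure_density continuous_on_modular) (auto intro: less_imp_le)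
  have "(\<integral>y. f y \<partial>distr m borel uminus) = (\<integral>y. f y \<partial>density m (\<lambda>y. ennreal (modular y)))"
    by (rule compact_regular_measures_eq_integral_bcs[OF n1 n2 _ f])
       (simp add: d cc_imp_bcs integral_uminus_cc)
  then show ?thesis using d[OF f] by simp
qed

lemma measure_right_translate:
  assumes "E \<in> sets borel" "E \<subseteq> K" "compact K"
  shows "measure m ((\<lambda>y. y + x) ` E) = modular (- x) * measure m E"
proof -
  have "measure m ((\<lambda>y. y + x) ` E) = (\<integral>y. indicator ((\<lambda>y. y + x) ` E) y \<partial>m)"
    by simp
  also have "\<dots> = (\<integral>y. indicator E (y + - x) \<partial>m)"
    by (intro Bochner_Integration.integral_cong refl)
       (auto simp: right_translate_eq_vimage indicator_def)
  also have "\<dots> = modular (- x) * measure m E"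
    by (subst integral_right_translate) (use assms bcs_indicator in auto)
  finally show ?thesis .
qed

end

section \<open>A Hahn--Banach theorem for spaces of functions\<close>

text \<open>The vector space is a set of functions rather than a type because it will be a space of
  finite families of \<open>bcs\<close> functions, cut out by conditions.\<close>

definition function_space :: "('b \<Rightarrow> real) set \<Rightarrow> bool" where
  "function_space V \<longleftrightarrow> (\<lambda>_. 0) \<in> V \<and> (\<forall>f\<in>V. \<forall>g\<in>V. (\<lambda>x. f x + g x) \<in> V) \<and>
     (\<forall>c. \<forall>f\<in>V. (\<lambda>x. c * f x) \<in> V)"

definition sublinear_on :: "('b \<Rightarrow> real) set \<Rightarrow> (('b \<Rightarrow> real) \<Rightarrow> real) \<Rightarrow> bool" where
  "sublinear_on V q \<longleftrightarrow> (\<forall>f\<in>V. \<forall>g\<in>V. q (\<lambda>x. f x + g x) \<le> q f + q g) \<and>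
     (\<forall>f\<in>V. \<forall>c>0. q (\<lambda>x. c * f x) \<le> c * q f)"

context
  fixes V :: "('b \<Rightarrow> real) set"
  assumes V: "function_space V"
begin

lemma fs_add: "f \<in> V \<Longrightarrow> g \<in> V \<Longrightarrow> (\<lambda>x. f x + g x) \<in> V"
  and fs_scale: "f \<in> V \<Longrightarrow> (\<lambda>x. c * f x) \<in> V"
  and fs_zero: "(\<lambda>_. 0) \<in> V"
  using V by (auto simp: function_space_def)

lemma sublinear_on_scale:
  assumes q: "sublinear_on V q" and f: "f \<in> V" and c: "c > 0"
  shows "q (\<lambda>x. c * f x) = c * q f"
proof (rule antisym)
  show "q (\<lambda>x. c * f x) \<le> c * q f" using assms by (simp add: sublinear_on_def)
  have "q (\<lambda>x. inverse c * (c * f x)) \<le> inverse c * q (\<lambda>x. c * f x)"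
    using q fs_scale[OF f, of c] c unfolding sublinear_on_def by (metis inverse_positive_iff_positive)
  then show "c * q f \<le> q (\<lambda>x. c * f x)" using c by (simp add: field_simps)
qed

lemma sublinear_on_zero:
  assumes q: "sublinear_on V q" shows "q (\<lambda>_. 0) = 0"
  using sublinear_on_scale[OF q fs_zero, of 2] by simp

lemma sublinear_on_minus:
  assumes q: "sublinear_on V q" and f: "f \<in> V"
  shows "- q (\<lambda>x. - 1 * f x) \<le> q f"
proof -
  have "q (\<lambda>x. f x + - 1 * f x) \<le> q f + q (\<lambda>x. - 1 * f x)"
    using q[unfolded sublinear_on_def, THEN conjunct1, rule_format, OF f fs_scale[OF f, of "-1"]] .
  then show ?thesis using sublinear_on_zero[OF q] by simp
qed

text \<open>Supplies the bounds of chains for Zorn's lemma. The infimum is finite because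
  \<open>q f\<close> is at least \<open>- p (- f)\<close>, and subadditive because of two members of
  a chain one lies below the other. The value \<open>0\<close> off \<open>V\<close> keeps the
  infimum among the normalized functionals of \<open>Hahn_Banach_functions\<close>.\<close>

lemma chain_Inf_sublinear_on:
  assumes ne: "C \<noteq> {}" and sub: "\<And>q. q \<in> C \<Longrightarrow> sublinear_on V q"
    and le: "\<And>q f. q \<in> C \<Longrightarrow> f \<in> V \<Longrightarrow> q f \<le> p f"
    and total: "\<And>q r. q \<in> C \<Longrightarrow> r \<in> C \<Longrightarrow> (\<forall>f. q f \<le> r f) \<or> (\<forall>f. r f \<le> q f)"
  defines "u \<equiv> \<lambda>f. if f \<in> V then (INF q\<in>C. q f) else 0"
  shows "sublinear_on V u" and "\<And>q f. q \<in> C \<Longrightarrow> f \<in> V \<Longrightarrow> u f \<le> q f"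
proof -
  have bdd: "bdd_below ((\<lambda>q. q f) ` C)" if "f \<in> V" for f
  proof (rule bdd_belowI)
    fix y assume "y \<in> (\<lambda>q. q f) ` C"
    then obtain q where q: "q \<in> C" "y = q f" by blast
    show "- p (\<lambda>x. - 1 * f x) \<le> y"
      using sublinear_on_minus[OF sub[OF q(1)] that] le[OF q(1) fs_scale[OF that, of "-1"]] q(2)
      by linarith
  qed
  show uq: "u f \<le> q f" if "q \<in> C" "f \<in> V" for q f
    using that cINF_lower[OF bdd] by (simp add: u_def)
  show "sublinear_on V u" unfolding sublinear_on_def
  proof (intro conjI ballI allI impI)
    fix f g assume fg: "f \<in> V" "g \<in> V"
    have *: "u (\<lambda>x. f x + g x) \<le> q f + r g" if qr: "q \<in> C" "r \<in> C" for q r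
    proof -
      obtain s where s: "s \<in> C" "\<forall>f. s f \<le> q f" "\<forall>f. s f \<le> r f"
        using total[OF qr] qr by (metis order_refl)
      have "u (\<lambda>x. f x + g x) \<le> s (\<lambda>x. f x + g x)" by (rule uq[OF s(1) fs_add[OF fg]])
      also have "\<dots> \<le> s f + s g" using sub[OF s(1)] fg unfolding sublinear_on_def by blast
      also have "\<dots> \<le> q f + r g" using s by (intro add_mono) auto
      finally show ?thesis .
    qed
    have "u (\<lambda>x. f x + g x) - u f \<le> r g" if r: "r \<in> C" for r
    proof -
      have "u (\<lambda>x. f x + g x) - r g \<le> (INF q\<in>C. q f)"
        using *[OF _ r] by (intro cINF_greatest ne) (simp add: algebra_simps)
      then show ?thesis using fg by (simp add: u_def)
    qed
    then have "u (\<lambda>x. f x + g x) - u f \<le> (INF q\<in>C. q g)" by (intro cINF_greatest ne)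
    then show "u (\<lambda>x. f x + g x) \<le> u f + u g" using fg by (simp add: u_def)
  next
    fix f and c :: real assume f: "f \<in> V" and c: "c > 0"
    have "u (\<lambda>x. c * f x) / c \<le> (INF q\<in>C. q f)"
    proof (rule cINF_greatest[OF ne])
      fix q assume q: "q \<in> C"
      show "u (\<lambda>x. c * f x) / c \<le> q f"
        using uq[OF q fs_scale[OF f, of c]] sublinear_on_scale[OF sub[OF q] f c] c
        by (simp add: field_simps)
    qed
    then show "u (\<lambda>x. c * f x) \<le> c * u f" using c f by (simp add: u_def field_simps)
  qed
qed

text \<open>Minimality is applied to \<open>r f = inf\<^bsub>t \<ge> 0\<^esub> (q (f + t y) - t q y)\<close>.\<close>
lemma minimal_sublinear_on_linear:
  assumes q: "sublinear_on V q"
    and min: "\<And>r. sublinear_on V r \<Longrightarrow> (\<And>f. f \<in> V \<Longrightarrow> r f \<le> q f) \<Longrightarrow> (\<And>f. f \<in> V \<Longrightarrow> r f = q f)"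
    and f: "f \<in> V" and y: "y \<in> V"
  shows "q (\<lambda>x. f x + y x) = q f + q y"
proof -
  define r where "r f = (INF t\<in>{0..}. q (\<lambda>x. f x + t * y x) - t * q y)" for f
  have add: "q (\<lambda>x. f x + g x) \<le> q f + q g" if "f \<in> V" "g \<in> V" for f g
    using q that by (simp add: sublinear_on_def)
  have ty: "q (\<lambda>x. t * y x) = t * q y" if "t \<ge> 0" for t
    using sublinear_on_scale[OF q y, of t] sublinear_on_zero[OF q] that by (cases "t = 0") auto
  have mem: "(\<lambda>x. f x + t * y x) \<in> V" if "f \<in> V" for f t using fs_add[OF that fs_scale[OF y]] .
  have bdd: "bdd_below ((\<lambda>t. q (\<lambda>x. f x + t * y x) - t * q y) ` {0..})" if f: "f \<in> V" for f
  proof (rule bdd_belowI)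
    fix z assume "z \<in> (\<lambda>t. q (\<lambda>x. f x + t * y x) - t * q y) ` {0..}"
    then obtain t where t: "t \<ge> 0" "z = q (\<lambda>x. f x + t * y x) - t * q y" by auto
    have "q (\<lambda>x. (f x + t * y x) + - 1 * f x) \<le> q (\<lambda>x. f x + t * y x) + q (\<lambda>x. - 1 * f x)"
      by (rule add[OF mem[OF f] fs_scale[OF f]])
    then show "- q (\<lambda>x. - 1 * f x) \<le> z" using t ty[OF t(1)] by simp
  qed
  have r_le: "r f \<le> q (\<lambda>x. f x + t * y x) - t * q y" if "f \<in> V" "t \<ge> 0" for f t
    unfolding r_def using that by (intro cINF_lower bdd) auto
  have "sublinear_on V r" unfolding sublinear_on_def
  proof (intro conjI ballI allI impI)
    fix f g assume fg: "f \<in> V" "g \<in> V"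
    have *: "r (\<lambda>x. f x + g x) \<le> (q (\<lambda>x. f x + t * y x) - t * q y) + (q (\<lambda>x. g x + s * y x) - s * q y)"
      if ts: "t \<ge> 0" "s \<ge> 0" for t s
    proof -
      have "r (\<lambda>x. f x + g x) \<le> q (\<lambda>x. (f x + g x) + (t + s) * y x) - (t + s) * q y"
        using ts by (intro r_le fs_add fg) auto
      moreover have "q (\<lambda>x. (f x + t * y x) + (g x + s * y x)) \<le> q (\<lambda>x. f x + t * y x) + q (\<lambda>x. g x + s * y x)"
        by (intro add mem fg)
      ultimately show ?thesis by (simp add: algebra_simps)
    qed
    have "r (\<lambda>x. f x + g x) - r f \<le> q (\<lambda>x. g x + s * y x) - s * q y" if s: "s \<ge> 0" for s
    proof -
      have "r (\<lambda>x. f x + g x) - (q (\<lambda>x. g x + s * y x) - s * q y) \<le> r f"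
        unfolding r_def[of f] using *[OF _ s] by (intro cINF_greatest) (auto simp: algebra_simps)
      then show ?thesis by simp
    qed
    then have "r (\<lambda>x. f x + g x) - r f \<le> r g"
      unfolding r_def[of g] by (intro cINF_greatest) auto
    then show "r (\<lambda>x. f x + g x) \<le> r f + r g" by simp
  next
    fix f and c :: real assume f: "f \<in> V" and c: "c > 0"
    have "r (\<lambda>x. c * f x) / c \<le> r f"
      unfolding r_def[of f]
    proof (rule cINF_greatest)
      fix t :: real assume t: "t \<in> {0..}"
      have "r (\<lambda>x. c * f x) \<le> q (\<lambda>x. c * f x + (c * t) * y x) - (c * t) * q y"
        using t c by (intro r_le fs_scale f) auto
      also have "(\<lambda>x. c * f x + (c * t) * y x) = (\<lambda>x. c * (f x + t * y x))"
        by (simp add: algebra_simps)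
      also have "q \<dots> = c * q (\<lambda>x. f x + t * y x)" by (rule sublinear_on_scale[OF q mem[OF f] c])
      finally show "r (\<lambda>x. c * f x) / c \<le> q (\<lambda>x. f x + t * y x) - t * q y"
        using c by (simp add: field_simps)
    qed simp
    then show "r (\<lambda>x. c * f x) \<le> c * r f" using c by (simp add: field_simps)
  qed
  moreover have "r f \<le> q f" if "f \<in> V" for f using r_le[OF that, of 0] by simp
  ultimately have "r f = q f" using min f by blast
  \<comment> \<open>Minimality has given \<open>r f = q f\<close>, and \<open>r f\<close> is at most
    the term of its infimum at \<open>t = 1\<close>.\<close>
  then have "q f + q y \<le> q (\<lambda>x. f x + y x)" using r_le[OF f, of 1] by simp
  then show ?thesis using add[OF f y] by simp
qed

text \<open>A minimal sublinear functional below \<open>p\<close> is linear. Zorn's lemma is used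
  for the reversed pointwise order, and functionals are set to \<open>0\<close> off \<open>V\<close>
  so that agreement on \<open>V\<close> means equality.\<close>

theorem Hahn_Banach_functions:
  assumes p: "sublinear_on V p"
  obtains L where "\<And>f g. f \<in> V \<Longrightarrow> g \<in> V \<Longrightarrow> L (\<lambda>x. f x + g x) = L f + L g"
    "\<And>f c. f \<in> V \<Longrightarrow> L (\<lambda>x. c * f x) = c * L f" "\<And>f. f \<in> V \<Longrightarrow> L f \<le> p f"
proof -
  define A where "A = {q. sublinear_on V q \<and> (\<forall>f\<in>V. q f \<le> p f) \<and> (\<forall>f. f \<notin> V \<longrightarrow> q f = 0)}"
  define P where "P = (\<lambda>q r :: ('b \<Rightarrow> real) \<Rightarrow> real. \<forall>f. r f \<le> q f)"
  have "\<exists>q\<in>A. \<forall>r\<in>A. P q r \<longrightarrow> r = q"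
  proof (rule predicate_Zorn)
    show "partial_order_on A (relation_of P A)"
      unfolding P_def by (rule partial_order_on_relation_ofI) (auto intro: order_trans simp: fun_eq_iff order_antisym)
    fix C assume "C \<in> Chains (relation_of P A)"
    then have CA: "C \<subseteq> A" and tot: "\<And>q r. q \<in> C \<Longrightarrow> r \<in> C \<Longrightarrow> P q r \<or> P r q"
      by (auto simp: Chains_def relation_of_def)
    show "\<exists>u\<in>A. \<forall>a\<in>C. P a u"
    proof (cases "C = {}")
      case True
      have "(\<lambda>f. if f \<in> V then p f else 0) \<in> A"
        using p fs_add fs_scale by (auto simp: A_def sublinear_on_def)
      then show ?thesis using True by blast
    next
      case False
      define u where "u = (\<lambda>f. if f \<in> V then (INF q\<in>C. q f) else 0)"
      have u: "sublinear_on V u" "\<And>q f. q \<in> C \<Longrightarrow> f \<in> V \<Longrightarrow> u f \<le> q f"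
        unfolding u_def
        using chain_Inf_sublinear_on[OF False, of p] CA tot by (auto simp: A_def P_def subset_iff)
      obtain q0 where q0: "q0 \<in> C" using False by blast
      have "u f \<le> p f" if "f \<in> V" for f
        using u(2)[OF q0 that] q0 CA that by (force simp: A_def)
      then have "u \<in> A" using u(1) by (auto simp: A_def u_def)
      moreover have "P q u" if "q \<in> C" for q
        using u(2)[OF that] CA that by (auto simp: P_def A_def u_def subset_iff)
      ultimately show ?thesis by blast
    qed
  qed
  then obtain q where q: "sublinear_on V q" "\<And>f. f \<in> V \<Longrightarrow> q f \<le> p f" "\<And>f. f \<notin> V \<Longrightarrow> q f = 0"
    and max: "\<And>r. r \<in> A \<Longrightarrow> P q r \<Longrightarrow> r = q" by (auto simp: A_def)
  have min: "r f = q f" if r: "sublinear_on V r" "\<And>f. f \<in> V \<Longrightarrow> r f \<le> q f" "f \<in> V" for r f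
  proof -
    define r' where "r' f = (if f \<in> V then r f else 0)" for f
    have "r' \<in> A"
      using r(1,2) q(2) fs_add fs_scale by (fastforce simp: A_def sublinear_on_def r'_def)
    moreover have "P q r'" using r(2) q(3) by (simp add: P_def r'_def)
    ultimately have "r' = q" by (rule max)
    then have "r' f = q f" by simp
    then show ?thesis using r(3) by (simp add: r'_def)
  qed
  have add: "q (\<lambda>x. f x + g x) = q f + q g" if "f \<in> V" "g \<in> V" for f g
  proof (rule minimal_sublinear_on_linear[OF q(1) _ that])
    fix r f assume "sublinear_on V r" "\<And>f. f \<in> V \<Longrightarrow> r f \<le> q f" "f \<in> V"
    then show "r f = q f" by (rule min)
  qed
  have scale: "q (\<lambda>x. c * f x) = c * q f" if f: "f \<in> V" for f c
  proof -
    consider "c = 0" | "c > 0" | "c < 0" by linarith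
    then show ?thesis
    proof cases
      case 1 then show ?thesis using sublinear_on_zero[OF q(1)] by simp
    next
      case 2 then show ?thesis by (rule sublinear_on_scale[OF q(1) f])
    next
      case 3
      have "q (\<lambda>x. c * f x + (- c) * f x) = q (\<lambda>x. c * f x) + q (\<lambda>x. (- c) * f x)"
        by (intro add fs_scale f)
      then show ?thesis
        using sublinear_on_scale[OF q(1) f, of "- c"] 3 sublinear_on_zero[OF q(1)] by simp
    qed
  qed
  show ?thesis using that[of q] add scale q(2) by blast
qed

text \<open>The cone \<open>C\<close> consists of pairs of a vector and the value that the functional
  should dominate there.\<close>
corollary Hahn_Banach_cone:
  assumes N_add: "\<And>f g. f \<in> V \<Longrightarrow> g \<in> V \<Longrightarrow> N (\<lambda>x. f x + g x) \<le> N f + N g"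
    and N_scale: "\<And>f c. f \<in> V \<Longrightarrow> N (\<lambda>x. c * f x) = \<bar>c\<bar> * N f"
    and C0: "((\<lambda>_. 0), 0) \<in> C" and CV: "\<And>f i. (f, i) \<in> C \<Longrightarrow> f \<in> V"
    and C_add: "\<And>f g i j. (f, i) \<in> C \<Longrightarrow> (g, j) \<in> C \<Longrightarrow> ((\<lambda>x. f x + g x), i + j) \<in> C"
    and C_scale: "\<And>f i c. (f, i) \<in> C \<Longrightarrow> c > 0 \<Longrightarrow> ((\<lambda>x. c * f x), c * i) \<in> C"
    and N_C: "\<And>f i. (f, i) \<in> C \<Longrightarrow> i \<le> N f"
  obtains L where "\<And>f g. f \<in> V \<Longrightarrow> g \<in> V \<Longrightarrow> L (\<lambda>x. f x + g x) = L f + L g"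
    "\<And>f c. f \<in> V \<Longrightarrow> L (\<lambda>x. c * f x) = c * L f" "\<And>f. f \<in> V \<Longrightarrow> \<bar>L f\<bar> \<le> N f"
    "\<And>f i. (f, i) \<in> C \<Longrightarrow> i \<le> L f"
proof -
  \<comment> \<open>The zero pair gives \<open>p f \<le> N f\<close>, and a pair
    \<open>(c, i)\<close> of the cone gives \<open>p (- c) \<le> - i\<close>. A linear functional
    below \<open>p\<close> is therefore both bounded by \<open>N\<close> and at least
    \<open>i\<close> at \<open>c\<close>.\<close>
  define p where "p f = (INF (c, i)\<in>C. N (\<lambda>x. f x + c x) - i)" for f
  have N0: "N (\<lambda>_. 0) = 0" using N_scale[OF fs_zero, of 0] by simp
  have bdd: "bdd_below ((\<lambda>(c, i). N (\<lambda>x. f x + c x) - i) ` C)" if f: "f \<in> V" for f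
  proof (rule bdd_belowI)
    fix z assume "z \<in> (\<lambda>(c, i). N (\<lambda>x. f x + c x) - i) ` C"
    then obtain c i where c: "(c, i) \<in> C" "z = N (\<lambda>x. f x + c x) - i" by auto
    have "N (\<lambda>x. (f x + c x) + - 1 * f x) \<le> N (\<lambda>x. f x + c x) + N (\<lambda>x. - 1 * f x)"
      by (intro N_add fs_add fs_scale f CV[OF c(1)])
    then show "- N f \<le> z" using c N_C[OF c(1)] N_scale[OF f, of "-1"] by simp
  qed
  have p_le: "p f \<le> N (\<lambda>x. f x + c x) - i" if "f \<in> V" "(c, i) \<in> C" for f c i
    unfolding p_def using cINF_lower[OF bdd[OF that(1)] that(2)] by simp
  have ge: "z \<le> p f" if "\<And>c i. (c, i) \<in> C \<Longrightarrow> z \<le> N (\<lambda>x. f x + c x) - i" for z f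
    unfolding p_def using C0 that by (intro cINF_greatest) auto
  have "sublinear_on V p" unfolding sublinear_on_def
  proof (intro conjI ballI allI impI)
    fix f g assume fg: "f \<in> V" "g \<in> V"
    have *: "p (\<lambda>x. f x + g x) \<le> (N (\<lambda>x. f x + c x) - i) + (N (\<lambda>x. g x + d x) - j)"
      if cd: "(c, i) \<in> C" "(d, j) \<in> C" for c i d j
    proof -
      have "p (\<lambda>x. f x + g x) \<le> N (\<lambda>x. (f x + g x) + (c x + d x)) - (i + j)"
        by (intro p_le fs_add fg C_add cd)
      moreover have "N (\<lambda>x. (f x + c x) + (g x + d x)) \<le> N (\<lambda>x. f x + c x) + N (\<lambda>x. g x + d x)"
        by (intro N_add fs_add fg CV[OF cd(1)] CV[OF cd(2)])
      ultimately show ?thesis by (simp add: algebra_simps)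
    qed
    have "p (\<lambda>x. f x + g x) - p f \<le> p g"
    proof (rule ge)
      fix d j assume d: "(d, j) \<in> C"
      have "p (\<lambda>x. f x + g x) - (N (\<lambda>x. g x + d x) - j) \<le> p f"
        using *[OF _ d] by (intro ge) (simp add: algebra_simps)
      then show "p (\<lambda>x. f x + g x) - p f \<le> N (\<lambda>x. g x + d x) - j" by simp
    qed
    then show "p (\<lambda>x. f x + g x) \<le> p f + p g" by simp
  next
    fix f and c :: real assume f: "f \<in> V" and c: "c > 0"
    have "p (\<lambda>x. c * f x) / c \<le> p f"
    proof (rule ge)
      fix d i assume d: "(d, i) \<in> C"
      have "p (\<lambda>x. c * f x) \<le> N (\<lambda>x. c * f x + c * d x) - c * i"
        by (intro p_le fs_scale f C_scale d c)
      also have "(\<lambda>x. c * f x + c * d x) = (\<lambda>x. c * (f x + d x))" by (simp add: algebra_simps)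
      also have "N \<dots> = c * N (\<lambda>x. f x + d x)" using c by (simp add: N_scale fs_add f CV[OF d])
      finally show "p (\<lambda>x. c * f x) / c \<le> N (\<lambda>x. f x + d x) - i"
        using c by (simp add: field_simps)
    qed
    then show "p (\<lambda>x. c * f x) \<le> c * p f" using c by (simp add: field_simps)
  qed
  then obtain L where L: "\<And>f g. f \<in> V \<Longrightarrow> g \<in> V \<Longrightarrow> L (\<lambda>x. f x + g x) = L f + L g"
    "\<And>f c. f \<in> V \<Longrightarrow> L (\<lambda>x. c * f x) = c * L f" "\<And>f. f \<in> V \<Longrightarrow> L f \<le> p f"
    by (rule Hahn_Banach_functions) (rule that)
  have LN: "L f \<le> N f" if "f \<in> V" for f
    using L(3)[OF that] p_le[OF that C0] by simp
  have "\<bar>L f\<bar> \<le> N f" if "f \<in> V" for f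
    using LN[OF that] LN[OF fs_scale[OF that, of "-1"]] L(2)[OF that, of "-1"] N_scale[OF that, of "-1"]
    by (simp add: abs_le_iff)
  moreover have "i \<le> L c" if c: "(c, i) \<in> C" for c i
    using L(3)[OF fs_scale[OF CV[OF c], of "-1"]] p_le[OF fs_scale[OF CV[OF c], of "-1"] c]
      L(2)[OF CV[OF c], of "-1"] N0 by simp
  ultimately show ?thesis using that[of L] L(1,2) by blast
qed

end

section \<open>Normalized right translation\<close>

context haar_group
begin

definition bump :: "'a set \<Rightarrow> ('a \<Rightarrow> real) \<Rightarrow> bool" where
  "bump N w \<longleftrightarrow> cc w \<and> (\<forall>x. 0 \<le> w x) \<and> (\<forall>x. x \<notin> N \<longrightarrow> w x = 0) \<and> (\<integral>x. w x \<partial>m) = 1"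

lemma bumpD:
  assumes "bump N w"
  shows "cc w" "\<And>x. 0 \<le> w x" "\<And>x. x \<notin> N \<Longrightarrow> w x = 0" "(\<integral>x. w x \<partial>m) = 1"
  using assms by (auto simp: bump_def)

lemma bump_exists: "open N \<Longrightarrow> 0 \<in> N \<Longrightarrow> \<exists>w. bump N w"
  unfolding bump_def using cc_zero_nhd_bump by metis

text \<open>The density of \<open>h * \<delta>\<^sub>x\<close>.\<close>
definition rtr :: "'a \<Rightarrow> ('a \<Rightarrow> real) \<Rightarrow> 'a \<Rightarrow> real" where
  "rtr x h = (\<lambda>z. modular x * h (z - x))"

lemma bcs_rtr: "bcs h \<Longrightarrow> bcs (rtr x h)"
  using bcs_scale[OF bcs_translate_right[of h "- x"], of "modular x"] by (simp add: rtr_def)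

lemma cc_rtr: "cc h \<Longrightarrow> cc (rtr x h)"
  using cc_scale[OF cc_translate_right[of h "- x"], of "modular x"] by (simp add: rtr_def)

lemma integral_rtr:
  assumes "bcs h" shows "(\<integral>z. rtr x h z \<partial>m) = (\<integral>z. h z \<partial>m)"
  using integral_right_translate[OF assms, of "- x"] modular_pos[of x]
  by (simp add: rtr_def modular_minus)

lemma integral_abs_rtr:
  assumes "bcs h" shows "(\<integral>z. \<bar>rtr x h z\<bar> \<partial>m) = (\<integral>z. \<bar>h z\<bar> \<partial>m)"
  using integral_rtr[OF bcs_abs[OF assms], of x] modular_pos[of x]
  by (simp add: rtr_def abs_mult)

lemma rtr_rtr: "rtr x (rtr y h) = rtr (y + x) h"
  by (auto simp: rtr_def modular_add diff_conv_add_uminus minus_add add.assoc simp del: add_uminus_conv_diff)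

lemma rtr_diff: "rtr x (\<lambda>z. h z - k z) = (\<lambda>z. rtr x h z - rtr x k z)"
  by (simp add: rtr_def algebra_simps)

lemma rtr_add: "rtr x (\<lambda>z. h z + k z) = (\<lambda>z. rtr x h z + rtr x k z)"
  by (simp add: rtr_def algebra_simps)

lemma rtr_scale: "rtr x (\<lambda>z. c * h z) = (\<lambda>z. c * rtr x h z)"
  by (simp add: rtr_def algebra_simps)

lemma rtr_left_translate: "rtr x (\<lambda>z. h (k + z)) = (\<lambda>z. rtr x h (k + z))"
  by (simp add: rtr_def add_diff_eq)

text \<open>Right translation is continuous in the integral norm: \<open>w\<close> is uniformly
  continuous, \<open>modular\<close> is continuous at \<open>0\<close>, and for small
  \<open>n\<close> everything happens on one compact set.\<close>

lemma rtr_continuous: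
  assumes w: "cc w" and e: "e > 0"
  obtains N where "open N" "0 \<in> N" "\<And>n. n \<in> N \<Longrightarrow> (\<integral>z. \<bar>rtr n w z - w z\<bar> \<partial>m) < e"
proof -
  obtain N0 C :: "'a set" where N0: "open N0" "compact C" "0 \<in> N0" "N0 \<subseteq> C"
    using locally_compact_zero_nhd[OF lc] .
  obtain K B where K: "compact K" "\<And>x. x \<notin> K \<Longrightarrow> w x = 0" and B: "\<And>x. \<bar>w x\<bar> \<le> B" "B \<ge> 0"
    using cc_imp_bcs[OF w] by (metis bcsE)
  have KC: "compact (K \<union> (K + C))" using K(1) N0(2) by (intro compact_Un compact_set_plus)
  \<comment> \<open>The factor \<open>B + 1\<close> collects the change of \<open>modular\<close>,
    worth \<open>d * B\<close>, and the change of \<open>w\<close>, worth \<open>d\<close>.\<close>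
  obtain d where d: "d > 0" "d * ((B + 1) * measure m (K \<union> (K + C))) < e"
    using small_factor[of "(B + 1) * measure m (K \<union> (K + C))" e] B(2) e by (metis add_nonneg_nonneg measure_nonneg mult_nonneg_nonneg zero_le_one)
  obtain N1 where N1: "open N1" "0 \<in> N1" "\<And>t z. t \<in> N1 \<Longrightarrow> \<bar>w (z + t) - w z\<bar> < d"
    using cc_uniform_right[OF w d(1)] by blast
  have op: "open {n. \<bar>modular n - 1\<bar> < d}"
    by (intro open_Collect_less continuous_intros continuous_on_modular)
  define N where "N = N0 \<inter> uminus ` N1 \<inter> {n. \<bar>modular n - 1\<bar> < d}"
  have "(\<integral>z. \<bar>rtr n w z - w z\<bar> \<partial>m) < e" if n: "n \<in> N" for n
  proof -
    have "\<bar>rtr n w z - w z\<bar> \<le> d * (B + 1)" for z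
    proof -
      have "rtr n w z - w z = (modular n - 1) * w (z - n) + (w (z - n) - w z)"
        by (simp add: rtr_def algebra_simps)
      moreover have "\<bar>(modular n - 1) * w (z - n)\<bar> \<le> d * B"
        unfolding abs_mult using n B d(1) by (intro mult_mono) (auto simp: N_def)
      moreover have "\<bar>w (z - n) - w z\<bar> \<le> d"
        using N1(3)[of "- n" z] n by (auto simp: N_def intro: less_imp_le)
      ultimately show ?thesis by (simp add: algebra_simps)
    qed
    moreover have "rtr n w z - w z = 0" if "z \<notin> K \<union> (K + C)" for z
    proof -
      have "z - n \<notin> K"
      proof
        assume "z - n \<in> K"
        then have "(z - n) + n \<in> K + C" using n N0(4) by (intro set_plus_intro) (auto simp: N_def)
        then show False using that by simp
      qed
      then show ?thesis using that K(2) by (simp add: rtr_def)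
    qed
    ultimately have "(\<integral>z. \<bar>rtr n w z - w z\<bar> \<partial>m) \<le> (d * (B + 1)) * measure m (K \<union> (K + C))"
      using cc_imp_bcs[OF w] by (intro integral_bcs_bound(2) bcs_diff bcs_rtr KC) auto
    then show ?thesis using d(2) by (simp add: mult.assoc)
  qed
  moreover have "open N" "0 \<in> N"
    using N0 N1 op d(1) open_uminus_image[OF N1(1)] by (auto simp: N_def uminus_image_eq_vimage)
  ultimately show ?thesis using that by blast
qed

text \<open>Both the convolution \<open>w * q\<close>, which is close to \<open>q\<close> when \<open>w\<close> is concentrated near \<open>0\<close>,
  and its Riemann sums, which are combinations of right translates of \<open>w\<close>, approximate \<open>q\<close>.\<close>
lemma cc_approx_right_translates:
  assumes q: "cc q" and e: "e > 0"
  shows "\<exists>N. open N \<and> 0 \<in> N \<and> (\<forall>w. bump N w \<longrightarrow>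
    (\<exists>X b. finite X \<and> (\<integral>z. \<bar>q z - (\<Sum>a\<in>X. b a * rtr (- a) w z)\<bar> \<partial>m) \<le> e))"
proof -
  obtain N0 C :: "'a set" where N0: "open N0" "compact C" "0 \<in> N0" "N0 \<subseteq> C"
    using locally_compact_zero_nhd[OF lc] .
  obtain K where qc: "continuous_on UNIV q" and K: "compact K" "\<And>x. x \<notin> K \<Longrightarrow> q x = 0"
    using q by (auto simp: cc_def)
  define K1 where "K1 = uminus ` K"
  define Q where "Q = C + K"
  have K1: "compact K1" and Q: "compact Q"
    unfolding K1_def Q_def using K N0 by (intro compact_uminus_image compact_set_plus; simp)+
  have KQ: "K \<subseteq> Q" using N0(3,4) unfolding Q_def by (force simp: set_plus_def)
  have "0 \<le> (1 + measure m K1) * measure m Q" by (simp add: measure_nonneg)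
  then obtain d where d: "d > 0" "d * ((1 + measure m K1) * measure m Q) < e"
    using small_factor e by metis
  obtain N1 where N1: "open N1" "0 \<in> N1" "\<And>t z. t \<in> N1 \<Longrightarrow> \<bar>q (t + z) - q z\<bar> < d"
    using cc_uniform_left[OF q d(1)] by blast
  define N where "N = N0 \<inter> uminus ` N1"
  show ?thesis
  proof (rule exI[of _ N], intro conjI allI impI)
    show "open N" "0 \<in> N"
      using N0 N1 open_uminus_image[OF N1(1)] by (auto simp: N_def uminus_image_eq_vimage)
    fix w assume bw: "bump N w"
    note w = bumpD[OF bw]
    have wc: "continuous_on UNIV w" using w(1) by (simp add: cc_def)
    \<comment> \<open>The integrand of the convolution \<open>w * q\<close> at \<open>z\<close>
      after \<open>y\<close> has been replaced by \<open>z + y\<close>; frozen at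
      \<open>y = a\<close> it is a multiple of a right translate of \<open>w\<close>.\<close>
    define F where "F y z = w (z + y) * q (- y)" for y z
    have Fc: "continuous_on UNIV (\<lambda>(y, z). F y z)" unfolding F_def case_prod_unfold
      by (intro continuous_intros continuous_on_compose2[OF wc] continuous_on_compose2[OF qc]) auto
    obtain X \<sigma> where X: "finite X" "X \<subseteq> K1" and \<sigma>: "\<And>x. x \<in> K1 \<Longrightarrow> \<sigma> x \<in> X"
      and F: "\<And>x y. x \<in> K1 \<Longrightarrow> y \<in> Q \<Longrightarrow> \<bar>F x y - F (\<sigma> x) y\<bar> < d"
      and P: "\<And>a. {x\<in>K1. \<sigma> x = a} \<in> sets borel"
      by (rule compact_uniform_choice[OF K1 Q Fc d(1)]) (rule that)
    define p where "p a = measure m {x\<in>K1. \<sigma> x = a}" for a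
    \<comment> \<open>The factor \<open>modular a\<close> cancels the normalization
      \<open>modular (- a)\<close> contained in \<open>rtr (- a) w\<close>.\<close>
    define b where "b a = p a * q (- a) * modular a" for a
    have b: "b a * rtr (- a) w z = p a * F a z" for a z
      using modular_pos[of a] by (simp add: b_def rtr_def F_def modular_minus)
    have conv: "\<bar>q z - (\<integral>y. F y z \<partial>m)\<bar> \<le> d" for z
    proof -
      have bw: "bcs (\<lambda>y. (q (- y + z) - q z) * w y)"
      proof (rule bcs_mult_bounded[OF cc_imp_bcs[OF w(1)]])
        show "(\<lambda>y. q (- y + z) - q z) \<in> borel_measurable borel"
          by (intro borel_measurable_continuous_onI continuous_intros continuous_on_compose2[OF qc]) auto
        fix y assume "w y \<noteq> 0"
        then show "\<bar>q (- y + z) - q z\<bar> \<le> d"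
          using w(3)[of y] N1(3)[of "- y" z] by (force simp: N_def)
      qed
      have bwq: "(\<lambda>y. w y * q (- y + z)) \<in> borel_measurable borel"
        by (intro borel_measurable_continuous_onI continuous_intros continuous_on_compose2[OF qc]
            continuous_on_compose2[OF wc]) auto
      have "(\<integral>y. F y z \<partial>m) = (\<integral>y. w y * q (- y + z) \<partial>m)"
        using integral_left_translate[OF bwq, of z] by (simp add: F_def minus_add add.assoc)
      also have "\<dots> = (\<integral>y. (q (- y + z) - q z) * w y + q z * w y \<partial>m)"
        by (simp add: algebra_simps)
      also have "\<dots> = (\<integral>y. (q (- y + z) - q z) * w y \<partial>m) + q z"
        using integrable_bcs[OF bw] integrable_cc[OF w(1)] w(4)
        by (subst Bochner_Integration.integral_add) auto
      finally have "\<bar>q z - (\<integral>y. F y z \<partial>m)\<bar> = \<bar>\<integral>y. (q (- y + z) - q z) * w y \<partial>m\<bar>" by simp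
      also have "\<dots> \<le> (\<integral>y. \<bar>(q (- y + z) - q z) * w y\<bar> \<partial>m)" by (rule integral_abs_bound)
      also have "\<dots> \<le> (\<integral>y. d * w y \<partial>m)"
      proof (rule integral_mono)
        show "integrable m (\<lambda>y. \<bar>(q (- y + z) - q z) * w y\<bar>)"
          by (intro integrable_bcs bcs_abs bw)
        show "integrable m (\<lambda>y. d * w y)" using integrable_cc[OF w(1)] by simp
        fix y
        show "\<bar>(q (- y + z) - q z) * w y\<bar> \<le> d * w y"
        proof (cases "w y = 0")
          case False
          then have "\<bar>q (- y + z) - q z\<bar> \<le> d"
            using w(3)[of y] N1(3)[of "- y" z] by (force simp: N_def)
          then show ?thesis using w(2)[of y] by (simp add: abs_mult mult_right_mono)
        qed simp
      qed
      finally show ?thesis using w(4) by simp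
    qed
    have "\<bar>q z - (\<Sum>a\<in>X. p a * F a z)\<bar> \<le> d * (1 + measure m K1)" if z: "z \<in> Q" for z
    proof -
      obtain B where B: "\<And>x. \<bar>w x\<bar> \<le> B" using cc_imp_bcs[OF w(1)] by (metis bcsE)
      have "bcs (\<lambda>y. F y z)" unfolding F_def
        by (intro bcs_mult_bounded[OF cc_imp_bcs[OF cc_uminus[OF q]], where B = B] B
            borel_measurable_continuous_onI continuous_on_compose2[OF wc] continuous_intros) auto
      moreover have "F y z = 0" if "y \<notin> K1" for y
        using that K(2)[of "- y"] by (simp add: F_def K1_def uminus_image_eq_vimage)
      ultimately have "\<bar>(\<integral>y. F y z \<partial>m) - (\<Sum>a\<in>X. p a * F a z)\<bar> \<le> d * measure m K1"
        unfolding p_def using F[OF _ z] by (intro riemann_sum[OF K1 X(1) \<sigma> P]) (auto intro: less_imp_le)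
      then show ?thesis using conv[of z] by (simp add: algebra_simps)
    qed
    moreover have "q z - (\<Sum>a\<in>X. p a * F a z) = 0" if z: "z \<notin> Q" for z
    proof -
      have "F a z = 0" if a: "a \<in> X" for a
      proof -
        have "z + a \<notin> N"
        proof
          assume "z + a \<in> N"
          moreover have "- a \<in> K" using a X(2) by (auto simp: K1_def)
          ultimately have "(z + a) + - a \<in> Q" unfolding Q_def
            using N0(4) by (intro set_plus_intro) (auto simp: N_def)
          then show False using z by (simp add: add.assoc)
        qed
        then show ?thesis using w(3) by (simp add: F_def)
      qed
      then show ?thesis using z KQ K(2) by auto
    qed
    moreover have "bcs (\<lambda>z. q z - (\<Sum>a\<in>X. p a * F a z))"
      unfolding b[symmetric]
      by (intro bcs_diff bcs_sum bcs_scale bcs_rtr cc_imp_bcs q w X)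
    ultimately have "(\<integral>z. \<bar>q z - (\<Sum>a\<in>X. p a * F a z)\<bar> \<partial>m) \<le> (d * (1 + measure m K1)) * measure m Q"
      by (intro integral_bcs_bound(2)[OF _ Q])
    then show "\<exists>X b. finite X \<and> (\<integral>z. \<bar>q z - (\<Sum>a\<in>X. b a * rtr (- a) w z)\<bar> \<partial>m) \<le> e"
      using d(2) X(1) by (intro exI[of _ X] exI[of _ b]) (simp add: b mult.assoc)
  qed
qed

end


section \<open>Invariant means\<close>

text \<open>What is kept of an element of \<open>TLIM m\<close>: its real part on bounded real Borel
  functions, with invariance tested on continuous compactly supported densities.\<close>

locale invariant_mean = haar_group m
  for m :: "'a::{topological_group_add,t2_space} measure" +
  fixes M :: "('a \<Rightarrow> real) \<Rightarrow> real"
  assumes M_add: "\<And>f g. bdd_borel f \<Longrightarrow> bdd_borel g \<Longrightarrow> M (\<lambda>x. f x + g x) = M f + M g"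
    and M_scale: "\<And>f c. bdd_borel f \<Longrightarrow> M (\<lambda>x. c * f x) = c * M f"
    and M_mono: "\<And>f g. bdd_borel f \<Longrightarrow> bdd_borel g \<Longrightarrow> (\<And>x. f x \<le> g x) \<Longrightarrow> M f \<le> M g"
    and M_one: "M (\<lambda>_. 1) = 1"
    and M_conv: "\<And>f \<phi>. cc f \<Longrightarrow> (\<And>x. 0 \<le> f x) \<Longrightarrow> (\<integral>x. f x \<partial>m) = 1 \<Longrightarrow> bdd_borel \<phi> \<Longrightarrow>
      M (\<lambda>x. \<integral>y. f y * \<phi> (- y + x) \<partial>m) = M \<phi>"
begin

lemma M_const: "M (\<lambda>_. c) = c"
  using M_scale[OF bdd_borel_const[of 1], of c] M_one by simp

lemma M_diff: "bdd_borel f \<Longrightarrow> bdd_borel g \<Longrightarrow> M (\<lambda>x. f x - g x) = M f - M g"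
  using M_add[of f "\<lambda>x. - 1 * g x"] M_scale[of g "-1"] bdd_borel_scale[of g "-1"] by simp

lemma M_sum: "finite I \<Longrightarrow> (\<And>i. i \<in> I \<Longrightarrow> bdd_borel (f i)) \<Longrightarrow> M (\<lambda>x. \<Sum>i\<in>I. f i x) = (\<Sum>i\<in>I. M (f i))"
  by (induction I rule: finite_induct) (auto simp: M_const M_add bdd_borel_sum)

lemma M_close:
  assumes "bdd_borel f" "bdd_borel g" "\<And>x. \<bar>f x - g x\<bar> \<le> e"
  shows "\<bar>M f - M g\<bar> \<le> e"
proof -
  have "M f \<le> M (\<lambda>x. g x + e)" "M g \<le> M (\<lambda>x. f x + e)"
  proof -
    have "f x \<le> g x + e" "g x \<le> f x + e" for x using assms(3)[of x] by linarith+
    then show "M f \<le> M (\<lambda>x. g x + e)" "M g \<le> M (\<lambda>x. f x + e)"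
      by (intro M_mono bdd_borel_add bdd_borel_const assms; simp)+
  qed
  then show ?thesis
    using assms by (simp add: M_add bdd_borel_const M_const abs_le_iff)
qed

section \<open>Means of orbits \<open>x \<mapsto> L (rtr x q)\<close> under a norm-bounded
  functional \<open>L\<close>\<close>

context
  fixes L :: "('a \<Rightarrow> real) \<Rightarrow> real"
  assumes L_add: "\<And>f g. bcs f \<Longrightarrow> bcs g \<Longrightarrow> L (\<lambda>x. f x + g x) = L f + L g"
    and L_scale: "\<And>f c. bcs f \<Longrightarrow> L (\<lambda>x. c * f x) = c * L f"
    and L_le: "\<And>f. bcs f \<Longrightarrow> \<bar>L f\<bar> \<le> (\<integral>x. \<bar>f x\<bar> \<partial>m)"
begin

lemma L_diff: "bcs f \<Longrightarrow> bcs g \<Longrightarrow> L (\<lambda>x. f x - g x) = L f - L g"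
  using L_add[of f "\<lambda>x. - 1 * g x"] L_scale[of g "-1"] bcs_scale[of g "-1"] by simp

lemma L_rtr_close:
  assumes "bcs f" "bcs g"
  shows "\<bar>L (rtr x f) - L (rtr x g)\<bar> \<le> (\<integral>z. \<bar>f z - g z\<bar> \<partial>m)"
  using L_le[OF bcs_rtr[OF bcs_diff[OF assms]], of x] integral_abs_rtr[OF bcs_diff[OF assms], of x]
    L_diff[OF bcs_rtr[OF assms(1)] bcs_rtr[OF assms(2)], of x x]
  by (simp add: rtr_diff)

lemma L_rtr_abs_le: "bcs f \<Longrightarrow> \<bar>L (rtr x f)\<bar> \<le> (\<integral>z. \<bar>f z\<bar> \<partial>m)"
  using L_le[OF bcs_rtr] by (simp add: integral_abs_rtr)

text \<open>\<open>rtr x\<close> preserves the integral norm and \<open>rtr x (rtr n w)\<close> is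
  \<open>rtr (n + x) w\<close>, so continuity at \<open>0\<close> becomes uniform in
  \<open>x\<close>.\<close>

lemma L_rtr_uniform:
  assumes w: "cc w" and e: "e > 0"
  obtains N where "open N" "0 \<in> N" "\<And>n x. n \<in> N \<Longrightarrow> \<bar>L (rtr (n + x) w) - L (rtr x w)\<bar> < e"
proof -
  obtain N where N: "open N" "0 \<in> N" "\<And>n. n \<in> N \<Longrightarrow> (\<integral>z. \<bar>rtr n w z - w z\<bar> \<partial>m) < e"
    using rtr_continuous[OF w e] by blast
  have "\<bar>L (rtr (n + x) w) - L (rtr x w)\<bar> < e" if "n \<in> N" for n x
    using L_rtr_close[of "rtr n w" w x] N(3)[OF that] bcs_rtr cc_imp_bcs[OF w]
    by (force simp: rtr_rtr)
  then show ?thesis using that N by blast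
qed

lemma L_rtr_continuous:
  assumes w: "cc w" shows "continuous_on UNIV (\<lambda>x. L (rtr x w))"
  unfolding continuous_on_def
proof (intro ballI tendstoI)
  fix x0 and e :: real assume "e > 0"
  then obtain N where N: "open N" "0 \<in> N" "\<And>n x. n \<in> N \<Longrightarrow> \<bar>L (rtr (n + x) w) - L (rtr x w)\<bar> < e"
    using L_rtr_uniform[OF w] by blast
  show "\<forall>\<^sub>F x in at x0 within UNIV. dist (L (rtr x w)) (L (rtr x0 w)) < e"
    unfolding eventually_at_topological
  proof (intro exI[of _ "(\<lambda>y. y + x0) ` N"] conjI ballI impI)
    show "open ((\<lambda>y. y + x0) ` N)" by (rule open_right_translate[OF N(1)])
    show "x0 \<in> (\<lambda>y. y + x0) ` N" using N(2) by (intro image_eqI[of _ _ 0]) auto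
    show "dist (L (rtr x w)) (L (rtr x0 w)) < e" if "x \<in> (\<lambda>y. y + x0) ` N" for x
      using that N(3) by (auto simp: dist_real_def)
  qed
qed

lemma L_rtr_bdd_borel: "cc w \<Longrightarrow> bdd_borel (\<lambda>x. L (rtr x w))"
  by (rule bdd_borel_continuous[OF L_rtr_continuous L_rtr_abs_le]) (auto intro: cc_imp_bcs)

text \<open>Convolving the orbit function with a density concentrated near \<open>- y\<close> nearly
  produces its shift by \<open>y\<close>, uniformly by \<open>L_rtr_uniform\<close>, while
  \<open>M\<close> does not change under convolution.\<close>

lemma M_L_rtr_invariant:
  assumes w: "cc w"
  shows "M (\<lambda>x. L (rtr x (rtr y w))) = M (\<lambda>x. L (rtr x w))"
proof -
  have "\<bar>M (\<lambda>x. L (rtr x (rtr y w))) - M (\<lambda>x. L (rtr x w))\<bar> \<le> e * 1" if e: "e > 0" for e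
  proof -
    obtain N where N: "open N" "0 \<in> N" "\<And>n x. n \<in> N \<Longrightarrow> \<bar>L (rtr (n + x) w) - L (rtr x w)\<bar> < e"
      using L_rtr_uniform[OF w e] by blast
    have "open (uminus ` N)" "0 \<in> uminus ` N"
      using N open_uminus_image[OF N(1)] by (auto simp: uminus_image_eq_vimage)
    then obtain b where "bump (uminus ` N) b"
      using bump_exists by blast
    note b = bumpD[OF this]
    \<comment> \<open>Where \<open>f z\<close> is nonzero, \<open>- (y + z)\<close> lies in
      \<open>N\<close>, and it carries \<open>y + x\<close> to \<open>- z + x\<close>.\<close>
    define f where "f z = b (y + z)" for z
    have f: "cc f" "\<And>z. 0 \<le> f z" unfolding f_def using b by (auto intro: cc_translate_left)
    have f1: "(\<integral>z. f z \<partial>m) = 1"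
      using integral_left_translate[of b y] b cc_imp_bcs[OF b(1)] by (simp add: f_def bcs_def)
    let ?\<Phi> = "\<lambda>x. L (rtr x w)"
    have cont: "continuous_on UNIV ?\<Phi>" by (rule L_rtr_continuous[OF w])
    obtain K where fc: "continuous_on UNIV f" and K: "compact K" "\<And>x. x \<notin> K \<Longrightarrow> f x = 0"
      using f by (auto simp: cc_def)
    have bcs: "bcs (\<lambda>z. ?\<Phi> (- z + x) * f z)" for x
    proof (rule bcs_mult_bounded[OF cc_imp_bcs[OF f(1)]])
      show "(\<lambda>z. ?\<Phi> (- z + x)) \<in> borel_measurable borel"
        by (intro borel_measurable_continuous_onI continuous_on_compose2[OF cont] continuous_intros) auto
      show "\<bar>?\<Phi> (- z + x)\<bar> \<le> (\<integral>z. \<bar>w z\<bar> \<partial>m)" for z by (rule L_rtr_abs_le[OF cc_imp_bcs[OF w]])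
    qed
    let ?c = "\<lambda>x. \<integral>z. f z * ?\<Phi> (- z + x) \<partial>m"
    have close: "\<bar>?c x - ?\<Phi> (y + x)\<bar> \<le> e" for x
    proof -
      have bcs': "bcs (\<lambda>z. (?\<Phi> (- z + x) - ?\<Phi> (y + x)) * f z)"
        using bcs_diff[OF bcs[of x] bcs_scale[OF cc_imp_bcs[OF f(1)], of "?\<Phi> (y + x)"]]
        by (simp add: algebra_simps)
      have "?c x - ?\<Phi> (y + x) = (\<integral>z. ?\<Phi> (- z + x) * f z \<partial>m) - (\<integral>z. ?\<Phi> (y + x) * f z \<partial>m)"
        using f1 by (simp add: mult.commute)
      also have "\<dots> = (\<integral>z. (?\<Phi> (- z + x) - ?\<Phi> (y + x)) * f z \<partial>m)"
        using integrable_bcs[OF bcs[of x]] integrable_cc[OF f(1)]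
        by (subst Bochner_Integration.integral_diff[symmetric]) (auto simp: algebra_simps)
      also have "\<bar>\<dots>\<bar> \<le> (\<integral>z. \<bar>(?\<Phi> (- z + x) - ?\<Phi> (y + x)) * f z\<bar> \<partial>m)" by (rule integral_abs_bound)
      also have "\<dots> \<le> (\<integral>z. e * f z \<partial>m)"
      proof (rule integral_mono)
        show "integrable m (\<lambda>z. \<bar>(?\<Phi> (- z + x) - ?\<Phi> (y + x)) * f z\<bar>)" by (intro integrable_bcs bcs_abs bcs')
        show "integrable m (\<lambda>z. e * f z)" using integrable_cc[OF f(1)] by simp
        show "\<bar>(?\<Phi> (- z + x) - ?\<Phi> (y + x)) * f z\<bar> \<le> e * f z" for z
        proof (cases "f z = 0")
          case False
          then have "y + z \<in> uminus ` N" using b(3)[of "y + z"] by (auto simp: f_def)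
          then have "- (y + z) \<in> N" by auto
          moreover have "- (y + z) + (y + x) = - z + x"
            by (simp only: minus_add add.assoc minus_add_cancel)
          ultimately have "\<bar>?\<Phi> (- z + x) - ?\<Phi> (y + x)\<bar> \<le> e"
            using N(3)[of "- (y + z)" "y + x"] by simp
          then show ?thesis using f(2)[of z] by (simp add: abs_mult mult_right_mono)
        qed simp
      qed
      finally show ?thesis using f1 by simp
    qed
    have Bc: "bdd_borel ?c"
    proof (rule bdd_borel_continuous)
      have cF: "continuous_on UNIV (\<lambda>(x, z). f z * ?\<Phi> (- z + x))" unfolding case_prod_unfold
        by (intro continuous_on_mult continuous_on_compose2[OF fc] continuous_on_compose2[OF cont]
            continuous_intros) auto
      show "continuous_on UNIV ?c"
        by (rule continuous_on_parametric_integral[OF cF K(1) open_UNIV]) (simp add: K(2))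
      show "\<bar>?c x\<bar> \<le> e + (\<integral>z. \<bar>w z\<bar> \<partial>m)" for x
        using close[of x] L_rtr_abs_le[OF cc_imp_bcs[OF w], of "y + x"] by linarith
    qed
    have BT: "bdd_borel (\<lambda>x. ?\<Phi> (y + x))"
    proof (rule bdd_borel_continuous)
      show "continuous_on UNIV (\<lambda>x. ?\<Phi> (y + x))"
        by (intro continuous_on_compose2[OF cont] continuous_intros) auto
    qed (rule L_rtr_abs_le[OF cc_imp_bcs[OF w]])
    have "\<bar>M ?c - M (\<lambda>x. ?\<Phi> (y + x))\<bar> \<le> e" by (rule M_close[OF Bc BT close])
    moreover have "M ?c = M ?\<Phi>" by (rule M_conv[OF f f1 L_rtr_bdd_borel[OF w]])
    ultimately show ?thesis by (simp add: rtr_rtr)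
  qed
  then have "M (\<lambda>x. L (rtr x (rtr y w))) - M (\<lambda>x. L (rtr x w)) = 0"
    by (rule eq_0_if_abs_le_all[rotated]) simp_all
  then show ?thesis by simp
qed

text \<open>Replace \<open>q\<close> by a nearby combination of right translates of
  \<open>w\<close>. By \<open>M_L_rtr_invariant\<close> its orbit has mean equal to the sum of
  coefficients times that of \<open>w\<close>, and this sum is the integral of the combination. One
  \<open>e\<close> pays for each of the two approximations, as the mean for \<open>w\<close> is at
  most \<open>1\<close> in absolute value.\<close>

lemma M_L_rtr_proportional:
  assumes q: "cc q" and e: "e > 0"
  shows "\<exists>N. open N \<and> 0 \<in> N \<and> (\<forall>w. bump N w \<longrightarrow>
    \<bar>M (\<lambda>x. L (rtr x q)) - M (\<lambda>x. L (rtr x w)) * (\<integral>x. q x \<partial>m)\<bar> \<le> 2 * e)"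
proof -
  obtain N where N: "open N" "0 \<in> N"
    "\<And>w. bump N w \<Longrightarrow>
      \<exists>X b. finite X \<and> (\<integral>z. \<bar>q z - (\<Sum>a\<in>X. b a * rtr (- a) w z)\<bar> \<partial>m) \<le> e"
    using cc_approx_right_translates[OF q e] by auto
  show ?thesis
  proof (rule exI[of _ N], intro conjI allI impI N(1,2))
    fix w assume bw: "bump N w"
    note w = bumpD[OF bw]
    obtain X b where X: "finite X" "(\<integral>z. \<bar>q z - (\<Sum>a\<in>X. b a * rtr (- a) w z)\<bar> \<partial>m) \<le> e"
      using N(3)[OF bw] by blast
    let ?s = "\<lambda>z. \<Sum>a\<in>X. b a * rtr (- a) w z"
    have cs: "cc ?s" by (intro cc_sum cc_scale cc_rtr w X)
    have cs': "cc (\<lambda>z. b a * rtr (- a) w z)" for a by (intro cc_scale cc_rtr w)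
    have Lsum: "L (rtr x ?s) = (\<Sum>a\<in>X. b a * L (rtr x (rtr (- a) w)))" for x
      using X(1)
    proof (induction X rule: finite_induct)
      case empty
      show ?case using L_scale[OF bcs_zero, of 0] by (simp add: rtr_def)
    next
      case (insert a X)
      have bR: "bcs (rtr x (rtr (- a) w))" by (intro bcs_rtr cc_imp_bcs w)
      have "bcs (rtr x (\<lambda>z. \<Sum>a\<in>X. b a * rtr (- a) w z))"
        by (intro bcs_rtr bcs_sum bcs_scale cc_imp_bcs w insert.hyps)
      then have "L (rtr x (\<lambda>z. b a * rtr (- a) w z + (\<Sum>a\<in>X. b a * rtr (- a) w z)))
        = b a * L (rtr x (rtr (- a) w)) + L (rtr x (\<lambda>z. \<Sum>a\<in>X. b a * rtr (- a) w z))"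
        unfolding rtr_add rtr_scale using L_add[OF bcs_scale[OF bR]] L_scale[OF bR] by simp
      then show ?case using insert by simp
    qed
    have "M (\<lambda>x. L (rtr x ?s)) = (\<Sum>a\<in>X. b a * M (\<lambda>x. L (rtr x w)))"
      unfolding Lsum
      using X(1) L_rtr_bdd_borel[OF cc_rtr[OF w(1)]]
      by (subst M_sum) (auto intro!: bdd_borel_scale simp: M_scale M_L_rtr_invariant[OF w(1)])
    then have 1: "M (\<lambda>x. L (rtr x ?s)) = (\<Sum>a\<in>X. b a) * M (\<lambda>x. L (rtr x w))"
      by (simp add: sum_distrib_right)
    have 2: "\<bar>M (\<lambda>x. L (rtr x q)) - M (\<lambda>x. L (rtr x ?s))\<bar> \<le> e"
      using L_rtr_close[OF cc_imp_bcs[OF q] cc_imp_bcs[OF cs]] X(2)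
      by (intro M_close L_rtr_bdd_borel q cs) (meson order_trans)
    have int_s: "(\<integral>z. ?s z \<partial>m) = (\<Sum>a\<in>X. b a)"
      using integrable_bcs[OF bcs_rtr[OF cc_imp_bcs[OF w(1)]]] w(4) cc_imp_bcs[OF w(1)]
      by (subst Bochner_Integration.integral_sum) (auto simp: integral_rtr)
    have "\<bar>\<integral>z. (q z - ?s z) \<partial>m\<bar> \<le> e"
      using integral_abs_bound[of m "\<lambda>z. q z - ?s z"] X(2) by linarith
    then have 3: "\<bar>(\<integral>z. q z \<partial>m) - (\<Sum>a\<in>X. b a)\<bar> \<le> e"
      using integrable_cc[OF q] integrable_cc[OF cs] int_s by simp
    have wM: "\<bar>M (\<lambda>x. L (rtr x w))\<bar> \<le> 1"
      using M_close[OF L_rtr_bdd_borel[OF w(1)] bdd_borel_const[of 0], of 1]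
        L_rtr_abs_le[OF cc_imp_bcs[OF w(1)]] w(2,4) by (simp add: M_const)
    have "\<bar>((\<integral>z. q z \<partial>m) - (\<Sum>a\<in>X. b a)) * M (\<lambda>x. L (rtr x w))\<bar> \<le> e * 1"
      unfolding abs_mult using 3 wM e by (intro mult_mono) auto
    then show "\<bar>M (\<lambda>x. L (rtr x q)) - M (\<lambda>x. L (rtr x w)) * (\<integral>x. q x \<partial>m)\<bar> \<le> 2 * e"
      using 1 2 by (simp add: algebra_simps)
  qed
qed

text \<open>Uniqueness of Haar measure in approximate form: one \<open>w\<close> supported in both
  neighbourhoods serves \<open>q\<close> and \<open>q'\<close>, and each comparison costs
  \<open>2 * e\<close>.\<close>

lemma M_L_rtr_eq:
  assumes q: "cc q" "cc q'" and eq: "(\<integral>x. q x \<partial>m) = (\<integral>x. q' x \<partial>m)"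
  shows "M (\<lambda>x. L (rtr x q)) = M (\<lambda>x. L (rtr x q'))"
proof -
  have "\<bar>M (\<lambda>x. L (rtr x q)) - M (\<lambda>x. L (rtr x q'))\<bar> \<le> e * 4" if e: "e > 0" for e
  proof -
    obtain N where N: "open N" "0 \<in> N"
      "\<And>w. bump N w \<Longrightarrow>
      \<bar>M (\<lambda>x. L (rtr x q)) - M (\<lambda>x. L (rtr x w)) * (\<integral>x. q x \<partial>m)\<bar> \<le> 2 * e"
      using M_L_rtr_proportional[OF q(1) e] by auto
    obtain N' where N': "open N'" "0 \<in> N'"
      "\<And>w. bump N' w \<Longrightarrow>
      \<bar>M (\<lambda>x. L (rtr x q')) - M (\<lambda>x. L (rtr x w)) * (\<integral>x. q' x \<partial>m)\<bar> \<le> 2 * e"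
      using M_L_rtr_proportional[OF q(2) e] by auto
    obtain w where "bump (N \<inter> N') w"
      using bump_exists[of "N \<inter> N'"] N(1,2) N'(1,2) by blast
    then have "bump N w" "bump N' w" by (auto simp: bump_def)
    from N(3)[OF this(1)] N'(3)[OF this(2)]
    show ?thesis using eq by (simp add: abs_le_iff)
  qed
  then have "M (\<lambda>x. L (rtr x q)) - M (\<lambda>x. L (rtr x q')) = 0"
    by (rule eq_0_if_abs_le_all[rotated]) simp_all
  then show ?thesis by simp
qed

end

end

section \<open>Existence of Folner sets\<close>

context haar_group
begin

lemma fmeasurable_subset_compact:
  "E \<in> sets borel \<Longrightarrow> E \<subseteq> K \<Longrightarrow> compact K \<Longrightarrow> E \<in> fmeasurable m"
  by (intro fmeasurableI) (auto dest: emeasure_subset_compact_finite)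

lemma fmeasurable_compact: "compact K \<Longrightarrow> K \<in> fmeasurable m"
  by (rule fmeasurable_subset_compact) (auto intro: compact_in_borel)

lemma measure_Diff_Int:
  assumes "A \<in> fmeasurable m" "B \<in> fmeasurable m"
  shows "measure m (A - B) = measure m A - measure m (A \<inter> B)"
proof -
  have "A - B = A - (A \<inter> B)" by blast
  then show ?thesis
    using measurable_measure_Diff[OF assms(1), of "A \<inter> B"] assms by (auto dest: fmeasurableD)
qed

text \<open>Nonnegative combinations of right translates of \<open>U\<close>, without normalization,
  so that the failure of almost invariance is a homogeneous condition fit for
  \<open>Hahn_Banach_cone\<close>. Indicators let \<open>cone_thickening\<close> act term by
  term.\<close>

inductive cone :: "'a set \<Rightarrow> ('a \<Rightarrow> real) \<Rightarrow> bool" for U where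
  cone_zero: "cone U (\<lambda>_. 0)"
| cone_step: "cone U g \<Longrightarrow> c \<ge> 0 \<Longrightarrow> cone U (\<lambda>z. g z + c * indicator ((\<lambda>y. y + t) ` U) z)"

lemma cone_nonneg: "cone U g \<Longrightarrow> 0 \<le> g z"
  by (induction rule: cone.induct) auto

lemma cone_add:
  assumes "cone U h" "cone U g" shows "cone U (\<lambda>z. g z + h z)"
  using assms(1)
proof (induction rule: cone.induct)
  case cone_zero
  then show ?case using assms(2) by simp
next
  case (cone_step h c t)
  from cone.cone_step[OF this(3,2), of t] show ?case by (simp add: add.assoc)
qed

lemma cone_scale:
  assumes "cone U g" "c > 0" shows "cone U (\<lambda>z. c * g z)"
  using assms(1)
proof (induction rule: cone.induct)
  case cone_zero
  then show ?case using cone.cone_zero by simp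
next
  case (cone_step g d t)
  then have "c * d \<ge> 0" using assms(2) by simp
  from cone.cone_step[OF cone_step(3) this, of t] show ?case by (simp add: algebra_simps)
qed

lemma cone_rtr_indicator: "cone U (rtr x (indicator U))"
proof -
  have "rtr x (indicator U) = (\<lambda>z. 0 + modular x * indicator ((\<lambda>y. y + x) ` U) z)"
    by (auto simp: rtr_def right_translate_eq_vimage indicator_def)
  then show ?thesis using cone_step[OF cone_zero, of "modular x"] modular_pos[of x]
    by (simp add: less_imp_le)
qed

lemma cone_bcs:
  assumes "cone U g" "compact U" shows "bcs g"
  using assms(1)
proof (induction rule: cone.induct)
  case (cone_step g c t)
  have "compact ((\<lambda>y. y + t) ` U)" by (rule compact_right_translate[OF assms(2)])
  then show ?case
    by (intro bcs_add bcs_scale cone_step bcs_indicator[OF compact_in_borel]) auto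
qed (rule bcs_zero)

text \<open>Adding \<open>c\<close> on a translate \<open>?A\<close> adds to the set at level
  \<open>s\<close> the part of \<open>?A\<close> at level \<open>s - c\<close> of \<open>g\<close>;
  for \<open>s - c \<le> 0\<close> this part is all of \<open>?A\<close>.\<close>

lemma cone_superlevel_compact:
  assumes "cone U g" "compact U" "s > 0" shows "compact {z. s \<le> g z}"
  using assms(1,3)
proof (induction arbitrary: s rule: cone.induct)
  case cone_zero
  then show ?case by simp
next
  case (cone_step g c t)
  let ?A = "(\<lambda>y. y + t) ` U"
  have A: "compact ?A" by (rule compact_right_translate[OF assms(2)])
  have "compact (?A \<inter> {z. s - c \<le> g z})"
  proof (cases "s - c > 0")
    case True
    then show ?thesis using cone_step.IH[of "s - c"] A by (intro compact_Int)
  next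
    case False
    have "s - c \<le> g z" for z using cone_nonneg[OF cone_step.hyps(1), of z] False by linarith
    then have "?A \<inter> {z. s - c \<le> g z} = ?A" by auto
    then show ?thesis using A by simp
  qed
  moreover have "{z. s \<le> g z + c * indicator ?A z} = {z. s \<le> g z} \<union> (?A \<inter> {z. s - c \<le> g z})"
    using cone_step.hyps(2) by (auto simp: indicator_def)
  ultimately show ?case using cone_step.IH[OF cone_step.prems] by (simp add: compact_Un)
qed

text \<open>Links the indicators that generate \<open>cone\<close> with the \<open>cc\<close>
  functions for which the identities of means are available: a Urysohn function between
  \<open>U\<close> and a tight open neighbourhood.\<close>

lemma indicator_approx_cc:
  assumes U: "compact U" and d: "d > 0"
  shows "\<exists>q. cc q \<and> (\<integral>z. \<bar>q z - indicator U z\<bar> \<partial>m) \<le> d"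
proof -
  obtain O' where O: "open O'" "U \<subseteq> O'" "emeasure m O' \<le> emeasure m U + ennreal d"
    using outer_regular_compact[OF U d] by blast
  obtain q where q: "cc q" "\<And>x. 0 \<le> q x" "\<And>x. q x \<le> 1" "\<And>x. x \<in> U \<Longrightarrow> q x = 1" "\<And>x. x \<notin> O' \<Longrightarrow> q x = 0"
    using Urysohn_cc[OF lc U O(1,2)] by metis
  have "emeasure m O' < \<infinity>" using O(3) emeasure_compact_finite[OF U]
    by (rule_tac le_less_trans[OF O(3)]) (simp add: less_top[symmetric])
  then have fO: "O' \<in> fmeasurable m" using O(1) by (intro fmeasurableI) auto
  have fU: "U \<in> fmeasurable m" by (rule fmeasurable_compact[OF U])
  have "ennreal (measure m O') \<le> ennreal (measure m U + d)"
    using O(3) fO fU d by (simp add: emeasure_eq_measure2 ennreal_plus)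
  then have mO: "measure m O' \<le> measure m U + d"
    using d by (subst (asm) ennreal_le_iff) auto
  have bU: "bcs (indicator U)" using U by (intro bcs_indicator[of _ U] compact_in_borel) auto
  have "(\<integral>z. \<bar>q z - indicator U z\<bar> \<partial>m) \<le> (\<integral>z. indicator (O' - U) z \<partial>m)"
  proof (rule integral_mono)
    show "integrable m (\<lambda>z. \<bar>q z - indicator U z\<bar>)"
      by (intro integrable_bcs bcs_abs bcs_diff bU cc_imp_bcs q)
    show "integrable m (indicator (O' - U) :: 'a \<Rightarrow> real)"
      using fmeasurable.Diff[OF fO fU] by (intro integrable_real_indicator) (auto simp: fmeasurable_def)
    show "\<bar>q z - indicator U z\<bar> \<le> indicator (O' - U) z" for z
      using q(2)[of z] q(3)[of z] q(4)[of z] q(5)[of z] by (auto simp: indicator_def)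
  qed
  also have "\<dots> = measure m O' - measure m U"
    using fO fU O(2) by (simp add: measurable_measure_Diff fmeasurableD del: sets_m)
  finally show ?thesis using mO q(1) by (intro exI[of _ q]) linarith
qed

end

text \<open>The functional given by the Hahn--Banach theorem on \<open>F\<close>-indexed families is split into its
  components, the maps \<open>h \<mapsto> L (S k h)\<close>.\<close>
lemma (in invariant_mean) reiter:
  assumes U: "compact U" "measure m U > 0" and F: "finite F" and \<eta>: "\<eta> > 0"
  shows "\<exists>g. cone U g \<and> (\<Sum>k\<in>F. \<integral>z. \<bar>g (- k + z) - g z\<bar> \<partial>m) < \<eta> * (\<integral>z. g z \<partial>m)"
proof (rule ccontr)
  assume "\<not> ?thesis"
  then have contra: "\<eta> * (\<integral>z. g z \<partial>m) \<le> (\<Sum>k\<in>F. \<integral>z. \<bar>g (- k + z) - g z\<bar> \<partial>m)" if "cone U g" for g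
    using that by (meson not_less)
  define V where "V = {h :: 'a \<times> 'a \<Rightarrow> real. (\<forall>k. bcs (\<lambda>z. h (k, z))) \<and> (\<forall>k z. k \<notin> F \<longrightarrow> h (k, z) = 0)}"
  define N where "N h = (\<Sum>k\<in>F. \<integral>z. \<bar>h (k, z)\<bar> \<partial>m)" for h :: "'a \<times> 'a \<Rightarrow> real"
  define T where "T g = (\<lambda>(k, z). if k \<in> F then g (- k + z) - g z else 0)" for g :: "'a \<Rightarrow> real"
  \<comment> \<open>The second entry is the lower bound that the negated claim gives for
    \<open>N (T g)\<close>, so the cone hypothesis \<open>i \<le> N f\<close> is exactly that
    negation.\<close>
  define C where "C = {(T g, \<eta> * (\<integral>z. g z \<partial>m)) | g. cone U g}"
  have V: "function_space V"
    by (auto simp: function_space_def V_def intro: bcs_zero bcs_add bcs_scale)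
  have cb: "bcs g" if "cone U g" for g by (rule cone_bcs[OF that U(1)])
  have TV: "T g \<in> V" if "cone U g" for g
  proof -
    have "bcs (\<lambda>z. if k \<in> F then g (- k + z) - g z else 0)" for k
      by (cases "k \<in> F") (simp_all add: cb[OF that] bcs_diff bcs_translate_left bcs_zero)
    then show ?thesis by (simp add: V_def T_def)
  qed
  obtain L where L: "\<And>f g. f \<in> V \<Longrightarrow> g \<in> V \<Longrightarrow> L (\<lambda>x. f x + g x) = L f + L g"
    "\<And>f c. f \<in> V \<Longrightarrow> L (\<lambda>x. c * f x) = c * L f" "\<And>f. f \<in> V \<Longrightarrow> \<bar>L f\<bar> \<le> N f"
    "\<And>f i. (f, i) \<in> C \<Longrightarrow> i \<le> L f"
  proof (rule Hahn_Banach_cone[OF V, of N C])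
    show "N (\<lambda>x. f x + g x) \<le> N f + N g" if "f \<in> V" "g \<in> V" for f g
      unfolding N_def sum.distrib[symmetric]
    proof (rule sum_mono)
      fix k
      have fg: "bcs (\<lambda>z. f (k, z))" "bcs (\<lambda>z. g (k, z))" using that by (auto simp: V_def)
      have "(\<integral>z. \<bar>f (k, z) + g (k, z)\<bar> \<partial>m) \<le> (\<integral>z. \<bar>f (k, z)\<bar> + \<bar>g (k, z)\<bar> \<partial>m)"
        by (intro integral_mono integrable_bcs bcs_add bcs_abs fg abs_triangle_ineq)
      also have "\<dots> = (\<integral>z. \<bar>f (k, z)\<bar> \<partial>m) + (\<integral>z. \<bar>g (k, z)\<bar> \<partial>m)"
        by (intro Bochner_Integration.integral_add integrable_bcs bcs_abs fg)
      finally show "(\<integral>z. \<bar>f (k, z) + g (k, z)\<bar> \<partial>m) \<le> (\<integral>z. \<bar>f (k, z)\<bar> \<partial>m) + (\<integral>z. \<bar>g (k, z)\<bar> \<partial>m)" .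
    qed
    show "N (\<lambda>x. c * f x) = \<bar>c\<bar> * N f" for f c
      by (simp add: N_def abs_mult sum_distrib_left)
    show "(\<lambda>_. 0, 0) \<in> C"
      unfolding C_def using cone_zero[of U] by (auto simp: T_def intro!: exI[of _ "\<lambda>_. 0"])
    show "f \<in> V" if "(f, i) \<in> C" for f i using that TV by (auto simp: C_def)
    show "(\<lambda>x. f x + g x, i + j) \<in> C" if fi: "(f, i) \<in> C" "(g, j) \<in> C" for f g i j
    proof -
      obtain a b where a: "cone U a" "f = T a" "i = \<eta> * (\<integral>z. a z \<partial>m)"
        and b: "cone U b" "g = T b" "j = \<eta> * (\<integral>z. b z \<partial>m)" using fi by (auto simp: C_def)
      have "(\<lambda>x. f x + g x) = T (\<lambda>z. a z + b z)" by (auto simp: a b T_def)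
      moreover have "i + j = \<eta> * (\<integral>z. a z + b z \<partial>m)"
        using integrable_bcs[OF cb] a b by (simp add: algebra_simps)
      ultimately show ?thesis using cone_add[OF b(1) a(1)] by (auto simp: C_def)
    qed
    show "(\<lambda>x. c * f x, c * i) \<in> C" if fi: "(f, i) \<in> C" and c: "c > 0" for f i c
    proof -
      obtain a where a: "cone U a" "f = T a" "i = \<eta> * (\<integral>z. a z \<partial>m)" using fi by (auto simp: C_def)
      have "(\<lambda>x. c * f x) = T (\<lambda>z. c * a z)" by (auto simp: a T_def algebra_simps)
      moreover have "c * i = \<eta> * (\<integral>z. c * a z \<partial>m)" using a by simp
      ultimately show ?thesis using cone_scale[OF a(1) c] by (auto simp: C_def)
    qed
    show "i \<le> N f" if fi: "(f, i) \<in> C" for f i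
    proof -
      obtain a where a: "cone U a" "f = T a" "i = \<eta> * (\<integral>z. a z \<partial>m)" using fi by (auto simp: C_def)
      then show ?thesis using contra[OF a(1)] by (simp add: N_def T_def)
    qed
  qed blast
  define S where "S k h = (\<lambda>(j, z). if j = k then h z else 0)" for k :: 'a and h :: "'a \<Rightarrow> real"
  have SV: "S k h \<in> V" if "k \<in> F" "bcs h" for k h
  proof -
    have "bcs (\<lambda>z. if j = k then h z else 0)" for j
      by (cases "j = k") (simp_all add: bcs_zero that)
    then show ?thesis using that by (auto simp: S_def V_def)
  qed
  have NS: "N (S k h) = (\<integral>z. \<bar>h z\<bar> \<partial>m)" if "k \<in> F" for k h
  proof -
    have "N (S k h) = (\<Sum>j\<in>F. if j = k then (\<integral>z. \<bar>h z\<bar> \<partial>m) else 0)"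
      unfolding N_def by (intro sum.cong) (auto simp: S_def)
    then show ?thesis using F that by simp
  qed
  have Lk_add: "L (S k (\<lambda>z. f z + g z)) = L (S k f) + L (S k g)" if "k \<in> F" "bcs f" "bcs g" for k f g
  proof -
    have "S k (\<lambda>z. f z + g z) = (\<lambda>x. S k f x + S k g x)" by (auto simp: S_def)
    then show ?thesis using L(1)[OF SV SV] that by simp
  qed
  have Lk_scale: "L (S k (\<lambda>z. c * f z)) = c * L (S k f)" if "k \<in> F" "bcs f" for k f c
  proof -
    have "S k (\<lambda>z. c * f z) = (\<lambda>x. c * S k f x)" by (auto simp: S_def)
    then show ?thesis using L(2)[OF SV] that by simp
  qed
  have Lk_le: "\<bar>L (S k f)\<bar> \<le> (\<integral>z. \<bar>f z\<bar> \<partial>m)" if "k \<in> F" "bcs f" for k f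
    using L(3)[OF SV[OF that]] NS[OF that(1)] by simp
  have decomp: "L (\<lambda>(k, z). if k \<in> G then h k z else 0) = (\<Sum>k\<in>G. L (S k (h k)))"
    if "finite G" "G \<subseteq> F" "\<And>k. bcs (h k)" for G h
    using that
  proof (induction G rule: finite_induct)
    case empty
    then show ?case using L(2)[of "\<lambda>_. 0" 0] V by (simp add: function_space_def case_prod_unfold)
  next
    case (insert k G)
    have "(\<lambda>(j, z). if j \<in> insert k G then h j z else 0) =
        (\<lambda>x. S k (h k) x + (case x of (j, z) \<Rightarrow> if j \<in> G then h j z else 0))"
      using insert.hyps by (auto simp: S_def)
    moreover have "(\<lambda>(j, z). if j \<in> G then h j z else 0) \<in> V"
    proof -
      have "bcs (\<lambda>z. if j \<in> G then h j z else 0)" for j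
        by (cases "j \<in> G") (simp_all add: bcs_zero insert.prems)
      then show ?thesis using insert.prems by (auto simp: V_def)
    qed
    ultimately show ?case using L(1)[OF SV] insert by simp
  qed
  have bU: "bcs (indicator U)" using U by (intro bcs_indicator[of _ U] compact_in_borel) auto
  have key: "\<eta> * measure m U \<le> (\<Sum>k\<in>F. L (S k (rtr x (\<lambda>z. indicator U (- k + z)))) - L (S k (rtr x (indicator U))))" for x
  proof -
    let ?g = "rtr x (indicator U)"
    have g: "cone U ?g" by (rule cone_rtr_indicator)
    have "\<eta> * measure m U = \<eta> * (\<integral>z. ?g z \<partial>m)" by (simp add: integral_rtr[OF bU])
    also have "\<dots> \<le> L (T ?g)" using g by (intro L(4)) (auto simp: C_def)
    also have "\<dots> = (\<Sum>k\<in>F. L (S k (\<lambda>z. ?g (- k + z) - ?g z)))"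
      unfolding T_def using cb[OF g] by (intro decomp F bcs_diff bcs_translate_left) auto
    also have "\<dots> = (\<Sum>k\<in>F. L (S k (rtr x (\<lambda>z. indicator U (- k + z)))) - L (S k (rtr x (indicator U))))"
    proof (rule sum.cong[OF refl])
      fix k assume k: "k \<in> F"
      have "L (S k (\<lambda>z. ?g (- k + z) + - 1 * ?g z)) = L (S k (\<lambda>z. ?g (- k + z))) + L (S k (\<lambda>z. - 1 * ?g z))"
        using cb[OF g] by (intro Lk_add k bcs_translate_left bcs_scale)
      also have "L (S k (\<lambda>z. - 1 * ?g z)) = - 1 * L (S k ?g)" by (rule Lk_scale[OF k cb[OF g]])
      finally show "L (S k (\<lambda>z. ?g (- k + z) - ?g z)) =
          L (S k (rtr x (\<lambda>z. indicator U (- k + z)))) - L (S k (rtr x (indicator U)))"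
        by (simp add: rtr_left_translate)
    qed
    finally show ?thesis .
  qed
  have "\<eta> * measure m U > 0" using U(2) \<eta> by simp
  \<comment> \<open>Replacing the indicator of \<open>U\<close> by \<open>q\<close> costs
    \<open>d\<close> in each of the two terms belonging to a \<open>k \<in> F\<close>, hence
    \<open>2 * card F\<close> times \<open>d\<close> altogether.\<close>
  then obtain d where d: "d > 0" "d * (2 * real (card F)) < \<eta> * measure m U"
    using small_factor[of "2 * real (card F)"] by (metis of_nat_0_le_iff mult_nonneg_nonneg zero_le_numeral)
  obtain q where q: "cc q" "(\<integral>z. \<bar>q z - indicator U z\<bar> \<partial>m) \<le> d"
    using indicator_approx_cc[OF U(1) d(1)] by blast
  have bq: "bcs q" by (rule cc_imp_bcs[OF q(1)])
  have kq: "cc (\<lambda>z. q (- k + z))" for k by (rule cc_translate_left[OF q(1)])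
  have close: "\<bar>L (S k (rtr x q)) - L (S k (rtr x (indicator U)))\<bar> \<le> d"
    "\<bar>L (S k (rtr x (\<lambda>z. q (- k + z)))) - L (S k (rtr x (\<lambda>z. indicator U (- k + z))))\<bar> \<le> d"
    if k: "k \<in> F" for k x
  proof -
    show "\<bar>L (S k (rtr x q)) - L (S k (rtr x (indicator U)))\<bar> \<le> d"
      using L_rtr_close[of "\<lambda>f. L (S k f)", OF Lk_add Lk_scale Lk_le bq bU] k q(2)
      by (meson order_trans)
    have "(\<lambda>z. \<bar>q z - indicator U z\<bar>) \<in> borel_measurable borel"
      using bcs_abs[OF bcs_diff[OF bq bU]] by (simp add: bcs_def)
    from integral_left_translate[OF this, of "- k"]
    show "\<bar>L (S k (rtr x (\<lambda>z. q (- k + z)))) - L (S k (rtr x (\<lambda>z. indicator U (- k + z))))\<bar> \<le> d"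
      using L_rtr_close[of "\<lambda>f. L (S k f)", OF Lk_add Lk_scale Lk_le
          bcs_translate_left[OF bq, of "- k"] bcs_translate_left[OF bU, of "- k"]] k q(2)
      by (metis (no_types, lifting) order_trans)
  qed
  define \<psi> where "\<psi> k x = L (S k (rtr x (\<lambda>z. q (- k + z)))) - L (S k (rtr x q))" for k x
  have B: "bdd_borel (\<lambda>x. L (S k (rtr x (\<lambda>z. q (- k + z)))))" "bdd_borel (\<lambda>x. L (S k (rtr x q)))"
    if k: "k \<in> F" for k
    using L_rtr_bdd_borel[of "\<lambda>f. L (S k f)", OF Lk_add Lk_scale Lk_le] k kq q(1) by blast+
  \<comment> \<open>By left invariance \<open>q\<close> and its left translate have the same
    integral, which is all that \<open>M\<close> sees of their orbits.\<close>
  have M0: "M (\<psi> k) = 0" if k: "k \<in> F" for k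
  proof -
    have "(\<integral>z. q (- k + z) \<partial>m) = (\<integral>z. q z \<partial>m)"
      using bq by (intro integral_left_translate) (simp add: bcs_def)
    then have "M (\<lambda>x. L (S k (rtr x (\<lambda>z. q (- k + z))))) = M (\<lambda>x. L (S k (rtr x q)))"
      using M_L_rtr_eq[of "\<lambda>f. L (S k f)", OF Lk_add Lk_scale Lk_le kq q(1)] k by blast
    then show ?thesis unfolding \<psi>_def using M_diff[OF B[OF k]] by simp
  qed
  have B\<psi>: "bdd_borel (\<psi> k)" if "k \<in> F" for k
    unfolding \<psi>_def by (intro bdd_borel_diff B that)
  \<comment> \<open>The contradiction: a function with mean \<open>0\<close> is bounded below by a
    positive constant.\<close>
  have "M (\<lambda>x. \<Sum>k\<in>F. \<psi> k x) = 0" using M_sum[OF F B\<psi>] M0 by simp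
  moreover have "\<eta> * measure m U - d * (2 * real (card F)) \<le> (\<Sum>k\<in>F. \<psi> k x)" for x
  proof -
    have "(\<Sum>k\<in>F. L (S k (rtr x (\<lambda>z. indicator U (- k + z)))) - L (S k (rtr x (indicator U))))
      \<le> (\<Sum>k\<in>F. \<psi> k x + 2 * d)"
    proof (rule sum_mono)
      fix k assume "k \<in> F"
      from close[OF this, of x]
      show "L (S k (rtr x (\<lambda>z. indicator U (- k + z)))) - L (S k (rtr x (indicator U))) \<le> \<psi> k x + 2 * d"
        by (simp add: \<psi>_def abs_le_iff)
    qed
    also have "\<dots> = (\<Sum>k\<in>F. \<psi> k x) + d * (2 * real (card F))" by (simp add: sum.distrib)
    finally show ?thesis using key[of x] by linarith
  qed
  then have "M (\<lambda>_. \<eta> * measure m U - d * (2 * real (card F))) \<le> M (\<lambda>x. \<Sum>k\<in>F. \<psi> k x)"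
    by (intro M_mono bdd_borel_const bdd_borel_sum F B\<psi>)
  ultimately show False using d(2) by (simp add: M_const)
qed

context haar_group
begin

text \<open>For fixed \<open>z\<close>, the levels \<open>s\<close> at which exactly one of
  \<open>s \<le> a z\<close>, \<open>s \<le> b z\<close> holds form the half-open interval between
  the two values, of length \<open>\<bar>a z - b z\<bar>\<close>. Integrating over \<open>z\<close>
  and exchanging the integrals gives the formula.\<close>

lemma layer_cake:
  assumes a: "bcs a" "\<And>z. 0 \<le> a z" and b: "bcs b" "\<And>z. 0 \<le> b z"
  defines "D \<equiv> \<lambda>s::real. indicator {0<..} s * emeasure m {z. (s \<le> a z) \<noteq> (s \<le> b z)}"
  shows "D \<in> borel_measurable borel"
    and "(\<integral>\<^sup>+s. D s \<partial>lborel) = ennreal (\<integral>z. \<bar>a z - b z\<bar> \<partial>m)"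
proof -
  obtain K where K: "compact K" "\<And>z. z \<notin> K \<Longrightarrow> a z = 0" using a(1) by (metis bcsE)
  obtain K' where K': "compact K'" "\<And>z. z \<notin> K' \<Longrightarrow> b z = 0" using b(1) by (metis bcsE)
  define Q where "Q = K \<union> K'"
  have Q: "compact Q" "Q \<in> sets borel" using K K' by (auto simp: Q_def intro: compact_in_borel)
  have [measurable]: "a \<in> borel_measurable borel" "b \<in> borel_measurable borel" "Q \<in> sets borel"
    using a b Q by (auto simp: bcs_def)
  \<comment> \<open>Haar measure may fail to be sigma-finite; its restriction to the compact set
    carrying \<open>a\<close> and \<open>b\<close> is finite, so the integrals may be
    exchanged.\<close>
  define n where "n = density m (indicator Q)"
  have sn [measurable_cong]: "sets n = sets borel" by (simp add: n_def)
  have en: "emeasure n E = emeasure m (Q \<inter> E)" if "E \<in> sets borel" for E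
    unfolding n_def using that Q by (subst emeasure_density) (auto simp: indicator_inter_arith[symmetric])
  have spn: "space n = UNIV" using sets_eq_imp_space_eq[OF sn] by simp
  have "emeasure n (space n) \<noteq> \<infinity>"
    using en[of UNIV] emeasure_compact_finite[OF Q(1)] by (simp add: spn)
  then interpret n: finite_measure n by (rule finite_measureI)
  interpret pair_sigma_finite lborel n ..
  define f where "f = (\<lambda>p :: real \<times> 'a. indicator {0<..} (fst p) * (if (fst p \<le> a (snd p)) \<noteq> (fst p \<le> b (snd p)) then 1 else 0 :: ennreal))"
  have f [measurable]: "f \<in> borel_measurable (lborel \<Otimes>\<^sub>M n)" unfolding f_def by measurable
  have DD: "D s = (\<integral>\<^sup>+z. f (s, z) \<partial>n)" for s
  proof (cases "s > 0")
    case True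
    have E: "{z. (s \<le> a z) \<noteq> (s \<le> b z)} \<in> sets borel" by measurable
    have "(\<integral>\<^sup>+z. f (s, z) \<partial>n) = (\<integral>\<^sup>+z. indicator {z. (s \<le> a z) \<noteq> (s \<le> b z)} z \<partial>n)"
      using True by (intro nn_integral_cong) (auto simp: f_def indicator_def)
    also have "\<dots> = emeasure n {z. (s \<le> a z) \<noteq> (s \<le> b z)}" using E sn by simp
    also have "\<dots> = emeasure m (Q \<inter> {z. (s \<le> a z) \<noteq> (s \<le> b z)})" by (rule en[OF E])
    also have "Q \<inter> {z. (s \<le> a z) \<noteq> (s \<le> b z)} = {z. (s \<le> a z) \<noteq> (s \<le> b z)}"
      using K(2) K'(2) True by (fastforce simp: Q_def)
    finally show ?thesis using True by (simp add: D_def)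
  qed (simp add: D_def f_def)
  have "(\<lambda>s. \<integral>\<^sup>+z. f (s, z) \<partial>n) \<in> borel_measurable lborel" by measurable
  then show "D \<in> borel_measurable borel" unfolding DD[abs_def] by simp
  have inner: "(\<integral>\<^sup>+s. f (s, z) \<partial>lborel) = ennreal \<bar>a z - b z\<bar>" for z
  proof -
    have "(\<integral>\<^sup>+s. f (s, z) \<partial>lborel) = (\<integral>\<^sup>+s. indicator {min (a z) (b z)<..max (a z) (b z)} s \<partial>lborel)"
      using a(2)[of z] b(2)[of z] by (intro nn_integral_cong) (auto simp: f_def indicator_def)
    also have "\<dots> = ennreal (max (a z) (b z) - min (a z) (b z))" by simp
    also have "max (a z) (b z) - min (a z) (b z) = \<bar>a z - b z\<bar>" by auto
    finally show ?thesis .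
  qed
  have "(\<integral>\<^sup>+s. D s \<partial>lborel) = (\<integral>\<^sup>+z. (\<integral>\<^sup>+s. f (s, z) \<partial>lborel) \<partial>n)"
    unfolding DD by (rule Fubini'[symmetric]) (simp add: f)
  also have "\<dots> = (\<integral>\<^sup>+z. ennreal \<bar>a z - b z\<bar> \<partial>n)" by (simp add: inner)
  also have "\<dots> = (\<integral>\<^sup>+z. indicator Q z * ennreal \<bar>a z - b z\<bar> \<partial>m)"
    unfolding n_def by (intro nn_integral_density) auto
  also have "\<dots> = (\<integral>\<^sup>+z. ennreal \<bar>a z - b z\<bar> \<partial>m)"
    using K K' by (intro nn_integral_cong) (auto simp: Q_def indicator_def)
  also have "\<dots> = ennreal (\<integral>z. \<bar>a z - b z\<bar> \<partial>m)"
    by (intro nn_integral_eq_integral integrable_bcs bcs_abs bcs_diff a b) auto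
  finally show "(\<integral>\<^sup>+s. D s \<partial>lborel) = ennreal (\<integral>z. \<bar>a z - b z\<bar> \<partial>m)" .
qed

text \<open>The function \<open>g'\<close> controls all small left translations of a superlevel set of \<open>g\<close>
  at once; it is what makes the set invariant under a compact set and not just under the
  finite set \<open>F\<close>.\<close>
lemma good_superlevel:
  assumes U: "compact U" and g: "cone U g" and g': "bcs g'" "\<And>z. g z \<le> g' z" and F: "finite F"
    and e: "e > 0"
    and less: "(\<integral>z. \<bar>g z - g' z\<bar> \<partial>m) + (\<Sum>k\<in>F. \<integral>z. \<bar>g (- k + z) - g z\<bar> \<partial>m) < e * (\<integral>z. g z \<partial>m)"
  obtains s where "s > 0"
    "measure m ({z. s \<le> g' z} - {z. s \<le> g z})
      + (\<Sum>k\<in>F. measure m (sym_diff ((+) k ` {z. s \<le> g z}) {z. s \<le> g z})) < e * measure m {z. s \<le> g z}"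
proof -
  define D where "D a b s = indicator {0<..} s * emeasure m {z. (s \<le> a z) \<noteq> (s \<le> b z)}"
    for a b :: "'a \<Rightarrow> real" and s :: real
  have bg: "bcs g" by (rule cone_bcs[OF g U])
  have g0: "0 \<le> g z" "0 \<le> g' z" for z using cone_nonneg[OF g, of z] g'(2)[of z] by linarith+
  have bk: "bcs (\<lambda>z. g (- k + z))" for k by (rule bcs_translate_left[OF bg])
  note lc1 = layer_cake[OF bg g0(1) g'(1) g0(2), folded D_def]
  note lc2 = layer_cake[OF bg g0(1) bcs_zero order_refl, folded D_def]
  note lck = layer_cake[OF bk g0(1) bg g0(1), folded D_def]
  \<comment> \<open>If no level worked, integrating the reversed inequality over all levels would
    contradict \<open>less\<close> by \<open>layer_cake\<close>. A level found here is positive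
    since \<open>D\<close> vanishes at the others.\<close>
  have "\<exists>s. D g g' s + (\<Sum>k\<in>F. D (\<lambda>z. g (- k + z)) g s) < ennreal e * D g (\<lambda>_. 0) s"
  proof (rule ccontr)
    assume "\<not> ?thesis"
    then have le: "ennreal e * D g (\<lambda>_. 0) s \<le> D g g' s + (\<Sum>k\<in>F. D (\<lambda>z. g (- k + z)) g s)" for s
      by (meson not_less)
    have "ennreal e * (\<integral>\<^sup>+s. D g (\<lambda>_. 0) s \<partial>lborel) = (\<integral>\<^sup>+s. ennreal e * D g (\<lambda>_. 0) s \<partial>lborel)"
      using lc2(1) by (intro nn_integral_cmult[symmetric]) auto
    also have "\<dots> \<le> (\<integral>\<^sup>+s. D g g' s + (\<Sum>k\<in>F. D (\<lambda>z. g (- k + z)) g s) \<partial>lborel)"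
      by (intro nn_integral_mono le)
    also have "\<dots> = (\<integral>\<^sup>+s. D g g' s \<partial>lborel) + (\<integral>\<^sup>+s. (\<Sum>k\<in>F. D (\<lambda>z. g (- k + z)) g s) \<partial>lborel)"
      using lc1(1) lck(1) by (intro nn_integral_add) (auto intro!: borel_measurable_sum)
    also have "(\<integral>\<^sup>+s. (\<Sum>k\<in>F. D (\<lambda>z. g (- k + z)) g s) \<partial>lborel)
        = (\<Sum>k\<in>F. \<integral>\<^sup>+s. D (\<lambda>z. g (- k + z)) g s \<partial>lborel)"
      using lck(1) by (intro nn_integral_sum) auto
    finally have "ennreal e * ennreal (\<integral>z. \<bar>g z - 0\<bar> \<partial>m) \<le> ennreal (\<integral>z. \<bar>g z - g' z\<bar> \<partial>m)
        + (\<Sum>k\<in>F. ennreal (\<integral>z. \<bar>g (- k + z) - g z\<bar> \<partial>m))"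
      unfolding lc1(2) lc2(2) lck(2) .
    then have "ennreal (e * (\<integral>z. g z \<partial>m)) \<le> ennreal ((\<integral>z. \<bar>g z - g' z\<bar> \<partial>m)
        + (\<Sum>k\<in>F. (\<integral>z. \<bar>g (- k + z) - g z\<bar> \<partial>m)))"
      using e g0 by (simp add: ennreal_mult sum_nonneg sum_ennreal ennreal_plus[symmetric] del: ennreal_plus)
    then have "e * (\<integral>z. g z \<partial>m) \<le> (\<integral>z. \<bar>g z - g' z\<bar> \<partial>m) + (\<Sum>k\<in>F. (\<integral>z. \<bar>g (- k + z) - g z\<bar> \<partial>m))"
      by (subst (asm) ennreal_le_iff) (auto intro!: add_nonneg_nonneg sum_nonneg)
    then show False using less by simp
  qed
  then obtain s where s: "D g g' s + (\<Sum>k\<in>F. D (\<lambda>z. g (- k + z)) g s) < ennreal e * D g (\<lambda>_. 0) s" by blast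
  have "s > 0"
  proof (rule ccontr)
    assume "\<not> s > 0"
    then show False using s by (simp add: D_def)
  qed
  let ?A = "{z. s \<le> g z}" and ?B = "{z. s \<le> g' z}"
  have A: "compact ?A" by (rule cone_superlevel_compact[OF g U \<open>s > 0\<close>])
  have [measurable]: "g' \<in> borel_measurable borel" using g' by (simp add: bcs_def)
  obtain Q where Q: "compact Q" "\<And>z. z \<notin> Q \<Longrightarrow> g' z = 0" using g'(1) by (metis bcsE)
  have Bs: "?B \<in> sets borel" by measurable
  have "?B \<subseteq> Q" using Q(2) \<open>s > 0\<close> by force
  then have Bm: "?B \<in> fmeasurable m" using Bs Q(1) by (intro fmeasurable_subset_compact)
  have Am: "?A \<in> fmeasurable m" by (rule fmeasurable_compact[OF A])
  have km: "(+) k ` ?A \<in> fmeasurable m" for k by (intro fmeasurable_compact compact_left_translate A)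
  have "{z. (s \<le> g z) \<noteq> (s \<le> g' z)} = ?B - ?A" using g'(2) by (auto intro: order_trans)
  then have D1: "D g g' s = ennreal (measure m (?B - ?A))"
    using \<open>s > 0\<close> fmeasurable.Diff[OF Bm Am] by (simp add: D_def emeasure_eq_measure2)
  have "{z. (s \<le> g (- k + z)) \<noteq> (s \<le> g z)} = sym_diff ((+) k ` ?A) ?A" for k
    unfolding left_translate_eq_vimage by auto
  then have D2: "D (\<lambda>z. g (- k + z)) g s = ennreal (measure m (sym_diff ((+) k ` ?A) ?A))" for k
    using \<open>s > 0\<close> km[of k] Am
    by (simp add: D_def emeasure_eq_measure2 fmeasurable.Diff fmeasurable.Un)
  have "{z. (s \<le> g z) \<noteq> (s \<le> 0)} = ?A" using \<open>s > 0\<close> by auto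
  then have D3: "D g (\<lambda>_. 0) s = ennreal (measure m ?A)"
    using \<open>s > 0\<close> Am by (simp add: D_def emeasure_eq_measure2)
  have "ennreal (measure m (?B - ?A) + (\<Sum>k\<in>F. measure m (sym_diff ((+) k ` ?A) ?A)))
      < ennreal (e * measure m ?A)"
    using s e unfolding D1 D2 D3
    by (simp add: ennreal_mult sum_nonneg sum_ennreal ennreal_plus[symmetric] del: ennreal_plus)
  then have "measure m (?B - ?A) + (\<Sum>k\<in>F. measure m (sym_diff ((+) k ` ?A) ?A)) < e * measure m ?A"
    by (subst (asm) ennreal_less_iff) (auto intro!: add_nonneg_nonneg sum_nonneg)
  then show ?thesis using that[OF \<open>s > 0\<close>] by blast
qed

text \<open>Every translate of \<open>U\<close> in \<open>g\<close> is replaced by the same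
  translate of \<open>O'\<close>. Left shifts by \<open>N\<close> commute with right translation,
  and both measures pick up the same factor \<open>modular (- t)\<close>, so the relative excess
  remains at most \<open>\<eta>\<close>.\<close>

lemma cone_thickening:
  assumes U: "compact U" and O: "open O'" "O' \<subseteq> Q" "compact Q" "U \<subseteq> O'"
    and N: "\<And>t a. t \<in> N \<Longrightarrow> a \<in> U \<Longrightarrow> t + a \<in> O'"
    and mO: "measure m O' - measure m U \<le> \<eta> * measure m U"
    and g: "cone U g"
  shows "\<exists>g'. bcs g' \<and> (\<forall>z. g z \<le> g' z) \<and> (\<forall>w\<in>N. \<forall>z. g z \<le> g' (w + z)) \<and>
    (\<integral>z. \<bar>g z - g' z\<bar> \<partial>m) \<le> \<eta> * (\<integral>z. g z \<partial>m)"
  using g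
proof (induction rule: cone.induct)
  case cone_zero
  show ?case using bcs_zero by (intro exI[of _ "\<lambda>_. 0"]) simp
next
  case (cone_step g c t)
  then obtain g' where g': "bcs g'" "\<And>z. g z \<le> g' z" "\<And>w z. w \<in> N \<Longrightarrow> g z \<le> g' (w + z)"
    "(\<integral>z. \<bar>g z - g' z\<bar> \<partial>m) \<le> \<eta> * (\<integral>z. g z \<partial>m)" by blast
  let ?U = "(\<lambda>y. y + t) ` U" and ?O = "(\<lambda>y. y + t) ` O'"
  have bg: "bcs g" by (rule cone_bcs[OF cone_step.hyps(1) U])
  have bU: "bcs (indicator ?U)"
    by (intro bcs_indicator[OF compact_in_borel order_refl] compact_right_translate U)
  have bO: "bcs (indicator ?O)"
    using O by (intro bcs_indicator[of _ "(\<lambda>y. y + t) ` Q"] compact_right_translate borel_right_translate) auto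
  have mU': "measure m ?U = modular (- t) * measure m U"
    by (rule measure_right_translate[OF compact_in_borel[OF U] order_refl U])
  have mO': "measure m ?O = modular (- t) * measure m O'"
    using O by (intro measure_right_translate[of _ Q]) auto
  have UO: "?U \<subseteq> ?O" using O(4) by auto
  let ?h = "\<lambda>z. g z + c * indicator ?U z" and ?h' = "\<lambda>z. g' z + c * indicator ?O z"
  have c: "c \<ge> 0" by (rule cone_step.hyps)
  have 1: "?h z \<le> ?h' z" for z
    using g'(2)[of z] UO c by (auto simp: indicator_def intro: add_mono)
  have 2: "?h z \<le> ?h' (w + z)" if w: "w \<in> N" for w z
  proof -
    have "w + z \<in> ?O" if "z \<in> ?U"
      using that N[OF w] by (force simp: add.assoc[symmetric])
    then show ?thesis using g'(3)[OF w, of z] c by (auto simp: indicator_def)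
  qed
  have int: "integrable m (indicator ?U :: 'a \<Rightarrow> real)" "integrable m (indicator ?O :: 'a \<Rightarrow> real)"
    "integrable m g" "integrable m g'"
    by (intro integrable_bcs bU bO bg g')+
  have "(\<integral>z. \<bar>?h z - ?h' z\<bar> \<partial>m) = (\<integral>z. \<bar>g z - g' z\<bar> + c * (indicator ?O z - indicator ?U z) \<partial>m)"
  proof (intro Bochner_Integration.integral_cong refl)
    fix z show "\<bar>?h z - ?h' z\<bar> = \<bar>g z - g' z\<bar> + c * (indicator ?O z - indicator ?U z)"
      using g'(2)[of z] 1[of z] by (simp add: algebra_simps)
  qed
  also have "\<dots> = (\<integral>z. \<bar>g z - g' z\<bar> \<partial>m) + c * (measure m ?O - measure m ?U)"
    using int by simp
  also have "measure m ?O - measure m ?U = modular (- t) * (measure m O' - measure m U)"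
    by (simp add: mU' mO' algebra_simps)
  also have "(\<integral>z. \<bar>g z - g' z\<bar> \<partial>m) + c * (modular (- t) * (measure m O' - measure m U))
      \<le> \<eta> * (\<integral>z. g z \<partial>m) + c * (modular (- t) * (\<eta> * measure m U))"
    using g'(4) mO c modular_pos[of "- t"] by (intro add_mono mult_left_mono) auto
  also have "\<dots> = \<eta> * (\<integral>z. ?h z \<partial>m)" using int mU' by (simp add: algebra_simps)
  finally have 3: "(\<integral>z. \<bar>?h z - ?h' z\<bar> \<partial>m) \<le> \<eta> * (\<integral>z. ?h z \<partial>m)" .
  show ?case
    using 1 2 3 by (intro exI[of _ ?h'] conjI bcs_add bcs_scale g' bO) auto
qed

text \<open>Both sets have the same measure, hence so do the two one-sided differences.\<close>

lemma measure_sym_diff_left_translate: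
  assumes A: "compact A"
  shows "measure m (sym_diff ((+) w ` A) A) = 2 * measure m ((+) w ` A - A)"
proof -
  have Am: "A \<in> fmeasurable m" "(+) w ` A \<in> fmeasurable m"
    using A by (auto intro: fmeasurable_compact compact_left_translate)
  have "measure m (sym_diff ((+) w ` A) A) = measure m ((+) w ` A - A) + measure m (A - (+) w ` A)"
    using fmeasurableD2[OF fmeasurable.Diff[OF Am(2,1)]] fmeasurableD2[OF fmeasurable.Diff[OF Am]]
      fmeasurableD[OF fmeasurable.Diff[OF Am(2,1)]] fmeasurableD[OF fmeasurable.Diff[OF Am]]
    by (intro measure_Union) auto
  moreover have "measure m ((+) w ` A - A) = measure m ((+) w ` A) - measure m (A \<inter> (+) w ` A)"
    using measure_Diff_Int[OF Am(2,1)] by (simp add: Int_commute)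
  moreover have "measure m (A - (+) w ` A) = measure m A - measure m (A \<inter> (+) w ` A)"
    by (rule measure_Diff_Int[OF Am])
  moreover have "measure m ((+) w ` A) = measure m A"
    by (rule measure_left_translate[OF compact_in_borel[OF A]])
  ultimately show ?thesis by simp
qed

end

text \<open>Write \<open>x \<in> K\<close> as \<open>k + w\<close> with \<open>k\<close> in a finite
  set and \<open>w\<close> small. The translation by \<open>k\<close> is controlled by
  \<open>reiter\<close>; that by \<open>w\<close> keeps \<open>A\<close> inside the superlevel set
  \<open>B\<close> of the thickened density, which is hardly larger than \<open>A\<close>.\<close>

theorem (in invariant_mean) folner_sets_nonempty:
  assumes K: "compact K" and \<epsilon>: "\<epsilon> > 0"
  shows "folner_sets m K \<epsilon> \<noteq> {}"
proof -
  obtain N0 U :: "'a set" where N0: "open N0" "compact U" "0 \<in> N0" "N0 \<subseteq> U"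
    using locally_compact_zero_nhd[OF lc] .
  note U = N0(2)
  \<comment> \<open>Thickening and \<open>reiter\<close> cost one \<open>\<eta>\<close> each, and
    passing from \<open>B - A\<close> to a symmetric difference doubles the bound:
    \<open>4 * \<eta> = \<epsilon>\<close>.\<close>
  define \<eta> where "\<eta> = \<epsilon> / 4"
  have \<eta>: "\<eta> > 0" using \<epsilon> by (simp add: \<eta>_def)
  have Um: "U \<in> fmeasurable m" by (rule fmeasurable_compact[OF U])
  have "0 < emeasure m N0" using N0 by (intro emeasure_open_pos) auto
  also have "\<dots> \<le> emeasure m U" using N0 by (intro emeasure_mono) (auto intro: compact_in_borel)
  finally have mU: "measure m U > 0" using Um by (simp add: emeasure_eq_measure2)
  then have "\<eta> * measure m U > 0" using \<eta> by simp
  then obtain G where G: "open G" "U \<subseteq> G" "emeasure m G \<le> emeasure m U + ennreal (\<eta> * measure m U)"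
    using outer_regular_compact[OF U] by blast
  \<comment> \<open>Intersecting with \<open>N0 + U\<close> puts the thickened set inside the
    compact set \<open>U + U\<close>.\<close>
  define O' where "O' = G \<inter> (N0 + U)"
  have "0 + u \<in> N0 + U" if "u \<in> U" for u using N0(3) that by (rule set_plus_intro)
  then have O: "open O'" "O' \<subseteq> U + U" "compact (U + U)" "U \<subseteq> O'"
    using G N0 open_set_plus'[OF N0(1), of U] compact_set_plus[OF U U]
    by (auto simp: O'_def set_plus_def)
  have Om: "O' \<in> fmeasurable m" using O by (intro fmeasurable_subset_compact) auto
  have "emeasure m O' \<le> emeasure m G" using G(1) by (intro emeasure_mono) (auto simp: O'_def)
  also note G(3)
  finally have "ennreal (measure m O') \<le> ennreal (measure m U + \<eta> * measure m U)"
    using Om Um \<eta> by (simp add: emeasure_eq_measure2 ennreal_plus)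
  then have mO: "measure m O' - measure m U \<le> \<eta> * measure m U"
    using \<eta> by (subst (asm) ennreal_le_iff) auto
  obtain N where N: "open N" "0 \<in> N" "\<And>t a. t \<in> N \<Longrightarrow> a \<in> U \<Longrightarrow> t + a \<in> O'"
    using compact_open_thickening[OF U O(1,4)] by metis
  obtain F where F: "F \<subseteq> K" "finite F" "K \<subseteq> (\<Union>k\<in>F. (+) k ` N)"
  proof (rule compactE_image[OF K, of K "\<lambda>k. (+) k ` N"])
    show "open ((+) k ` N)" for k by (rule open_left_translate[OF N(1)])
    have "k \<in> (+) k ` N" for k using N(2) by (intro image_eqI[of _ _ 0]) simp_all
    then show "K \<subseteq> (\<Union>k\<in>K. (+) k ` N)" by blast
  qed blast
  obtain g where g: "cone U g" "(\<Sum>k\<in>F. \<integral>z. \<bar>g (- k + z) - g z\<bar> \<partial>m) < \<eta> * (\<integral>z. g z \<partial>m)"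
    using reiter[OF U mU F(2) \<eta>] by blast
  from cone_thickening[OF U O N(3) mO g(1)]
  obtain g' where G': "bcs g' \<and> (\<forall>z. g z \<le> g' z) \<and> (\<forall>w\<in>N. \<forall>z. g z \<le> g' (w + z)) \<and>
    (\<integral>z. \<bar>g z - g' z\<bar> \<partial>m) \<le> \<eta> * (\<integral>z. g z \<partial>m)" ..
  then have g': "bcs g'" "\<And>z. g z \<le> g' z" "\<And>w z. w \<in> N \<Longrightarrow> g z \<le> g' (w + z)"
    "(\<integral>z. \<bar>g z - g' z\<bar> \<partial>m) \<le> \<eta> * (\<integral>z. g z \<partial>m)" by blast+
  have less: "(\<integral>z. \<bar>g z - g' z\<bar> \<partial>m) + (\<Sum>k\<in>F. \<integral>z. \<bar>g (- k + z) - g z\<bar> \<partial>m)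
      < (2 * \<eta>) * (\<integral>z. g z \<partial>m)"
    using g(2) g'(4) by linarith
  have "2 * \<eta> > 0" using \<eta> by simp
  from good_superlevel[OF U g(1) g'(1,2) F(2) this less] obtain s where "s > 0" and
    s: "measure m ({z. s \<le> g' z} - {z. s \<le> g z})
      + (\<Sum>k\<in>F. measure m (sym_diff ((+) k ` {z. s \<le> g z}) {z. s \<le> g z}))
      < (2 * \<eta>) * measure m {z. s \<le> g z}" by blast
  define A where "A = {z. s \<le> g z}"
  define B where "B = {z. s \<le> g' z}"
  have A: "compact A" unfolding A_def by (rule cone_superlevel_compact[OF g(1) U \<open>s > 0\<close>])
  have Am: "(+) x ` A \<in> fmeasurable m" "A \<in> fmeasurable m" for x
    by (intro fmeasurable_compact compact_left_translate A)+
  obtain Q where Q: "compact Q" "\<And>z. z \<notin> Q \<Longrightarrow> g' z = 0" using g'(1) by (metis bcsE)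
  have [measurable]: "g' \<in> borel_measurable borel" using g' by (simp add: bcs_def)
  have "B \<in> sets borel" unfolding B_def by measurable
  moreover have "B \<subseteq> Q" using Q(2) \<open>s > 0\<close> by (force simp: B_def)
  ultimately have Bm: "B \<in> fmeasurable m" using Q(1) by (intro fmeasurable_subset_compact)
  have sum: "measure m (B - A) + (\<Sum>k\<in>F. measure m (sym_diff ((+) k ` A) A)) < (2 * \<eta>) * measure m A"
    using s by (simp add: A_def B_def)
  have "0 \<le> (\<Sum>k\<in>F. measure m (sym_diff ((+) k ` A) A))" by (intro sum_nonneg) simp
  then have "0 < (2 * \<eta>) * measure m A" using sum measure_nonneg[of m "B - A"] by linarith
  then have mA: "measure m A > 0" using \<eta> by (simp add: zero_less_mult_iff)
  have "measure m (sym_diff ((+) x ` A) A) < \<epsilon> * measure m A" if x: "x \<in> K" for x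
  proof -
    obtain k w where k: "k \<in> F" "w \<in> N" "x = k + w" using F(3) x by auto
    have xA: "(+) x ` A = (+) k ` (+) w ` A" by (auto simp: k(3) image_image add.assoc)
    have "(+) k ` sym_diff ((+) w ` A) A = sym_diff ((+) x ` A) ((+) k ` A)"
      unfolding xA by (simp add: left_translate_eq_vimage) blast
    moreover have "sym_diff ((+) w ` A) A \<in> sets borel"
      using compact_in_borel[OF compact_left_translate[OF A, of w]] compact_in_borel[OF A] by auto
    ultimately have e1: "measure m (sym_diff ((+) x ` A) ((+) k ` A)) = measure m (sym_diff ((+) w ` A) A)"
      using measure_left_translate[of "sym_diff ((+) w ` A) A" k] by simp
    have "(+) w ` A \<subseteq> B" using g'(3)[OF k(2)] by (auto simp: A_def B_def intro: order_trans)
    then have "measure m ((+) w ` A - A) \<le> measure m (B - A)"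
      using fmeasurableD[OF fmeasurable.Diff[OF Am(1)[of w] Am(2)]] fmeasurable.Diff[OF Bm Am(2)]
      by (intro measure_mono_fmeasurable) auto
    then have e2: "measure m (sym_diff ((+) w ` A) A) \<le> 2 * measure m (B - A)"
      using measure_sym_diff_left_translate[OF A, of w] by simp
    have e3: "measure m (sym_diff ((+) k ` A) A) \<le> (\<Sum>k\<in>F. measure m (sym_diff ((+) k ` A) A))"
      by (rule member_le_sum[OF k(1) _ F(2)]) simp
    have "measure m (sym_diff ((+) x ` A) A)
        \<le> measure m (sym_diff ((+) x ` A) ((+) k ` A) \<union> sym_diff ((+) k ` A) A)"
      by (intro measure_mono_fmeasurable fmeasurableD fmeasurable.Diff fmeasurable.Un Am) auto
    also have "\<dots> \<le> measure m (sym_diff ((+) x ` A) ((+) k ` A)) + measure m (sym_diff ((+) k ` A) A)"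
      using Am by (intro measure_Un_le fmeasurableD fmeasurable.Diff fmeasurable.Un)
    finally show ?thesis
      using e1 e2 e3 sum mA \<eta> measure_nonneg[of m "B - A"]
        \<open>0 \<le> (\<Sum>k\<in>F. measure m (sym_diff ((+) k ` A) A))\<close>
      by (simp add: \<eta>_def)
  qed
  then have "A \<in> folner_sets m K \<epsilon>"
    using A mA by (simp add: folner_sets_def divide_less_eq)
  then show ?thesis by blast
qed

section \<open>Means\<close>

context haar_group
begin

lemma Linf_vimage:
  assumes "\<phi> \<in> Linf m" "B \<in> sets borel" "F \<in> sets borel" "emeasure m F < \<infinity>"
  shows "\<phi> -` B \<inter> F \<in> sets borel"
  using assms by (auto simp: Linf_def locally_measurable_def)

text \<open>On a set of finite measure, local measurability of all preimages is measurability of the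
  restricted function; this form gives access to the closure rules for measurable functions.\<close>

lemma Linf_iff:
  "\<phi> \<in> Linf m \<longleftrightarrow> bounded (range \<phi>) \<and>
    (\<forall>F\<in>sets borel. emeasure m F < \<infinity> \<longrightarrow> (\<lambda>x. indicator F x *\<^sub>R \<phi> x) \<in> borel_measurable borel)"
proof -
  have "(\<forall>B\<in>sets borel. \<phi> -` B \<inter> F \<in> sets borel) \<longleftrightarrow> (\<lambda>x. indicator F x *\<^sub>R \<phi> x) \<in> borel_measurable borel"
    if F: "F \<in> sets borel" for F
  proof -
    have "(\<lambda>x. indicator F x *\<^sub>R \<phi> x) \<in> borel_measurable borel
        \<longleftrightarrow> \<phi> \<in> borel_measurable (restrict_space borel F)"
      using F by (subst borel_measurable_restrict_space_iff) auto
    also have "\<dots> \<longleftrightarrow> (\<forall>B\<in>sets borel. \<phi> -` B \<inter> F \<in> sets borel)"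
      using F unfolding measurable_def by (auto simp: space_restrict_space sets_restrict_space_iff)
    finally show ?thesis by simp
  qed
  then show ?thesis by (auto simp: Linf_def locally_measurable_def)
qed

lemma Linf_bounded: "\<phi> \<in> Linf m \<Longrightarrow> \<exists>C. \<forall>x. cmod (\<phi> x) \<le> C"
  by (auto simp: Linf_def bounded_iff)

lemma Linf_add: "\<phi> \<in> Linf m \<Longrightarrow> \<psi> \<in> Linf m \<Longrightarrow> (\<lambda>x. \<phi> x + \<psi> x) \<in> Linf m"
  unfolding Linf_iff by (auto simp: scaleR_add_right intro: bounded_plus_comp borel_measurable_add)

lemma Linf_compose:
  assumes "\<phi> \<in> Linf m" and h: "h \<in> borel_measurable borel" and "bounded (range (\<lambda>x. h (\<phi> x)))"
  shows "(\<lambda>x. h (\<phi> x)) \<in> Linf m"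
proof -
  have "(\<lambda>x. h (\<phi> x)) -` B = \<phi> -` (h -` B)" for B by auto
  moreover have "h -` B \<in> sets borel" if "B \<in> sets borel" for B
    using measurable_sets_borel[OF h that] by simp
  ultimately show ?thesis using assms by (auto simp: Linf_def)
qed

lemma Linf_mult: "\<phi> \<in> Linf m \<Longrightarrow> (\<lambda>x. c * \<phi> x) \<in> Linf m"
proof -
  assume \<phi>: "\<phi> \<in> Linf m"
  obtain C where C: "\<And>x. cmod (\<phi> x) \<le> C" using Linf_bounded[OF \<phi>] by auto
  have "bounded (range (\<lambda>x. c * \<phi> x))"
    unfolding bounded_iff by (intro exI[of _ "cmod c * C"]) (auto simp: norm_mult C mult_left_mono)
  then show ?thesis by (intro Linf_compose[OF \<phi>]) auto
qed

lemma Linf_Re: "\<phi> \<in> Linf m \<Longrightarrow> (\<lambda>x. complex_of_real (Re (\<phi> x))) \<in> Linf m"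
  and Linf_Im: "\<phi> \<in> Linf m \<Longrightarrow> (\<lambda>x. complex_of_real (Im (\<phi> x))) \<in> Linf m"
proof -
  assume \<phi>: "\<phi> \<in> Linf m"
  obtain C where C: "\<And>x. cmod (\<phi> x) \<le> C" using Linf_bounded[OF \<phi>] by auto
  have "cmod (complex_of_real (Re (\<phi> x))) \<le> C" "cmod (complex_of_real (Im (\<phi> x))) \<le> C" for x
    using C[of x] abs_Re_le_cmod[of "\<phi> x"] abs_Im_le_cmod[of "\<phi> x"] by auto
  then have "bounded (range (\<lambda>x. complex_of_real (Re (\<phi> x))))" "bounded (range (\<lambda>x. complex_of_real (Im (\<phi> x))))"
    unfolding bounded_iff by blast+
  then show "(\<lambda>x. complex_of_real (Re (\<phi> x))) \<in> Linf m" "(\<lambda>x. complex_of_real (Im (\<phi> x))) \<in> Linf m"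
    by (intro Linf_compose[OF \<phi>, of "\<lambda>z. complex_of_real (Re z)"] Linf_compose[OF \<phi>, of "\<lambda>z. complex_of_real (Im z)"]; simp)+
qed

lemma bdd_borel_Linf: "bdd_borel f \<Longrightarrow> (\<lambda>x. complex_of_real (f x)) \<in> Linf m"
  unfolding Linf_iff bdd_borel_def bounded_iff by auto

lemma Linf_const: "(\<lambda>_. c) \<in> Linf m"
  unfolding Linf_iff by auto

lemma indicator_Linf:
  assumes "locally_measurable m E"
  shows "(indicator E :: 'a \<Rightarrow> complex) \<in> Linf m"
proof -
  have "(\<lambda>x. indicator F x *\<^sub>R indicator E x :: complex) \<in> borel_measurable borel"
    if "F \<in> sets borel" "emeasure m F < \<infinity>" for F
  proof -
    have "E \<inter> F \<in> sets borel" using assms that by (simp add: locally_measurable_def)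
    moreover have "(\<lambda>x. indicator F x *\<^sub>R indicator E x :: complex) = indicator (E \<inter> F)"
      by (auto simp: indicator_def)
    ultimately show ?thesis by simp
  qed
  moreover have "bounded (range (indicator E :: 'a \<Rightarrow> complex))"
    unfolding bounded_iff by (intro exI[of _ 1]) (auto simp: indicator_def)
  ultimately show ?thesis by (simp add: Linf_iff)
qed

lemma locally_null_empty: "locally_null m {}"
  by (simp add: locally_null_def)

text \<open>The norm is an infimum, so an actual essential bound is obtained with the margin
  \<open>\<delta>\<close>.\<close>

lemma Linf_norm_le_imp:
  assumes \<phi>: "\<phi> \<in> Linf m" and "Linf_norm m \<phi> \<le> 1" "\<delta> > 0"
  shows "\<exists>c. 0 \<le> c \<and> c < 1 + \<delta> \<and> locally_null m {x. c < cmod (\<phi> x)}"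
proof -
  let ?S = "{c. 0 \<le> c \<and> locally_null m {x. c < cmod (\<phi> x)}}"
  obtain C where C: "\<And>x. cmod (\<phi> x) \<le> C" using Linf_bounded[OF \<phi>] by auto
  have "0 \<le> C" using C norm_ge_zero order_trans by blast
  moreover have "{x. C < cmod (\<phi> x)} = {}" using C by (auto simp: not_less)
  ultimately have "C \<in> ?S" by (simp add: locally_null_def)
  moreover have "Inf ?S < 1 + \<delta>" using assms by (simp add: Linf_norm_def)
  moreover have "bdd_below ?S" by (auto intro: bdd_belowI[of _ 0])
  ultimately show ?thesis using cInf_less_iff[of ?S "1 + \<delta>"] by auto
qed

lemma Linf_norm_const_one: "Linf_norm m (\<lambda>_. 1) \<le> 1"
  unfolding Linf_norm_def
  by (rule cInf_lower) (auto simp: locally_null_def intro: bdd_belowI[of _ 0])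

text \<open>\<open>m\<close> lives on the Borel sets and is not completed, so a subset of a locally
  null set must be locally measurable itself; being a preimage under \<open>\<phi>\<close> ensures
  this.\<close>

lemma Linf_locally_null_mono:
  assumes \<phi>: "\<phi> \<in> Linf m" and B: "B \<in> sets borel" and E: "locally_null m E" "\<phi> -` B \<subseteq> E"
  shows "locally_null m (\<phi> -` B)"
  unfolding locally_null_def
proof (intro ballI impI)
  fix F assume F: "F \<in> sets m" "emeasure m F < \<infinity>"
  have "\<phi> -` B \<inter> F \<in> sets m" using Linf_vimage[OF \<phi> B] F by simp
  moreover have "E \<inter> F \<in> null_sets m" using E(1) F by (auto simp: locally_null_def)
  ultimately show "\<phi> -` B \<inter> F \<in> null_sets m"
    using E(2) by (meson Int_mono null_sets_subset order_refl)
qed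

context
  fixes \<mu> assumes \<mu>: "\<mu> \<in> means m"
begin

lemma mean_add: "\<phi> \<in> Linf m \<Longrightarrow> \<psi> \<in> Linf m \<Longrightarrow> \<mu> (\<lambda>x. \<phi> x + \<psi> x) = \<mu> \<phi> + \<mu> \<psi>"
  and mean_mult: "\<phi> \<in> Linf m \<Longrightarrow> \<mu> (\<lambda>x. c * \<phi> x) = c * \<mu> \<phi>"
  and mean_pos: "\<phi> \<in> Linf m \<Longrightarrow> locally_null m {x. \<phi> x \<notin> \<real>\<^sub>\<ge>\<^sub>0} \<Longrightarrow> \<mu> \<phi> \<in> \<real>\<^sub>\<ge>\<^sub>0"
  and mean_norm: "(SUP \<phi>\<in>{\<phi>\<in>Linf m. Linf_norm m \<phi> \<le> 1}. ennreal (cmod (\<mu> \<phi>))) = 1"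
  using \<mu> unfolding means_def by blast+

lemma mean_real_pos:
  assumes "(\<lambda>x. complex_of_real (f x)) \<in> Linf m" "locally_null m {x. f x < 0}"
  shows "Im (\<mu> (\<lambda>x. complex_of_real (f x))) = 0" "0 \<le> Re (\<mu> (\<lambda>x. complex_of_real (f x)))"
proof -
  have "{x. complex_of_real (f x) \<notin> \<real>\<^sub>\<ge>\<^sub>0} = {x. f x < 0}"
    by (auto simp: complex_nonneg_Reals_iff)
  then have "\<mu> (\<lambda>x. complex_of_real (f x)) \<in> \<real>\<^sub>\<ge>\<^sub>0" using assms by (intro mean_pos) auto
  then show "Im (\<mu> (\<lambda>x. complex_of_real (f x))) = 0" "0 \<le> Re (\<mu> (\<lambda>x. complex_of_real (f x)))"
    by (auto simp: complex_nonneg_Reals_iff)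
qed

lemma mean_one_real: "Im (\<mu> (\<lambda>_. 1)) = 0" "0 \<le> Re (\<mu> (\<lambda>_. 1))"
  using mean_real_pos[of "\<lambda>_. 1"] Linf_const[of 1] locally_null_empty by auto

lemma mean_real:
  assumes f: "(\<lambda>x. complex_of_real (f x)) \<in> Linf m"
  shows "Im (\<mu> (\<lambda>x. complex_of_real (f x))) = 0"
proof -
  obtain C where C: "\<And>x. \<bar>f x\<bar> \<le> C" using Linf_bounded[OF f] by auto
  have "0 \<le> f x + C" for x using C[of x] by linarith
  then have "{x. f x + C < 0} = {}" by (auto simp: not_less)
  moreover have L: "(\<lambda>x. complex_of_real (f x + C)) \<in> Linf m"
    using Linf_add[OF f Linf_const[of "complex_of_real C"]] by simp
  ultimately have "Im (\<mu> (\<lambda>x. complex_of_real (f x + C))) = 0"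
    using mean_real_pos(1)[OF L] locally_null_empty by simp
  moreover have "\<mu> (\<lambda>x. complex_of_real (f x + C)) = \<mu> (\<lambda>x. complex_of_real (f x)) + C * \<mu> (\<lambda>_. 1)"
    using mean_add[OF f Linf_const[of "complex_of_real C"]] mean_mult[OF Linf_const[of 1], of "complex_of_real C"]
    by simp
  ultimately show ?thesis using mean_one_real by simp
qed

text \<open>Multiply \<open>\<phi>\<close> by a unimodular \<open>u\<close> that makes
  \<open>\<mu> \<phi>\<close> real and nonnegative. Then only the real part of
  \<open>u * \<phi>\<close> contributes, it is at most \<open>c\<close> off a locally null set, and
  positivity applies.\<close>

lemma mean_norm_le:
  assumes \<phi>: "\<phi> \<in> Linf m" and "0 \<le> c" "locally_null m {x. c < cmod (\<phi> x)}"
  shows "cmod (\<mu> \<phi>) \<le> c * Re (\<mu> (\<lambda>_. 1))"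
proof -
  obtain u where u: "cmod u = 1" "u * \<mu> \<phi> = cmod (\<mu> \<phi>)"
  proof (cases "\<mu> \<phi> = 0")
    case False
    show ?thesis
      by (rule that[of "cnj (\<mu> \<phi>) / cmod (\<mu> \<phi>)"])
         (use False in \<open>auto simp: norm_divide complex_norm_square[symmetric] power2_eq_square mult.commute\<close>)
  qed (use that[of 1] in auto)
  let ?\<psi> = "\<lambda>x. u * \<phi> x"
  have \<psi>: "?\<psi> \<in> Linf m" by (rule Linf_mult[OF \<phi>])
  have "?\<psi> = (\<lambda>x. complex_of_real (Re (?\<psi> x)) + \<i> * complex_of_real (Im (?\<psi> x)))"
    by (rule ext) (rule complex_eq)
  then have "\<mu> ?\<psi> = \<mu> (\<lambda>x. complex_of_real (Re (?\<psi> x)) + \<i> * complex_of_real (Im (?\<psi> x)))" by metis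
  also have "\<dots> = \<mu> (\<lambda>x. complex_of_real (Re (?\<psi> x))) + \<i> * \<mu> (\<lambda>x. complex_of_real (Im (?\<psi> x)))"
    using Linf_Re[OF \<psi>] Linf_Im[OF \<psi>] by (simp only: mean_add mean_mult Linf_mult)
  finally have "Re (\<mu> ?\<psi>) = Re (\<mu> (\<lambda>x. complex_of_real (Re (?\<psi> x))))"
    using mean_real[OF Linf_Im[OF \<psi>]] by simp
  moreover have "\<mu> ?\<psi> = cmod (\<mu> \<phi>)" using mean_mult[OF \<phi>, of u] u by simp
  ultimately have 1: "cmod (\<mu> \<phi>) = Re (\<mu> (\<lambda>x. complex_of_real (Re (?\<psi> x))))" by simp
  define f where "f x = c + - 1 * Re (?\<psi> x)" for x
  have mf: "(\<lambda>x. - 1 * complex_of_real (Re (?\<psi> x))) \<in> Linf m"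
    by (rule Linf_mult[OF Linf_Re[OF \<psi>]])
  have f: "(\<lambda>x. complex_of_real (f x)) \<in> Linf m"
    using Linf_add[OF Linf_const[of "complex_of_real c"] mf] by (simp add: f_def)
  have eq: "{x. f x < 0} = (\<lambda>x. complex_of_real (f x)) -` (- \<real>\<^sub>\<ge>\<^sub>0)"
    by (auto simp: complex_nonneg_Reals_iff)
  have "{x. f x < 0} \<subseteq> {x. c < cmod (\<phi> x)}"
  proof
    fix x assume "x \<in> {x. f x < 0}"
    then have "c < Re (?\<psi> x)" by (simp add: f_def)
    also have "\<dots> \<le> cmod (?\<psi> x)" by (rule complex_Re_le_cmod)
    also have "\<dots> = cmod (\<phi> x)" using u(1) by (simp add: norm_mult)
    finally show "x \<in> {x. c < cmod (\<phi> x)}" by simp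
  qed
  then have "locally_null m {x. f x < 0}"
    unfolding eq using assms(3)
    by (intro Linf_locally_null_mono[OF f]) (auto intro: borel_closed closed_nonneg_Reals_complex)
  then have "0 \<le> Re (\<mu> (\<lambda>x. complex_of_real (f x)))" by (rule mean_real_pos(2)[OF f])
  moreover have "\<mu> (\<lambda>x. complex_of_real (f x)) = c * \<mu> (\<lambda>_. 1) - \<mu> (\<lambda>x. complex_of_real (Re (?\<psi> x)))"
    using mean_add[OF Linf_const[of "complex_of_real c"] mf] mean_mult[OF Linf_const[of 1], of "complex_of_real c"]
      mean_mult[OF Linf_Re[OF \<psi>], of "-1"] by (simp add: f_def)
  ultimately show ?thesis using 1 by simp
qed

lemma mean_one: "\<mu> (\<lambda>_. 1) = 1"
proof -
  let ?a = "Re (\<mu> (\<lambda>_. 1))"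
  have a0: "?a \<ge> 0" and a: "\<mu> (\<lambda>_. 1) = complex_of_real ?a"
    using mean_one_real by (auto simp: complex_eq_iff)
  have "ennreal (cmod (\<mu> (\<lambda>_. 1))) \<le> 1"
    unfolding mean_norm[symmetric] using Linf_const[of 1] Linf_norm_const_one by (intro SUP_upper) auto
  then have "?a \<le> 1" using a a0 by (metis abs_of_nonneg ennreal_le_1 norm_of_real)
  moreover have "1 \<le> ennreal ?a"
    unfolding mean_norm[symmetric]
  proof (rule SUP_least)
    fix \<phi> assume "\<phi> \<in> {\<phi> \<in> Linf m. Linf_norm m \<phi> \<le> 1}"
    then have \<phi>: "\<phi> \<in> Linf m" "Linf_norm m \<phi> \<le> 1" by auto
    have "cmod (\<mu> \<phi>) \<le> ?a"
    proof (rule field_le_epsilon)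
      fix d :: real assume d: "d > 0"
      obtain d' where d': "d' > 0" "d' * ?a < d" using small_factor[OF a0 d] .
      obtain c where c: "0 \<le> c" "c < 1 + d'" "locally_null m {x. c < cmod (\<phi> x)}"
        using Linf_norm_le_imp[OF \<phi> d'(1)] by blast
      have "cmod (\<mu> \<phi>) \<le> c * ?a" by (rule mean_norm_le[OF \<phi>(1) c(1,3)])
      also have "\<dots> \<le> (1 + d') * ?a" using c(2) a0 by (intro mult_right_mono) auto
      finally show "cmod (\<mu> \<phi>) \<le> ?a + d" using d'(2) by (simp add: algebra_simps)
    qed
    then show "ennreal (cmod (\<mu> \<phi>)) \<le> ennreal ?a" by (rule ennreal_leI)
  qed
  ultimately show ?thesis using a a0 by (metis ennreal_ge_1 of_real_1 order_antisym)
qed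

end

lemma TLIM_invariant_mean:
  assumes \<mu>: "\<mu> \<in> TLIM m"
  shows "invariant_mean m (\<lambda>f. Re (\<mu> (\<lambda>x. complex_of_real (f x))))"
proof -
  have \<mu>m: "\<mu> \<in> means m" using \<mu> by (simp add: TLIM_def)
  show ?thesis
  proof (unfold_locales)
    show "Re (\<mu> (\<lambda>x. complex_of_real (f x + g x))) =
        Re (\<mu> (\<lambda>x. complex_of_real (f x))) + Re (\<mu> (\<lambda>x. complex_of_real (g x)))"
      if "bdd_borel f" "bdd_borel g" for f g
      using mean_add[OF \<mu>m bdd_borel_Linf[OF that(1)] bdd_borel_Linf[OF that(2)]] by simp
    show "Re (\<mu> (\<lambda>x. complex_of_real (c * f x))) = c * Re (\<mu> (\<lambda>x. complex_of_real (f x)))"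
      if "bdd_borel f" for f c
      using mean_mult[OF \<mu>m bdd_borel_Linf[OF that], of "complex_of_real c"] by simp
    show "Re (\<mu> (\<lambda>x. complex_of_real (f x))) \<le> Re (\<mu> (\<lambda>x. complex_of_real (g x)))"
      if fg: "bdd_borel f" "bdd_borel g" "\<And>x. f x \<le> g x" for f g
    proof -
      have "{x. g x + - 1 * f x < 0} = {}" using fg(3) by (auto simp: not_less)
      then have "0 \<le> Re (\<mu> (\<lambda>x. complex_of_real (g x + - 1 * f x)))"
        using mean_real_pos(2)[OF \<mu>m bdd_borel_Linf[OF bdd_borel_add[OF fg(2) bdd_borel_scale[OF fg(1)]]], of "-1"]
          locally_null_empty by simp
      moreover have "\<mu> (\<lambda>x. complex_of_real (g x) + - 1 * complex_of_real (f x)) =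
          \<mu> (\<lambda>x. complex_of_real (g x)) - \<mu> (\<lambda>x. complex_of_real (f x))"
        using mean_add[OF \<mu>m bdd_borel_Linf[OF fg(2)] Linf_mult[OF bdd_borel_Linf[OF fg(1)], of "-1"]]
          mean_mult[OF \<mu>m bdd_borel_Linf[OF fg(1)], of "-1"] by simp
      ultimately show ?thesis by simp
    qed
    show "Re (\<mu> (\<lambda>x. complex_of_real 1)) = 1" using mean_one[OF \<mu>m] by simp
    fix f \<phi> :: "'a \<Rightarrow> real"
    assume f: "cc f" "\<And>x. 0 \<le> f x" "(\<integral>x. f x \<partial>m) = 1" and \<phi>: "bdd_borel \<phi>"
    have "f \<in> P1 m" using f integrable_cc[OF f(1)] by (simp add: P1_def)
    then have "\<mu> (convolution m f (\<lambda>x. complex_of_real (\<phi> x))) = \<mu> (\<lambda>x. complex_of_real (\<phi> x))"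
      using \<mu> bdd_borel_Linf[OF \<phi>] unfolding TLIM_def by blast
    moreover have "convolution m f (\<lambda>x. complex_of_real (\<phi> x)) =
        (\<lambda>x. complex_of_real (\<integral>y. f y * \<phi> (- y + x) \<partial>m))"
      unfolding convolution_def
      by (simp add: scaleR_conv_of_real flip: of_real_mult integral_complex_of_real)
    ultimately show "Re (\<mu> (\<lambda>x. complex_of_real (\<integral>y. f y * \<phi> (- y + x) \<partial>m)))
        = Re (\<mu> (\<lambda>x. complex_of_real (\<phi> x)))" by simp
  qed
qed


subsection \<open>The mean of a compact set\<close>

context
  fixes A assumes A: "compact A" and mA: "measure m A > 0"
begin

lemma Linf_restrict_integrable:
  assumes \<phi>: "\<phi> \<in> Linf m"
  shows "integrable m (\<lambda>x. (indicator A x / measure m A) *\<^sub>R \<phi> x)"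
proof -
  obtain C where C: "\<And>x. cmod (\<phi> x) \<le> C" using Linf_bounded[OF \<phi>] by auto
  have fin: "A \<in> sets borel" "emeasure m A < \<infinity>"
    using A emeasure_compact_finite[OF A] by (auto intro: compact_in_borel)
  then have "(\<lambda>x. indicator A x *\<^sub>R \<phi> x) \<in> borel_measurable borel" using \<phi> by (simp add: Linf_iff)
  then have "integrable m (\<lambda>x. indicator A x *\<^sub>R \<phi> x)"
    using fin C by (intro integrableI_bounded_set[of A _ _ C]) (auto simp: indicator_def)
  then have "integrable m (\<lambda>x. inverse (measure m A) *\<^sub>R (indicator A x *\<^sub>R \<phi> x))"
    by (rule integrable_scaleR_right)
  then show ?thesis by (simp add: divide_inverse mult.commute)
qed

lemma mean_of_set_apply:
  "\<phi> \<in> Linf m \<Longrightarrow> mean_of_set m A \<phi> = (\<integral>x. (indicator A x / measure m A) *\<^sub>R \<phi> x \<partial>m)"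
  by (simp add: mean_of_set_def L1_functional_def)

lemma mean_of_set_norm_le:
  assumes \<phi>: "\<phi> \<in> Linf m" and c: "0 \<le> c" "locally_null m {x. c < cmod (\<phi> x)}"
  shows "cmod (mean_of_set m A \<phi>) \<le> c"
proof -
  have fin: "A \<in> fmeasurable m" by (rule fmeasurable_compact[OF A])
  have "{x. c < cmod (\<phi> x)} \<inter> A \<in> null_sets m"
    using c(2) fin by (auto simp: locally_null_def fmeasurable_def)
  then have ae: "AE x in m. x \<in> A \<longrightarrow> cmod (\<phi> x) \<le> c"
    by (rule AE_I') auto
  have "cmod (mean_of_set m A \<phi>) \<le> (\<integral>x. cmod ((indicator A x / measure m A) *\<^sub>R \<phi> x) \<partial>m)"
    unfolding mean_of_set_apply[OF \<phi>] by (rule integral_norm_bound)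
  also have "\<dots> \<le> (\<integral>x. (c / measure m A) * indicator A x \<partial>m)"
  proof (rule integral_mono_AE)
    show "integrable m (\<lambda>x. cmod ((indicator A x / measure m A) *\<^sub>R \<phi> x))"
      by (rule integrable_norm[OF Linf_restrict_integrable[OF \<phi>]])
    show "integrable m (\<lambda>x. (c / measure m A) * indicator A x)"
      using fin by (intro integrable_mult_right integrable_real_indicator) (auto simp: fmeasurable_def)
    show "AE x in m. cmod ((indicator A x / measure m A) *\<^sub>R \<phi> x) \<le> c / measure m A * indicator A x"
      using ae
    proof eventually_elim
      case (elim x)
      then show ?case using mA by (auto simp: indicator_def divide_simps)
    qed
  qed
  also have "\<dots> = c" using mA by simp
  finally show ?thesis .
qed

lemma mean_of_set_one: "mean_of_set m A (\<lambda>_. 1) = 1"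
proof -
  have "mean_of_set m A (\<lambda>_. 1) = (\<integral>x. complex_of_real (indicator A x / measure m A) \<partial>m)"
    by (simp add: mean_of_set_apply[OF Linf_const] scaleR_conv_of_real)
  also have "\<dots> = complex_of_real (\<integral>x. indicator A x / measure m A \<partial>m)"
    by (rule integral_complex_of_real)
  also have "\<dots> = 1" using mA by simp
  finally show ?thesis .
qed

lemma mean_of_set_means: "mean_of_set m A \<in> means m"
  unfolding means_def
proof (intro CollectI conjI ballI allI impI)
  have fin: "A \<in> fmeasurable m" by (rule fmeasurable_compact[OF A])
  show "mean_of_set m A \<in> extensional (Linf m)" by (simp add: mean_of_set_def L1_functional_def)
  show "mean_of_set m A \<phi> = mean_of_set m A \<psi>"
    if "\<phi> \<in> Linf m" "\<psi> \<in> Linf m" "locally_eq m \<phi> \<psi>" for \<phi> \<psi>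
  proof -
    have "{x. \<phi> x \<noteq> \<psi> x} \<inter> A \<in> null_sets m"
      using that(3) fin by (auto simp: locally_eq_def locally_null_def fmeasurable_def)
    then have "AE x in m. (indicator A x / measure m A) *\<^sub>R \<phi> x = (indicator A x / measure m A) *\<^sub>R \<psi> x"
      by (rule AE_I') (auto simp: indicator_def)
    then show ?thesis
      unfolding mean_of_set_apply[OF that(1)] mean_of_set_apply[OF that(2)]
      using borel_measurable_integrable[OF Linf_restrict_integrable[OF that(1)]]
        borel_measurable_integrable[OF Linf_restrict_integrable[OF that(2)]]
      by (intro integral_cong_AE)
  qed
  show "mean_of_set m A (\<lambda>x. \<phi> x + \<psi> x) = mean_of_set m A \<phi> + mean_of_set m A \<psi>"
    if "\<phi> \<in> Linf m" "\<psi> \<in> Linf m" for \<phi> \<psi>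
    using that Linf_add[OF that] Linf_restrict_integrable[OF that(1)] Linf_restrict_integrable[OF that(2)]
    by (simp add: mean_of_set_apply scaleR_add_right)
  show "mean_of_set m A (\<lambda>x. c * \<phi> x) = c * mean_of_set m A \<phi>" if "\<phi> \<in> Linf m" for c \<phi>
    unfolding mean_of_set_apply[OF that] mean_of_set_apply[OF Linf_mult[OF that]]
    by (simp flip: mult_scaleR_right)
  show "(SUP \<phi>\<in>{\<phi>\<in>Linf m. Linf_norm m \<phi> \<le> 1}. ennreal (cmod (mean_of_set m A \<phi>))) = 1"
  proof (rule antisym)
    show "(SUP \<phi>\<in>{\<phi>\<in>Linf m. Linf_norm m \<phi> \<le> 1}. ennreal (cmod (mean_of_set m A \<phi>))) \<le> 1"
    proof (rule SUP_least)
      fix \<phi> assume "\<phi> \<in> {\<phi> \<in> Linf m. Linf_norm m \<phi> \<le> 1}"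
      then have \<phi>: "\<phi> \<in> Linf m" "Linf_norm m \<phi> \<le> 1" by auto
      have "cmod (mean_of_set m A \<phi>) \<le> 1"
      proof (rule field_le_epsilon)
        fix d :: real assume "d > 0"
        then obtain c where c: "0 \<le> c" "c < 1 + d" "locally_null m {x. c < cmod (\<phi> x)}"
          using Linf_norm_le_imp[OF \<phi>] by blast
        show "cmod (mean_of_set m A \<phi>) \<le> 1 + d"
          using mean_of_set_norm_le[OF \<phi>(1) c(1,3)] c(2) by linarith
      qed
      then show "ennreal (cmod (mean_of_set m A \<phi>)) \<le> 1" by simp
    qed
    have "ennreal (cmod (mean_of_set m A (\<lambda>_. 1))) \<le>
        (SUP \<phi>\<in>{\<phi>\<in>Linf m. Linf_norm m \<phi> \<le> 1}. ennreal (cmod (mean_of_set m A \<phi>)))"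
      using Linf_const[of 1] Linf_norm_const_one by (intro SUP_upper) auto
    then show "1 \<le> (SUP \<phi>\<in>{\<phi>\<in>Linf m. Linf_norm m \<phi> \<le> 1}. ennreal (cmod (mean_of_set m A \<phi>)))"
      by (simp add: mean_of_set_one)
  qed
  show "mean_of_set m A \<phi> \<in> \<real>\<^sub>\<ge>\<^sub>0" if \<phi>: "\<phi> \<in> Linf m" and null: "locally_null m {x. \<phi> x \<notin> \<real>\<^sub>\<ge>\<^sub>0}" for \<phi>
  proof -
    have "{x. \<phi> x \<notin> \<real>\<^sub>\<ge>\<^sub>0} \<inter> A \<in> null_sets m"
      using null fin by (auto simp: locally_null_def fmeasurable_def)
    then have ae: "AE x in m. x \<in> A \<longrightarrow> \<phi> x \<in> \<real>\<^sub>\<ge>\<^sub>0" by (rule AE_I') auto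
    let ?g = "\<lambda>x. (indicator A x / measure m A) *\<^sub>R \<phi> x"
    have int: "integrable m ?g" by (rule Linf_restrict_integrable[OF \<phi>])
    have "Re (integral\<^sup>L m ?g) = (\<integral>x. Re (?g x) \<partial>m)" "Im (integral\<^sup>L m ?g) = (\<integral>x. Im (?g x) \<partial>m)"
      using integral_Re[OF int] integral_Im[OF int] by simp_all
    moreover have "(\<integral>x. Re (?g x) \<partial>m) \<ge> 0"
    proof (rule integral_nonneg_AE)
      show "AE x in m. 0 \<le> Re (?g x)"
        using ae by eventually_elim (auto simp: complex_nonneg_Reals_iff indicator_def)
    qed
    moreover have "(\<integral>x. Im (?g x) \<partial>m) = 0"
    proof (rule integral_eq_zero_AE)
      show "AE x in m. Im (?g x) = 0"
        using ae by eventually_elim (auto simp: complex_nonneg_Reals_iff indicator_def)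
    qed
    ultimately show ?thesis
      unfolding mean_of_set_apply[OF \<phi>] by (simp add: complex_nonneg_Reals_iff)
  qed
qed

lemma mean_of_set_indicator:
  assumes "locally_measurable m E"
  shows "mean_of_set m A (indicator E) = complex_of_real (measure m (A \<inter> E) / measure m A)"
proof -
  have "mean_of_set m A (indicator E) = (\<integral>x. complex_of_real (indicator (A \<inter> E) x / measure m A) \<partial>m)"
    unfolding mean_of_set_apply[OF indicator_Linf[OF assms]]
    by (intro Bochner_Integration.integral_cong refl) (auto simp: indicator_def scaleR_conv_of_real)
  also have "\<dots> = complex_of_real (\<integral>x. indicator (A \<inter> E) x / measure m A \<partial>m)"
    by (rule integral_complex_of_real)
  finally show ?thesis by simp
qed

end

end

section \<open>Averages over right translates\<close>

context haar_group
begin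

lemma bcs_mult_indicator:
  assumes E: "locally_measurable m E" and h: "bcs h"
  shows "bcs (\<lambda>z. indicator E z * h z)"
proof -
  obtain Q where Q: "compact Q" "\<And>x. x \<notin> Q \<Longrightarrow> h x = 0" using h by (metis bcsE)
  have "E \<inter> Q \<in> sets borel"
    using E compact_in_borel[OF Q(1)] emeasure_compact_finite[OF Q(1)] by (simp add: locally_measurable_def)
  then have "bcs (\<lambda>z. indicator (E \<inter> Q) z * h z)"
    by (intro bcs_mult_bounded[OF h, of _ 1] borel_measurable_indicator) (simp_all add: indicator_def)
  moreover have "indicator (E \<inter> Q) z * h z = indicator E z * h z" for z
    using Q(2)[of z] by (cases "z \<in> Q") (auto simp: indicator_def)
  ultimately show ?thesis by simp
qed

definition avg :: "'a set \<Rightarrow> 'a set \<Rightarrow> 'a \<Rightarrow> real" where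
  "avg A E x = measure m ((\<lambda>y. y + x) ` A \<inter> E) / measure m ((\<lambda>y. y + x) ` A)"

lemma measure_right_translate_compact:
  "compact A \<Longrightarrow> measure m ((\<lambda>y. y + x) ` A) = modular (- x) * measure m A"
  by (rule measure_right_translate[OF compact_in_borel order_refl])

lemma avg_alt:
  assumes A: "compact A"
  shows "avg A E x = modular x * measure m ((\<lambda>y. y + x) ` A \<inter> E) / measure m A"
  using modular_pos[of x] by (simp add: avg_def measure_right_translate_compact[OF A] modular_minus divide_simps)

lemma integral_indicator_rtr:
  assumes A: "compact A"
  shows "(\<integral>z. indicator E z * rtr x (indicator A) z \<partial>m) = modular x * measure m ((\<lambda>y. y + x) ` A \<inter> E)"
proof -
  have "indicator E z * rtr x (indicator A) z = modular x * indicator ((\<lambda>y. y + x) ` A \<inter> E) z" for z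
    by (auto simp: rtr_def right_translate_eq_vimage indicator_def)
  then show ?thesis by simp
qed

lemma avg_bounds:
  assumes A: "compact A" and E: "locally_measurable m E"
  shows "0 \<le> avg A E x" "avg A E x \<le> 1"
proof -
  let ?A = "(\<lambda>y. y + x) ` A"
  have fm: "?A \<in> fmeasurable m" by (intro fmeasurable_compact compact_right_translate A)
  have "E \<inter> ?A \<in> sets borel"
    using E fm by (simp add: locally_measurable_def fmeasurable_def)
  then have "measure m (?A \<inter> E) \<le> measure m ?A"
    using fm by (intro measure_mono_fmeasurable) (auto simp: Int_commute)
  then show "0 \<le> avg A E x" "avg A E x \<le> 1"
    by (auto simp: avg_def divide_le_eq_1 less_le)
qed

end

lemma (in invariant_mean) avg_bdd_borel:
  assumes A: "compact A" and E: "locally_measurable m E"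
  shows "bdd_borel (avg A E)"
proof -
  define L where "L h = (\<integral>z. indicator E z * h z \<partial>m)" for h :: "'a \<Rightarrow> real"
  have bE: "bcs (\<lambda>z. indicator E z * h z)" if "bcs h" for h by (rule bcs_mult_indicator[OF E that])
  have L1: "L (\<lambda>x. f x + g x) = L f + L g" if "bcs f" "bcs g" for f g
    using integrable_bcs[OF bE[OF that(1)]] integrable_bcs[OF bE[OF that(2)]]
    by (simp add: L_def distrib_left)
  have L2: "L (\<lambda>x. c * f x) = c * L f" if "bcs f" for f c
    by (simp add: L_def mult.left_commute)
  have L3: "\<bar>L f\<bar> \<le> (\<integral>x. \<bar>f x\<bar> \<partial>m)" if "bcs f" for f
  proof -
    have "\<bar>L f\<bar> \<le> (\<integral>z. \<bar>indicator E z * f z\<bar> \<partial>m)" unfolding L_def by (rule integral_abs_bound)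
    also have "\<dots> \<le> (\<integral>x. \<bar>f x\<bar> \<partial>m)"
      by (intro integral_mono integrable_bcs bcs_abs bE that) (auto simp: indicator_def)
    finally show ?thesis .
  qed
  have bA: "bcs (indicator A)" by (rule bcs_indicator[OF compact_in_borel[OF A] order_refl A])
  have "\<exists>q. cc q \<and> (\<integral>z. \<bar>q z - indicator A z\<bar> \<partial>m) \<le> inverse (real (Suc n))" for n
    by (rule indicator_approx_cc[OF A]) simp
  then have "\<exists>q. \<forall>n. cc (q n) \<and> (\<integral>z. \<bar>q n z - indicator A z\<bar> \<partial>m) \<le> inverse (real (Suc n))"
    by (intro choice allI)
  then obtain q where q: "\<And>n. cc (q n)" "\<And>n. (\<integral>z. \<bar>q n z - indicator A z\<bar> \<partial>m) \<le> inverse (real (Suc n))"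
    by blast
  have B: "bdd_borel (\<lambda>x. L (rtr x (q n)))" for n
    by (rule L_rtr_bdd_borel[of L, rotated 3, OF q(1)]) (fact L1 L2 L3)+
  have close: "\<bar>L (rtr x (q n)) - L (rtr x (indicator A))\<bar> \<le> (\<integral>z. \<bar>q n z - indicator A z\<bar> \<partial>m)" for n x
    by (rule L_rtr_close[of L, rotated 3, OF cc_imp_bcs[OF q(1)] bA]) (fact L1 L2 L3)+
  have lim: "(\<lambda>n. L (rtr x (q n))) \<longlonglongrightarrow> L (rtr x (indicator A))" for x
  proof (rule LIM_zero_cancel, rule Lim_null_comparison)
    show "\<forall>\<^sub>F n in sequentially. norm (L (rtr x (q n)) - L (rtr x (indicator A))) \<le> inverse (real (Suc n))"
      using order_trans[OF close q(2)] by (intro always_eventually allI) simp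
  qed (rule LIMSEQ_inverse_real_of_nat)
  have "(\<lambda>x. L (rtr x (q n))) \<in> borel_measurable borel" for n
    using B[of n] by (simp add: bdd_borel_def)
  then have "(\<lambda>x. L (rtr x (indicator A))) \<in> borel_measurable borel"
    by (rule borel_measurable_LIMSEQ_real[OF lim])
  moreover have "avg A E = (\<lambda>x. L (rtr x (indicator A)) / measure m A)"
    by (auto simp: L_def integral_indicator_rtr[OF A] avg_alt[OF A])
  ultimately have "avg A E \<in> borel_measurable borel" by simp
  moreover have "\<bar>avg A E x\<bar> \<le> 1" for x using avg_bounds[OF A E, of x] by simp
  ultimately show ?thesis by (auto simp: bdd_borel_def)
qed

lemma (in haar_group) TLIM_avg:
  assumes \<mu>: "\<mu> \<in> TLIM m" and A: "compact A" "measure m A > 0" and E: "locally_measurable m E"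
  shows "\<mu> (\<lambda>x. complex_of_real (avg A E x)) = \<mu> (indicator E)"
proof -
  define f where "f y = modular y * indicator A (- y) / measure m A" for y
  have bA: "bcs (indicator A)" by (rule bcs_indicator[OF compact_in_borel[OF A(1)] order_refl A(1)])
  have "compact (modular ` uminus ` A)"
    by (intro compact_continuous_image compact_uminus_image A continuous_on_subset[OF continuous_on_modular]) auto
  then obtain B where B: "\<And>y. y \<in> uminus ` A \<Longrightarrow> \<bar>modular y\<bar> \<le> B"
    by (metis bounded_iff compact_imp_bounded imageI real_norm_def)
  have "integrable m (\<lambda>y. modular y * indicator A (- y))"
  proof (rule integrable_bcs, rule bcs_mult_bounded[where B = B])
    show "bcs (\<lambda>y. indicator A (- y))" by (rule bcs_uminus[OF bA])
    show "modular \<in> borel_measurable borel"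
      by (rule borel_measurable_continuous_onI[OF continuous_on_modular])
    show "\<bar>modular y\<bar> \<le> B" if "indicator A (- y) \<noteq> (0 :: real)" for y
      using that B[of y] by (auto simp: indicator_def uminus_image_eq_vimage split: if_splits)
  qed
  then have f_int: "integrable m f" unfolding f_def by simp
  have f_pos: "0 \<le> f y" for y using modular_pos[of y] by (simp add: f_def less_imp_le)
  have "(\<integral>y. f y \<partial>m) = (\<integral>y. modular y * indicator A (- y) \<partial>m) / measure m A" by (simp add: f_def)
  also have "(\<integral>y. modular y * indicator A (- y) \<partial>m) = (\<integral>y. indicator A y \<partial>m)"
    using integral_uminus[OF bcs_uminus[OF bA]] by simp
  finally have "f \<in> P1 m" using f_int f_pos A(2) by (simp add: P1_def)
  then have "\<mu> (convolution m f (indicator E)) = \<mu> (indicator E)"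
    using \<mu> indicator_Linf[OF E] unfolding TLIM_def by blast
  moreover have "convolution m f (indicator E) x = complex_of_real (avg A E x)" for x
  proof -
    define j :: "'a \<Rightarrow> real" where "j z = indicator E z * indicator ((\<lambda>y. y + x) ` A) z" for z
    have "bcs (indicator ((\<lambda>y. y + x) ` A))"
      by (intro bcs_indicator[OF compact_in_borel order_refl] compact_right_translate A)
    then have j: "bcs j" unfolding j_def by (rule bcs_mult_indicator[OF E])
    have jx: "j (y + x) = indicator E (y + x) * indicator A y" for y
      by (simp add: j_def right_translate_eq_vimage indicator_def add.assoc)
    have "convolution m f (indicator E) x =
        (\<integral>y. complex_of_real (modular y * j (- y + x) / measure m A) \<partial>m)"
      unfolding convolution_def
      by (intro Bochner_Integration.integral_cong refl) (auto simp: f_def jx indicator_def scaleR_conv_of_real)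
    also have "\<dots> = complex_of_real ((\<integral>y. modular y * j (- y + x) \<partial>m) / measure m A)"
      by (simp only: integral_complex_of_real) simp
    also have "(\<integral>y. modular y * j (- y + x) \<partial>m) = (\<integral>y. j (y + x) \<partial>m)"
      using integral_uminus[OF bcs_uminus[OF bcs_translate_right[OF j, of x]]] by simp
    also have "\<dots> = modular x * (\<integral>z. j z \<partial>m)" by (rule integral_right_translate[OF j])
    also have "(\<integral>z. j z \<partial>m) = (\<integral>z. indicator ((\<lambda>y. y + x) ` A \<inter> E) z \<partial>m)"
      by (intro Bochner_Integration.integral_cong refl) (auto simp: j_def indicator_def)
    finally show ?thesis by (simp add: avg_alt[OF A(1)])
  qed
  ultimately show ?thesis by (metis (no_types, lifting) ext)
qed


section \<open>Groups that are not sigma-compact\<close>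

lemma not_sigma_compact:
  assumes "natLeq <o (compact_covering_number :: 'a::topological_space set rel)"
    and C: "countable C" "\<forall>K\<in>C. compact K"
  shows "\<Union>C \<noteq> (UNIV :: 'a set)"
proof
  assume "\<Union>C = UNIV"
  then have cov: "compact_covering C" using C(2) by (simp add: compact_covering_def)
  let ?D = "SOME D :: 'a set set. minimal_compact_covering D"
  have "minimal_compact_covering ?D" using minimal_compact_covering_exists by (rule someI_ex)
  then have "|?D| \<le>o |C|" using cov by (simp add: minimal_compact_covering_def)
  also have "|C| \<le>o natLeq" using C(1) by (simp add: countable_card_le_natLeq)
  finally have "(compact_covering_number :: 'a set rel) \<le>o natLeq" by (simp add: compact_covering_number_def)
  then show False using assms(1) not_ordLess_ordLeq by blast
qed

lemma (in invariant_mean) M_indicator_null: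
  assumes not_sigma: "\<And>C :: 'a set set. countable C \<Longrightarrow> (\<forall>K\<in>C. compact K) \<Longrightarrow> \<Union>C \<noteq> UNIV"
    and S: "S \<in> sets borel" and C: "countable C" "\<And>K. K \<in> C \<Longrightarrow> compact K" "S \<subseteq> \<Union>C"
  shows "M (indicator S) = 0"
proof -
  obtain N0 C0 :: "'a set" where N0: "open N0" "compact C0" "0 \<in> N0" "N0 \<subseteq> C0"
    using locally_compact_zero_nhd[OF lc] .
  obtain K :: "nat \<Rightarrow> 'a set" where K: "\<And>n. compact (K n)" "S \<subseteq> (\<Union>n. K n)"
  proof (cases "C = {}")
    case True
    then show ?thesis using that[of "\<lambda>_. {}"] C(3) by auto
  next
    case False
    then show ?thesis
      using that[of "from_nat_into C"] C range_from_nat_into[OF False C(1)] from_nat_into[OF False] by simp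
  qed
  define Q where "Q = rec_nat C0 (\<lambda>n Q. Q \<union> (Q + Q) \<union> uminus ` Q \<union> K n)"
  have Q_0: "Q 0 = C0" and Q_Suc: "\<And>n. Q (Suc n) = Q n \<union> (Q n + Q n) \<union> uminus ` Q n \<union> K n"
    by (simp_all add: Q_def)
  have Qc: "compact (Q n)" for n
    by (induction n) (auto simp: Q_0 Q_Suc N0 K intro!: compact_Un compact_set_plus compact_uminus_image)
  have "mono Q" unfolding mono_iff_le_Suc by (auto simp: Q_Suc)
  define H where "H = (\<Union>n. Q n)"
  have H_add: "x + y \<in> H" if xy: "x \<in> H" "y \<in> H" for x y
  proof -
    obtain i j where "x \<in> Q i" "y \<in> Q j" using xy by (auto simp: H_def)
    then have "x \<in> Q (max i j)" "y \<in> Q (max i j)"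
      using monoD[OF \<open>mono Q\<close>, of i "max i j"] monoD[OF \<open>mono Q\<close>, of j "max i j"] by auto
    then have "x + y \<in> Q (Suc (max i j))" unfolding Q_Suc using set_plus_intro by blast
    then show ?thesis by (auto simp: H_def)
  qed
  have H_minus: "- x \<in> H" if x: "x \<in> H" for x
  proof -
    obtain i where "x \<in> Q i" using x by (auto simp: H_def)
    then have "- x \<in> Q (Suc i)" by (auto simp: Q_Suc)
    then show ?thesis by (auto simp: H_def)
  qed
  have NH: "N0 \<subseteq> H" using N0(4) Q_0 by (auto simp: H_def)
  have "S \<subseteq> H"
  proof
    fix x assume "x \<in> S"
    then obtain n where "x \<in> K n" using K(2) by auto
    then have "x \<in> Q (Suc n)" by (simp add: Q_Suc)
    then show "x \<in> H" by (auto simp: H_def)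
  qed
  have Hs: "H \<in> sets borel" unfolding H_def using Qc compact_in_borel by auto
  have xHs: "(+) x ` H \<in> sets borel" for x by (rule borel_left_translate[OF Hs])
  have coset: "M (indicator ((+) x ` H)) = M (indicator H)" for x
  proof -
    obtain b where "bump N0 b" using bump_exists[OF N0(1,3)] by blast
    note b = bumpD[OF this]
    define f where "f z = b (- x + z)" for z
    have f: "cc f" "\<And>z. 0 \<le> f z" unfolding f_def using b by (auto intro: cc_translate_left)
    have f1: "(\<integral>z. f z \<partial>m) = 1"
      using integral_left_translate[of b "- x"] b(4) cc_imp_bcs[OF b(1)] by (simp add: f_def bcs_def)
    have eq: "f y * indicator H (- y + z) = f y * indicator H (- x + z)" for y z
    proof (cases "f y = 0")
      case False
      then have xy: "- x + y \<in> H" using b(3)[of "- x + y"] NH by (auto simp: f_def)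
      have "- y + z \<in> H \<longleftrightarrow> - x + z \<in> H"
      proof
        assume "- y + z \<in> H"
        from H_add[OF xy this] show "- x + z \<in> H" by (simp add: add.assoc)
      next
        assume "- x + z \<in> H"
        from H_add[OF H_minus[OF xy] this] show "- y + z \<in> H"
          by (simp only: minus_add minus_minus add.assoc add_minus_cancel)
      qed
      then show ?thesis by (simp add: indicator_def)
    qed simp
    have "(\<lambda>z. \<integral>y. f y * indicator H (- y + z) \<partial>m) = (\<lambda>z. indicator H (- x + z))"
      unfolding eq using f1 by simp
    also have "\<dots> = indicator ((+) x ` H)"
      unfolding left_translate_eq_vimage by (auto simp: indicator_def)
    finally show ?thesis using M_conv[OF f f1 bdd_borel_indicator[OF Hs]] by simp
  qed
  have "\<exists>X. finite X \<and> card X = n \<and> disjoint_family_on (\<lambda>x. (+) x ` H) X" for n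
  proof (induction n)
    case 0
    show ?case by (intro exI[of _ "{}"]) (simp add: disjoint_family_on_def)
  next
    case (Suc n)
    then obtain X where X: "finite X" "card X = n" "disjoint_family_on (\<lambda>x. (+) x ` H) X" by blast
    have "countable ((\<lambda>(x, n). (+) x ` Q n) ` (X \<times> UNIV))"
      using countable_finite[OF X(1)] by (intro countable_image countable_SIGMA) auto
    moreover have "\<forall>K\<in>(\<lambda>(x, n). (+) x ` Q n) ` (X \<times> UNIV). compact K"
      using Qc by (auto intro: compact_left_translate)
    ultimately obtain y where y: "y \<notin> \<Union>((\<lambda>(x, n). (+) x ` Q n) ` (X \<times> UNIV))"
      using not_sigma by blast
    have yX: "(+) x ` H \<inter> (+) y ` H = {}" if x: "x \<in> X" for x
    proof (rule ccontr)
      assume "(+) x ` H \<inter> (+) y ` H \<noteq> {}"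
      then obtain h h' where h: "h \<in> H" "h' \<in> H" "x + h = y + h'" by auto
      have "y = x + (h + - h')" using h(3) by (metis add.assoc add.right_neutral right_minus)
      moreover have "h + - h' \<in> H" by (intro H_add H_minus h)
      ultimately show False using y x by (auto simp: H_def)
    qed
    have "y \<notin> X"
    proof
      assume "y \<in> X"
      moreover have "0 \<in> H" using NH N0(3) by auto
      ultimately show False using yX[of y] by blast
    qed
    then have "finite (insert y X)" "card (insert y X) = Suc n"
      "disjoint_family_on (\<lambda>x. (+) x ` H) (insert y X)"
      using X yX by (auto simp: disjoint_family_on_insert)
    then show ?case by blast
  qed
  note ex = this
  have "real n * M (indicator H) \<le> 1" for n
  proof -
    obtain X where X: "finite X" "card X = n" "disjoint_family_on (\<lambda>x. (+) x ` H) X" using ex by blast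
    have "real n * M (indicator H) = (\<Sum>x\<in>X. M (indicator ((+) x ` H)))"
      using X(2) by (simp add: coset)
    also have "\<dots> = M (\<lambda>z. \<Sum>x\<in>X. indicator ((+) x ` H) z)"
      by (rule M_sum[OF X(1), symmetric]) (rule bdd_borel_indicator[OF xHs])
    also have "\<dots> \<le> M (\<lambda>_. 1)"
    proof (rule M_mono)
      show "bdd_borel (\<lambda>z. \<Sum>x\<in>X. indicator ((+) x ` H) z)"
        by (intro bdd_borel_sum X(1) bdd_borel_indicator xHs)
      show "(\<Sum>x\<in>X. indicator ((+) x ` H) z) \<le> (1 :: real)" for z
        unfolding indicator_UN_disjoint[OF X(1,3), symmetric] by (simp add: indicator_def)
    qed (rule bdd_borel_const)
    finally show ?thesis by (simp add: M_const)
  qed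
  then have "M (indicator H) \<le> 0"
    by (metis mult.commute not_le ex_less_of_nat_mult)
  moreover have "M (indicator S) \<le> M (indicator H)"
    using \<open>S \<subseteq> H\<close> by (intro M_mono bdd_borel_indicator S Hs) (auto simp: indicator_def)
  moreover have "M (\<lambda>_. 0) \<le> M (indicator S)"
    by (intro M_mono bdd_borel_indicator S bdd_borel_const) simp
  ultimately show ?thesis by (simp add: M_const)
qed

lemma disjoint_right_translates_one:
  fixes A :: "'a::{topological_group_add,t2_space} set"
  assumes A: "compact A" and S: "\<And>K. compact K \<Longrightarrow> \<not> S \<subseteq> K" and Q: "compact Q"
  shows "\<exists>X. X \<subseteq> S \<and> finite X \<and> card X = n \<and> (\<forall>x\<in>X. (\<lambda>y. y + x) ` A \<inter> Q = {}) \<and>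
    disjoint_family_on (\<lambda>x. (\<lambda>y. y + x) ` A) X"
proof (induction n)
  case 0
  show ?case by (intro exI[of _ "{}"]) (simp add: disjoint_family_on_def)
next
  case (Suc n)
  then obtain X where X: "X \<subseteq> S" "finite X" "card X = n" "\<forall>x\<in>X. (\<lambda>y. y + x) ` A \<inter> Q = {}"
    "disjoint_family_on (\<lambda>x. (\<lambda>y. y + x) ` A) X" by blast
  define R where "R = Q \<union> (\<Union>x\<in>X. (\<lambda>y. y + x) ` A)"
  have "compact R" unfolding R_def using X(2) Q A by (auto intro!: compact_Un compact_UN compact_right_translate)
  then have "compact (uminus ` A + R)"
    using A by (intro compact_set_plus compact_uminus_image)
  then have "compact ((uminus ` A + R) \<union> X)"
    using finite_imp_compact[OF X(2)] by (rule compact_Un)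
  then obtain x where x: "x \<in> S" "x \<notin> uminus ` A + R" "x \<notin> X" using S by blast
  have disj: "(\<lambda>y. y + x) ` A \<inter> R = {}"
  proof (rule ccontr)
    assume "(\<lambda>y. y + x) ` A \<inter> R \<noteq> {}"
    then obtain a where a: "a \<in> A" "a + x \<in> R" by auto
    then have "- a + (a + x) \<in> uminus ` A + R" by (intro set_plus_intro) auto
    then show False using x(2) by (simp add: add.assoc[symmetric])
  qed
  show ?case
  proof (intro exI[of _ "insert x X"] conjI)
    show "\<forall>x\<in>insert x X. (\<lambda>y. y + x) ` A \<inter> Q = {}" using X(4) disj by (auto simp: R_def)
    show "disjoint_family_on (\<lambda>x. (\<lambda>y. y + x) ` A) (insert x X)"
      unfolding disjoint_family_on_insert[OF x(3)] using X(5) disj by (auto simp: R_def)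
  qed (use X x in auto)
qed

lemma disjoint_right_translates:
  fixes A :: "'a::{topological_group_add,t2_space} set"
  assumes A: "compact A" and "finite J" and S: "\<And>j K. j \<in> J \<Longrightarrow> compact K \<Longrightarrow> \<not> S j \<subseteq> K"
  shows "\<exists>X. (\<forall>j\<in>J. X j \<subseteq> S j \<and> finite (X j) \<and> card (X j) = n j) \<and>
    disjoint_family_on (\<lambda>x. (\<lambda>y. y + x) ` A) (\<Union>j\<in>J. X j)"
  using assms(2,3)
proof (induction J rule: finite_induct)
  case empty
  show ?case by (simp add: disjoint_family_on_def)
next
  case (insert j J)
  have "\<exists>X. (\<forall>j\<in>J. X j \<subseteq> S j \<and> finite (X j) \<and> card (X j) = n j) \<and>
      disjoint_family_on (\<lambda>x. (\<lambda>y. y + x) ` A) (\<Union>j\<in>J. X j)"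
    by (rule insert.IH) (use insert.prems in blast)
  then obtain X where X: "\<And>i. i \<in> J \<Longrightarrow> X i \<subseteq> S i \<and> finite (X i) \<and> card (X i) = n i"
    "disjoint_family_on (\<lambda>x. (\<lambda>y. y + x) ` A) (\<Union>i\<in>J. X i)"
    by blast
  define Q where "Q = (\<Union>x\<in>(\<Union>i\<in>J. X i). (\<lambda>y. y + x) ` A)"
  have "compact Q" unfolding Q_def
    using insert.hyps(1) X(1) by (intro compact_UN compact_right_translate A) auto
  from disjoint_right_translates_one[OF A insert.prems(1) this, of j "n j"]
  obtain Y where Y: "Y \<subseteq> S j" "finite Y" "card Y = n j" "\<forall>x\<in>Y. (\<lambda>y. y + x) ` A \<inter> Q = {}"
    "disjoint_family_on (\<lambda>x. (\<lambda>y. y + x) ` A) Y" by auto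
  define X' where "X' = X(j := Y)"
  have U: "(\<Union>i\<in>insert j J. X' i) = Y \<union> (\<Union>i\<in>J. X i)"
    using insert.hyps(2) by (auto simp: X'_def)
  have "disjoint_family_on (\<lambda>x. (\<lambda>y. y + x) ` A) (Y \<union> (\<Union>i\<in>J. X i))"
    unfolding disjoint_family_on_def
  proof (intro ballI impI)
    fix a b assume ab: "a \<in> Y \<union> (\<Union>i\<in>J. X i)" "b \<in> Y \<union> (\<Union>i\<in>J. X i)" "a \<noteq> b"
    have q: "(\<lambda>y. y + x) ` A \<subseteq> Q" if "x \<in> (\<Union>i\<in>J. X i)" for x using that by (auto simp: Q_def)
    consider "a \<in> Y" "b \<in> Y" | "a \<in> (\<Union>i\<in>J. X i)" "b \<in> (\<Union>i\<in>J. X i)"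
      | "a \<in> Y" "b \<in> (\<Union>i\<in>J. X i)" | "a \<in> (\<Union>i\<in>J. X i)" "b \<in> Y" using ab by blast
    then show "(\<lambda>y. y + a) ` A \<inter> (\<lambda>y. y + b) ` A = {}"
    proof cases
      case 1 then show ?thesis using Y(5) ab(3) by (simp add: disjoint_family_on_def)
    next
      case 2 then show ?thesis using X(2) ab(3) unfolding disjoint_family_on_def by blast
    next
      case 3 then show ?thesis using Y(4) q[OF 3(2)] by blast
    next
      case 4 then show ?thesis using Y(4) q[OF 4(1)] by blast
    qed
  qed
  moreover have "\<forall>i\<in>insert j J. X' i \<subseteq> S i \<and> finite (X' i) \<and> card (X' i) = n i"
    using X(1) Y insert.hyps(2) by (auto simp: X'_def)
  ultimately show ?case using U by (intro exI[of _ X']) simp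
qed


section \<open>Approximation by Folner sets\<close>

theorem (in haar_group) TLIM_subset_TLIM0:
  assumes not_sigma: "\<And>C :: 'a set set. countable C \<Longrightarrow> (\<forall>K\<in>C. compact K) \<Longrightarrow> \<Union>C \<noteq> UNIV"
    and \<mu>: "\<mu> \<in> TLIM m" and P: "finite_measurable_partition m P" and K: "compact K"
    and \<epsilon>: "0 < \<epsilon>" "\<epsilon> < 1"
  shows "\<exists>B\<in>folner_sets m K \<epsilon>. mean_of_set m B \<in> mean_nhd m \<mu> P \<epsilon>"
proof -
  define M where "M f = Re (\<mu> (\<lambda>x. complex_of_real (f x)))" for f :: "'a \<Rightarrow> real"
  interpret invariant_mean m M
    unfolding M_def by (rule TLIM_invariant_mean[OF \<mu>])
  have \<mu>m: "\<mu> \<in> means m" using \<mu> by (simp add: TLIM_def)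
  have P_fin: "finite P" and P_lm: "\<And>E. E \<in> P \<Longrightarrow> locally_measurable m E"
    using P by (auto simp: finite_measurable_partition_def)
  obtain A where "A \<in> folner_sets m K \<epsilon>" using folner_sets_nonempty[OF K \<epsilon>(1)] by blast
  then have A: "compact A" "measure m A > 0"
    and AK: "\<And>x. x \<in> K \<Longrightarrow> measure m (sym_diff ((+) x ` A) A) < \<epsilon> * measure m A"
    by (auto simp: folner_sets_def divide_less_eq)
  define T where "T x = (\<lambda>y. y + x) ` A" for x
  define a where "a x = measure m (T x)" for x
  have Tc: "compact (T x)" for x unfolding T_def by (rule compact_right_translate[OF A(1)])
  have Tm: "T x \<in> fmeasurable m" for x by (rule fmeasurable_compact[OF Tc])
  have a_mod: "a x = modular (- x) * measure m A" for x
    unfolding a_def T_def by (rule measure_right_translate_compact[OF A(1)])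
  have a_pos: "a x > 0" for x unfolding a_mod using modular_pos A(2) by simp
  define \<phi> where "\<phi> E x = avg A E x" for E x
  have \<phi>01: "0 \<le> \<phi> E x" "\<phi> E x \<le> 1" if "E \<in> P" for E x
    unfolding \<phi>_def using avg_bounds[OF A(1) P_lm[OF that]] by blast+
  have \<phi>B: "bdd_borel (\<phi> E)" if "E \<in> P" for E
    using avg_bdd_borel[OF A(1) P_lm[OF that]] by (simp add: \<phi>_def[abs_def])
  have \<mu>E: "\<mu> (indicator E) = complex_of_real (M (\<phi> E))" if "E \<in> P" for E
  proof -
    have "\<mu> (\<lambda>x. complex_of_real (\<phi> E x)) = \<mu> (indicator E)"
      unfolding \<phi>_def by (rule TLIM_avg[OF \<mu> A P_lm[OF that]])
    moreover have "Im (\<mu> (\<lambda>x. complex_of_real (\<phi> E x))) = 0"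
      by (rule mean_real[OF \<mu>m bdd_borel_Linf[OF \<phi>B[OF that]]])
    ultimately show ?thesis by (simp add: M_def complex_eq_iff)
  qed
  have aE: "measure m (T x \<inter> E) = a x * \<phi> E x" for x E
    using a_pos[of x] by (simp add: \<phi>_def avg_def a_def T_def)

  define \<theta> where "\<theta> = \<epsilon> / 9"
  have \<theta>: "0 < \<theta>" "\<theta> < 1" "8 * \<theta> < \<epsilon>" using \<epsilon> by (auto simp: \<theta>_def)
  define \<gamma> where "\<gamma> x = restrict (\<lambda>E. \<lfloor>\<phi> E x / \<theta>\<rfloor>) P" for x
  define v where "v j E = \<theta> * of_int (j E)" for j :: "'a set \<Rightarrow> int" and E
  have v: "v (\<gamma> x) E \<le> \<phi> E x" "\<phi> E x \<le> v (\<gamma> x) E + \<theta>" if "E \<in> P" for x E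
  proof -
    have "\<theta> * of_int \<lfloor>\<phi> E x / \<theta>\<rfloor> \<le> \<theta> * (\<phi> E x / \<theta>)"
      "\<theta> * (\<phi> E x / \<theta>) \<le> \<theta> * (of_int \<lfloor>\<phi> E x / \<theta>\<rfloor> + 1)"
      using \<theta>(1) by (intro mult_left_mono; linarith)+
    then show "v (\<gamma> x) E \<le> \<phi> E x" "\<phi> E x \<le> v (\<gamma> x) E + \<theta>"
      using \<theta>(1) that by (simp_all add: v_def \<gamma>_def distrib_left)
  qed
  have v0: "0 \<le> v (\<gamma> x) E" if "E \<in> P" for x E
    using \<theta>(1) \<phi>01(1)[OF that, of x] that by (simp add: v_def \<gamma>_def)
  define C where "C j = {x. \<gamma> x = j}" for j
  define \<Gamma> where "\<Gamma> = range \<gamma>"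
  have \<Gamma>: "finite \<Gamma>"
  proof (rule finite_subset)
    show "\<Gamma> \<subseteq> PiE P (\<lambda>_. {0..\<lfloor>1 / \<theta>\<rfloor>})"
    proof
      fix j assume "j \<in> \<Gamma>"
      then obtain x where x: "j = \<gamma> x" by (auto simp: \<Gamma>_def)
      have "\<lfloor>\<phi> E x / \<theta>\<rfloor> \<in> {0..\<lfloor>1 / \<theta>\<rfloor>}" if "E \<in> P" for E
        using \<phi>01[OF that, of x] \<theta>(1) by (auto intro!: floor_mono divide_right_mono)
      then show "j \<in> PiE P (\<lambda>_. {0..\<lfloor>1 / \<theta>\<rfloor>})" by (auto simp: x \<gamma>_def)
    qed
  qed (intro finite_PiE P_fin finite_atLeastAtMost_int)
  have Cs: "C j \<in> sets borel" if "j \<in> \<Gamma>" for j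
  proof -
    have "C j = (\<Inter>E\<in>P. {x. \<lfloor>\<phi> E x / \<theta>\<rfloor> = j E})" if "j \<in> extensional P"
      using that by (auto simp: C_def \<gamma>_def fun_eq_iff restrict_def extensional_def)
    moreover have "j \<in> extensional P" using that by (auto simp: \<Gamma>_def \<gamma>_def)
    moreover have "{x. \<lfloor>\<phi> E x / \<theta>\<rfloor> = j E} \<in> sets borel" if "E \<in> P" for E
    proof -
      have [measurable]: "\<phi> E \<in> borel_measurable borel" using \<phi>B[OF that] by (simp add: bdd_borel_def)
      show ?thesis by measurable
    qed
    ultimately show ?thesis using P_fin by (cases "P = {}") auto
  qed
  have CB: "bdd_borel (indicator (C j))" if "j \<in> \<Gamma>" for j by (rule bdd_borel_indicator[OF Cs[OF that]])
  define c where "c j = M (indicator (C j))" for j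
  have c0: "c j \<ge> 0" if "j \<in> \<Gamma>" for j
    using M_mono[OF bdd_borel_const[of 0] CB[OF that]] by (simp add: c_def M_const)
  have sum_C: "(\<Sum>j\<in>\<Gamma>. w j * indicator (C j) x) = w (\<gamma> x)" for w :: "_ \<Rightarrow> real" and x
  proof -
    have "(\<Sum>j\<in>\<Gamma>. w j * indicator (C j) x) = (\<Sum>j\<in>\<Gamma>. if \<gamma> x = j then w j else 0)"
      by (intro sum.cong) (auto simp: C_def indicator_def)
    then show ?thesis using \<Gamma> by (simp add: \<Gamma>_def)
  qed
  have Msum: "M (\<lambda>x. w (\<gamma> x)) = (\<Sum>j\<in>\<Gamma>. w j * c j)" for w :: "_ \<Rightarrow> real"
    unfolding sum_C[symmetric] c_def using \<Gamma> CB by (subst M_sum) (auto simp: M_scale bdd_borel_scale)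
  have wB: "bdd_borel (\<lambda>x. w (\<gamma> x))" for w :: "_ \<Rightarrow> real"
    unfolding sum_C[symmetric] by (intro bdd_borel_sum bdd_borel_scale \<Gamma> CB)
  have c1: "(\<Sum>j\<in>\<Gamma>. c j) = 1" using Msum[of "\<lambda>_. 1"] by (simp add: M_const)
  define J where "J = {j\<in>\<Gamma>. c j > 0}"
  have J: "finite J" "J \<subseteq> \<Gamma>" using \<Gamma> by (auto simp: J_def)
  have sumJ: "(\<Sum>j\<in>\<Gamma>. w j * c j) = (\<Sum>j\<in>J. w j * c j)" for w :: "_ \<Rightarrow> real"
    using \<Gamma> c0 by (intro sum.mono_neutral_right) (force simp: J_def less_le)+
  have c1J: "(\<Sum>j\<in>J. c j) = 1" using sumJ[of "\<lambda>_. 1"] c1 by simp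
  then have J_ne: "J \<noteq> {}" by auto

  define V where "V E = (\<Sum>j\<in>J. v j E * c j)" for E
  have V: "\<bar>M (\<phi> E) - V E\<bar> \<le> \<theta>" if E: "E \<in> P" for E
  proof -
    have "\<bar>M (\<phi> E) - M (\<lambda>x. v (\<gamma> x) E)\<bar> \<le> \<theta>"
    proof (rule M_close[OF \<phi>B[OF E] wB])
      fix x show "\<bar>\<phi> E x - v (\<gamma> x) E\<bar> \<le> \<theta>" using v[OF E, of x] \<theta>(1) by (simp add: abs_le_iff)
    qed
    then show ?thesis using Msum[of "\<lambda>j. v j E"] sumJ[of "\<lambda>j. v j E"] by (simp add: V_def)
  qed
  have vJ: "0 \<le> v j E" "v j E \<le> 1" if "E \<in> P" "j \<in> J" for E j
  proof -
    obtain x where "j = \<gamma> x" using \<open>j \<in> J\<close> J(2) by (auto simp: \<Gamma>_def)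
    then show "0 \<le> v j E" "v j E \<le> 1"
      using v0[OF that(1), of x] v(1)[OF that(1), of x] \<phi>01(2)[OF that(1), of x] by auto
  qed
  have V01: "0 \<le> V E" "V E \<le> 1" if E: "E \<in> P" for E
  proof -
    show "0 \<le> V E" unfolding V_def using vJ[OF E] by (intro sum_nonneg mult_nonneg_nonneg) (auto simp: J_def)
    have "V E \<le> (\<Sum>j\<in>J. 1 * c j)" unfolding V_def using vJ[OF E]
      by (intro sum_mono mult_right_mono) (auto simp: J_def)
    then show "V E \<le> 1" using c1J by simp
  qed

  have "\<exists>i :: int. \<forall>K. compact K \<longrightarrow>
      \<not> {x\<in>C j. (1 + \<theta>) powr of_int i \<le> a x \<and> a x < (1 + \<theta>) * (1 + \<theta>) powr of_int i} \<subseteq> K"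
    if j: "j \<in> J" for j
  proof (rule ccontr)
    assume "\<not> ?thesis"
    then have "\<forall>i :: int. \<exists>K. compact K \<and>
      {x\<in>C j. (1 + \<theta>) powr of_int i \<le> a x \<and> a x < (1 + \<theta>) * (1 + \<theta>) powr of_int i} \<subseteq> K" by blast
    from choice[OF this] obtain Q :: "int \<Rightarrow> 'a set" where Q: "\<And>i. compact (Q i)"
      "\<And>i. {x\<in>C j. (1 + \<theta>) powr of_int i \<le> a x \<and> a x < (1 + \<theta>) * (1 + \<theta>) powr of_int i} \<subseteq> Q i"
      by blast
    have "C j \<subseteq> \<Union>(range Q)"
    proof
      fix x assume "x \<in> C j"
      moreover obtain i :: int where "(1 + \<theta>) powr of_int i \<le> a x" "a x < (1 + \<theta>) * (1 + \<theta>) powr of_int i"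
        using real_powr_interval[of "1 + \<theta>" "a x"] \<theta>(1) a_pos[of x] by auto
      ultimately show "x \<in> \<Union>(range Q)" using Q(2)[of i] by blast
    qed
    moreover have "countable (range Q)" by simp
    ultimately have "M (indicator (C j)) = 0"
      using Q(1) j J(2) by (intro M_indicator_null[OF not_sigma Cs]) auto
    then show False using j by (simp add: J_def c_def)
  qed
  then have "\<forall>j. \<exists>i :: int. j \<in> J \<longrightarrow> (\<forall>K. compact K \<longrightarrow>
      \<not> {x\<in>C j. (1 + \<theta>) powr of_int i \<le> a x \<and> a x < (1 + \<theta>) * (1 + \<theta>) powr of_int i} \<subseteq> K)" by blast
  from choice[OF this] obtain i :: "('a set \<Rightarrow> int) \<Rightarrow> int" where i: "\<forall>j. j \<in> J \<longrightarrow> (\<forall>K. compact K \<longrightarrow>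
      \<not> {x\<in>C j. (1 + \<theta>) powr of_int (i j) \<le> a x \<and> a x < (1 + \<theta>) * (1 + \<theta>) powr of_int (i j)} \<subseteq> K)" ..
  define s where "s j = (1 + \<theta>) powr of_int (i j)" for j
  define S where "S j = {x\<in>C j. s j \<le> a x \<and> a x < (1 + \<theta>) * s j}" for j
  have s_pos: "s j > 0" for j using \<theta>(1) by (simp add: s_def)
  have S: "\<not> S j \<subseteq> K" if "j \<in> J" "compact K" for j K
    using i that by (simp add: S_def s_def)
  define R where "R = (\<Sum>j\<in>J. s j / (\<theta> * c j))"
  have R: "s j \<le> \<theta> * c j * R" if "j \<in> J" for j
  proof -
    have cj: "c j > 0" using that by (simp add: J_def)
    have "s j / (\<theta> * c j) \<le> R" unfolding R_def
      using that J s_pos \<theta>(1) c0 by (intro member_le_sum) (auto simp: J_def less_imp_le)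
    then show ?thesis using cj \<theta>(1) by (simp add: divide_le_eq mult.commute)
  qed
  have R_pos: "R > 0" unfolding R_def
    using J J_ne s_pos \<theta>(1) by (intro sum_pos divide_pos_pos) (auto simp: J_def)
  define n where "n j = nat \<lceil>c j * R / s j\<rceil>" for j
  have n: "c j * R \<le> real (n j) * s j" "real (n j) * s j \<le> (1 + \<theta>) * (c j * R)" if "j \<in> J" for j
  proof -
    have q: "0 \<le> c j * R / s j" using that R_pos s_pos[of j] by (simp add: J_def less_imp_le)
    then have "c j * R / s j \<le> real (n j)" "real (n j) \<le> c j * R / s j + 1"
      unfolding n_def by (simp_all add: of_nat_nat)
    then show "c j * R \<le> real (n j) * s j" "real (n j) * s j \<le> (1 + \<theta>) * (c j * R)"
      using s_pos[of j] R[OF that] by (simp_all add: field_simps)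
  qed
  obtain X where X: "\<And>j. j \<in> J \<Longrightarrow> X j \<subseteq> S j" "\<And>j. j \<in> J \<Longrightarrow> finite (X j)" "\<And>j. j \<in> J \<Longrightarrow> card (X j) = n j"
    and X_disj: "disjoint_family_on T (\<Union>j\<in>J. X j)"
  proof -
    have "\<exists>X. (\<forall>j\<in>J. X j \<subseteq> S j \<and> finite (X j) \<and> card (X j) = n j) \<and>
        disjoint_family_on T (\<Union>j\<in>J. X j)"
      unfolding T_def[abs_def] by (rule disjoint_right_translates[OF A(1) J(1)]) (rule S)
    then show ?thesis using that by blast
  qed
  define Y where "Y = (\<Union>j\<in>J. X j)"
  have Y: "finite Y" unfolding Y_def using J X by blast
  have sumY: "(\<Sum>x\<in>Y. h x) = (\<Sum>j\<in>J. \<Sum>x\<in>X j. h x)" for h :: "'a \<Rightarrow> real"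
    unfolding Y_def
  proof (rule sum.UNION_disjoint)
    show "\<forall>i\<in>J. \<forall>j\<in>J. i \<noteq> j \<longrightarrow> X i \<inter> X j = {}"
    proof (intro ballI impI)
      fix i j assume ij: "i \<in> J" "j \<in> J" "i \<noteq> j"
      have "S i \<inter> S j = {}" using ij(3) by (auto simp: S_def C_def)
      then show "X i \<inter> X j = {}" using X(1)[OF ij(1)] X(1)[OF ij(2)] by blast
    qed
  qed (use J X in auto)
  define B where "B = (\<Union>x\<in>Y. T x)"
  have B: "compact B" unfolding B_def using Y Tc by (intro compact_UN)
  have disjY: "disjoint_family_on T Y" using X_disj by (simp add: Y_def)
  have mUN: "measure m (\<Union>x\<in>Y. F x) = (\<Sum>x\<in>Y. measure m (F x))"
    if F: "\<And>x. F x \<in> sets borel" "\<And>x. F x \<subseteq> T x" for F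
  proof (rule measure_UNION'[OF Y])
    show "F x \<in> fmeasurable m" for x by (rule fmeasurable_subset_compact[OF F Tc])
    show "pairwise (\<lambda>i j. disjnt (F i) (F j)) Y"
      using disjY F(2) by (fastforce simp: pairwise_def disjnt_def disjoint_family_on_def)
  qed
  have mB: "measure m B = (\<Sum>x\<in>Y. a x)"
    unfolding B_def a_def by (rule mUN) (auto intro: compact_in_borel Tc)
  have mBE: "measure m (B \<inter> E) = (\<Sum>x\<in>Y. a x * \<phi> E x)" if E: "E \<in> P" for E
  proof -
    have "E \<inter> T x \<in> sets borel" for x
      using P_lm[OF E] Tm[of x] by (simp add: locally_measurable_def fmeasurable_def)
    then have "T x \<inter> E \<in> sets borel" for x by (simp add: Int_commute)
    then have "measure m (\<Union>x\<in>Y. T x \<inter> E) = (\<Sum>x\<in>Y. measure m (T x \<inter> E))" by (intro mUN) auto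
    moreover have "B \<inter> E = (\<Union>x\<in>Y. T x \<inter> E)" by (auto simp: B_def)
    ultimately show ?thesis by (simp add: aE)
  qed
  define \<alpha> where "\<alpha> j = (\<Sum>x\<in>X j. a x)" for j
  have \<alpha>: "c j * R \<le> \<alpha> j" "\<alpha> j \<le> c j * R + 3 * \<theta> * (c j * R)" if j: "j \<in> J" for j
  proof -
    have "real (n j) * s j \<le> \<alpha> j"
      unfolding \<alpha>_def X(3)[OF j, symmetric] using X(1)[OF j] by (intro sum_bounded_below) (auto simp: S_def)
    then show "c j * R \<le> \<alpha> j" using n(1)[OF j] by linarith
    have "\<alpha> j \<le> real (n j) * ((1 + \<theta>) * s j)"
      unfolding \<alpha>_def X(3)[OF j, symmetric] using X(1)[OF j]
      by (intro sum_bounded_above) (auto simp: S_def intro: less_imp_le)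
    also have "\<dots> = (1 + \<theta>) * (real (n j) * s j)" by simp
    also have "\<dots> \<le> (1 + \<theta>) * ((1 + \<theta>) * (c j * R))"
      using n(2)[OF j] \<theta>(1) by (intro mult_left_mono) auto
    also have "\<dots> = (1 + 2 * \<theta> + \<theta> * \<theta>) * (c j * R)" by (simp add: algebra_simps)
    also have "\<dots> \<le> (1 + 3 * \<theta>) * (c j * R)"
      using \<theta> R_pos c0 j J(2) by (intro mult_right_mono mult_nonneg_nonneg) (auto simp: less_imp_le)
    finally show "\<alpha> j \<le> c j * R + 3 * \<theta> * (c j * R)" by (simp add: algebra_simps)
  qed
  have mB\<alpha>: "measure m B = (\<Sum>j\<in>J. \<alpha> j)" by (simp add: mB sumY \<alpha>_def)
  have sumR: "(\<Sum>j\<in>J. c j * R) = R" using c1J by (simp flip: sum_distrib_right)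
  have mB_ge: "R \<le> measure m B"
    using sum_mono[of J "\<lambda>j. c j * R" \<alpha>] \<alpha>(1) by (simp add: mB\<alpha> sumR)
  have mB_le: "measure m B \<le> R + 3 * \<theta> * R"
    using sum_mono[of J \<alpha> "\<lambda>j. c j * R + 3 * \<theta> * (c j * R)"] \<alpha>(2)
    by (simp add: mB\<alpha> sumR sum.distrib flip: sum_distrib_left)
  have mB_pos: "measure m B > 0" using mB_ge R_pos by linarith

  have fol: "B \<in> folner_sets m K \<epsilon>"
  proof -
    have "measure m (sym_diff ((+) x ` B) B) < \<epsilon> * measure m B" if x: "x \<in> K" for x
    proof -
      let ?D = "sym_diff ((+) x ` A) A"
      let ?F = "\<lambda>y. (\<lambda>z. z + y) ` ?D"
      have Dc: "?D \<subseteq> (+) x ` A \<union> A" "compact ((+) x ` A \<union> A)" "?D \<in> sets borel"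
        using compact_left_translate[OF A(1), of x] A(1) compact_in_borel[OF A(1)]
          compact_in_borel[OF compact_left_translate[OF A(1), of x]]
        by (auto intro: compact_Un)
      have F: "?F y \<in> fmeasurable m" for y
        using Dc by (intro fmeasurable_subset_compact[of _ "(\<lambda>z. z + y) ` ((+) x ` A \<union> A)"]
            borel_right_translate compact_right_translate image_mono)
      have "sym_diff ((+) x ` B) B \<subseteq> (\<Union>y\<in>Y. ?F y)"
      proof
        fix z assume z: "z \<in> sym_diff ((+) x ` B) B"
        then obtain y where y: "y \<in> Y" "z \<in> sym_diff ((+) x ` T y) (T y)"
          by (auto simp: B_def)
        then have "z - y \<in> ?D"
          by (auto simp: T_def left_translate_eq_vimage right_translate_eq_vimage add_diff_eq)
        then show "z \<in> (\<Union>y\<in>Y. ?F y)"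
          using y(1) by (intro UN_I[of y] image_eqI[of _ _ "z - y"]) auto
      qed
      moreover have "sym_diff ((+) x ` B) B \<in> sets borel"
        using compact_in_borel[OF compact_left_translate[OF B]] compact_in_borel[OF B] by auto
      moreover have "(\<Union>y\<in>Y. ?F y) \<in> fmeasurable m"
        using F Y by (intro fmeasurable.finite_UN)
      ultimately have "measure m (sym_diff ((+) x ` B) B) \<le> measure m (\<Union>y\<in>Y. ?F y)"
        by (intro measure_mono_fmeasurable) auto
      also have "\<dots> \<le> (\<Sum>y\<in>Y. measure m (?F y))"
        using Y by (intro measure_UNION_le fmeasurableD F)
      also have "\<dots> < (\<Sum>y\<in>Y. \<epsilon> * a y)"
      proof (rule sum_strict_mono[OF Y])
        show "Y \<noteq> {}" using mB_pos by (auto simp: B_def)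
        fix y
        have "measure m (?F y) = modular (- y) * measure m ?D"
          by (rule measure_right_translate[OF Dc(3,1,2)])
        also have "\<dots> < modular (- y) * (\<epsilon> * measure m A)"
          using AK[OF x] modular_pos by (intro mult_strict_left_mono)
        finally show "measure m (?F y) < \<epsilon> * a y" by (simp add: a_mod mult.left_commute)
      qed
      also have "\<dots> = \<epsilon> * measure m B" by (simp add: mB sum_distrib_left)
      finally show ?thesis .
    qed
    then show ?thesis using B mB_pos by (simp add: folner_sets_def divide_less_eq)
  qed

  have close: "\<bar>M (\<phi> E) - measure m (B \<inter> E) / measure m B\<bar> < \<epsilon>" if E: "E \<in> P" for E
  proof -
    have "\<bar>measure m (B \<inter> E) - (\<Sum>j\<in>J. v j E * \<alpha> j)\<bar> \<le> \<theta> * measure m B"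
    proof -
      have "measure m (B \<inter> E) - (\<Sum>j\<in>J. v j E * \<alpha> j) = (\<Sum>j\<in>J. \<Sum>x\<in>X j. a x * (\<phi> E x - v j E))"
        by (simp add: mBE[OF E] sumY \<alpha>_def sum_distrib_left right_diff_distrib sum_subtractf mult.commute)
      also have "\<bar>\<dots>\<bar> \<le> (\<Sum>j\<in>J. \<bar>\<Sum>x\<in>X j. a x * (\<phi> E x - v j E)\<bar>)" by (rule sum_abs)
      also have "\<dots> \<le> (\<Sum>j\<in>J. \<theta> * \<alpha> j)"
      proof (rule sum_mono)
        fix j assume j: "j \<in> J"
        have "\<bar>\<Sum>x\<in>X j. a x * (\<phi> E x - v j E)\<bar> \<le> (\<Sum>x\<in>X j. \<bar>a x * (\<phi> E x - v j E)\<bar>)" by (rule sum_abs)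
        also have "\<dots> \<le> (\<Sum>x\<in>X j. \<theta> * a x)"
        proof (rule sum_mono)
          fix x assume "x \<in> X j"
          then have "j = \<gamma> x" using X(1)[OF j] by (auto simp: S_def C_def)
          then have "\<bar>\<phi> E x - v j E\<bar> \<le> \<theta>" using v[OF E, of x] \<theta>(1) by (simp add: abs_le_iff)
          then show "\<bar>a x * (\<phi> E x - v j E)\<bar> \<le> \<theta> * a x"
            using a_pos[of x] by (simp add: abs_mult mult.commute mult_left_mono)
        qed
        finally show "\<bar>\<Sum>x\<in>X j. a x * (\<phi> E x - v j E)\<bar> \<le> \<theta> * \<alpha> j"
          by (simp add: \<alpha>_def sum_distrib_left)
      qed
      finally show ?thesis by (simp add: mB\<alpha> sum_distrib_left)
    qed
    moreover have "\<bar>(\<Sum>j\<in>J. v j E * \<alpha> j) - R * V E\<bar> \<le> 3 * \<theta> * R"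
    proof -
      have "(\<Sum>j\<in>J. v j E * \<alpha> j) - R * V E = (\<Sum>j\<in>J. v j E * (\<alpha> j - c j * R))"
        by (simp add: V_def sum_distrib_left right_diff_distrib sum_subtractf algebra_simps)
      also have "\<bar>\<dots>\<bar> \<le> (\<Sum>j\<in>J. \<bar>v j E * (\<alpha> j - c j * R)\<bar>)" by (rule sum_abs)
      also have "\<dots> \<le> (\<Sum>j\<in>J. 1 * (3 * \<theta> * (c j * R)))"
      proof (rule sum_mono)
        fix j assume j: "j \<in> J"
        have "\<bar>\<alpha> j - c j * R\<bar> \<le> 3 * \<theta> * (c j * R)"
          using \<alpha>[OF j] by (simp only: abs_of_nonneg diff_ge_0_iff_ge diff_le_eq add.commute)
        then show "\<bar>v j E * (\<alpha> j - c j * R)\<bar> \<le> 1 * (3 * \<theta> * (c j * R))"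
          unfolding abs_mult using vJ[OF E j] by (intro mult_mono) auto
      qed
      also have "\<dots> = 3 * \<theta> * R" by (simp add: sumR flip: sum_distrib_left)
      finally show ?thesis .
    qed
    moreover have "\<bar>R * V E - measure m B * V E\<bar> \<le> 3 * \<theta> * R"
    proof -
      have "\<bar>R - measure m B\<bar> * \<bar>V E\<bar> \<le> (3 * \<theta> * R) * 1"
        using mB_ge mB_le V01[OF E] R_pos \<theta>(1) by (intro mult_mono) auto
      then show ?thesis by (simp add: abs_mult flip: left_diff_distrib)
    qed
    ultimately have "\<bar>measure m (B \<inter> E) - measure m B * V E\<bar> \<le> \<theta> * measure m B + 6 * \<theta> * R"
      by linarith
    also have "\<dots> \<le> \<theta> * measure m B + 6 * \<theta> * measure m B"
      using mB_ge \<theta>(1) by simp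
    finally have "\<bar>measure m (B \<inter> E) - measure m B * V E\<bar> \<le> 7 * \<theta> * measure m B" by simp
    moreover have "measure m (B \<inter> E) / measure m B - V E = (measure m (B \<inter> E) - measure m B * V E) / measure m B"
      using mB_pos by (simp add: diff_divide_distrib)
    ultimately have "\<bar>measure m (B \<inter> E) / measure m B - V E\<bar> \<le> 7 * \<theta>"
      using mB_pos by (simp add: divide_le_eq)
    then show ?thesis using V[OF E] \<theta>(3) by linarith
  qed
  have "mean_of_set m B \<in> mean_nhd m \<mu> P \<epsilon>"
    unfolding mean_nhd_def
  proof (intro CollectI conjI ballI)
    show "mean_of_set m B \<in> means m" by (rule mean_of_set_means[OF B mB_pos])
    fix E assume E: "E \<in> P"
    have "cmod (\<mu> (indicator E) - mean_of_set m B (indicator E))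
        = cmod (complex_of_real (M (\<phi> E) - measure m (B \<inter> E) / measure m B))"
      by (simp add: \<mu>E[OF E] mean_of_set_indicator[OF B mB_pos P_lm[OF E]])
    then show "cmod (\<mu> (indicator E) - mean_of_set m B (indicator E)) < \<epsilon>"
      using close[OF E] by (simp only: norm_of_real)
  qed
  with fol show ?thesis by blast
qed

theorem mainTheorem11:
  fixes m :: "'a::{topological_group_add,t2_space} measure"
  assumes "locally_compact_space (euclidean :: 'a topology)"
    and "left_haar_measure m"
    and "natLeq <o (compact_covering_number :: 'a set rel)"
  shows "TLIM0 m = TLIM m"
proof -
  interpret haar_group m using assms(1,2) by unfold_locales
  show ?thesis
  proof
    show "TLIM0 m \<subseteq> TLIM m" by (auto simp: TLIM0_def)
    show "TLIM m \<subseteq> TLIM0 m"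
      using TLIM_subset_TLIM0[OF not_sigma_compact[OF assms(3)]] by (auto simp: TLIM0_def)
  qed
qed

end
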